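(* Let $\mathfrak{M}$, $A$, $B$, $\sigma$, $\pi$, $R$, $i$, $p$, $m_R,u_R,\Delta_R,\varepsilon_R,\xi$ be as in the context (a bialgebra $A$ in an abelian and coabelian braided monoidal category with a right weak projection $\pi$ onto a sub-bialgebra $B$ with antipode, and the associated data). Assume moreover that $A$ is cocommutative, i.e. $c_{A,A}\Delta_A=\Delta_A$, and that $\xi$ is trivial, i.e. $\xi=u_B m_{\mathbf 1}(\varepsilon_R\otimes\varepsilon_R)$. Then $(R,B,\vartriangleright,\vartriangleleft)$ is a matched pair of bialgebras in $\mathfrak{M}$ such that $A\simeq R\Join B$ as bialgebras, where $$\vartriangleright:=p\,m_A(\sigma\otimes i):B\otimes R\to R\qquad\text{and}\qquad\vartriangleleft:=\pi\,m_A(\sigma\otimes i):B\otimes R\to B .$$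
   Context: Conventions: associativity constraints are suppressed; an object used as a morphism denotes its identity; $l_X:\mathbf{1}\otimes X\to X$ and $r_X:X\otimes\mathbf{1}\to X$ are the unit constraints; $m_{\mathbf 1}:\mathbf 1\otimes\mathbf 1\to\mathbf 1$ is the canonical isomorphism and $\Delta_{\mathbf 1}$ its inverse. $(\mathfrak{M},\otimes,\mathbf{1},c)$ is an abelian and coabelian braided monoidal category: $\mathfrak{M}$ is an abelian category and for every $X$ the functors $X\otimes(-)$ and $(-)\otimes X$ are additive, right exact (abelian) and left exact (coabelian). The braiding is a natural isomorphism $c_{X,Y}:X\otimes Y\to Y\otimes X$ with $c_{X\otimes Y,Z}=(c_{X,Z}\otimes Y)(X\otimes c_{Y,Z})$ and $c_{X,Y\otimes Z}=(Y\otimes c_{X,Z})(c_{X,Y}\otimes Z)$. A bialgebra $(B,m,u,\Delta,\varepsilon)$ in $\mathfrak{M}$ is an algebra and a coalgebra with $\Delta m=(m\otimes m)(B\otimes c_{B,B}\otimes B)(\Delta\otimes\Delta)$, $\varepsilon m=m_{\mathbf 1}(\varepsilon\otimes\varepsilon)$, $\Delta u=(u\otimes u)\Delta_{\mathbf 1}$, $\varepsilon u=\mathrm{Id}_{\mathbf 1}$. An antipode is $S:B\to B$ with $m(S\otimes B)\Delta=u\varepsilon=m(B\otimes S)\Delta$. Setting: $(A,m_A,u_A,\Delta_A,\varepsilon_A)$ is a bialgebra in $\mathfrak{M}$; $(B,m_B,u_B,\Delta_B,\varepsilon_B)$ is a sub-bialgebra of $A$ with an antipode $S_B$; $\sigma:B\to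 A$ is the canonical inclusion (a bialgebra morphism and a monomorphism); $\pi:A\to B$ is a right weak projection onto $B$, i.e. a coalgebra homomorphism with $\pi m_A(A\otimes\sigma)=m_B(\pi\otimes B)$ (right $B$-linearity) and $\pi\sigma=\mathrm{Id}_B$. Put $\Phi:=\sigma S_B\pi$ and $\Pi_2:=m_A(A\otimes\Phi)\Delta_A$. $(R,i)$, $i:R\to A$, is the equalizer of $(A\otimes\pi)\Delta_A$ and $(A\otimes u_B)r_A^{-1}$ from $A$ to $A\otimes B$; $p:A\to R$ is the unique morphism such that $ip=\Pi_2$ and $pi=\mathrm{Id}_R$ (it exists). Data: $m_R:=p\,m_A(i\otimes i)$, $u_R:=p\,u_A$, $\Delta_R:=(p\otimes p)\Delta_A i$, $\varepsilon_R:=\varepsilon_A i$, $\xi:=\pi m_A(i\otimes i):R\otimes R\to B$. In the claim $R$ is considered with the structure $(m_R,u_R,\Delta_R,\varepsilon_R)$. For bialgebras $R,B$, put $\Delta_{B\otimes R}=(B\otimes c_{B,R}\otimes R)(\Delta_B\otimes\Delta_R)$, $\varepsilon_{B\otimes R}=m_{\mathbf 1}(\varepsilon_B\otimes\varepsilon_R)$. Matched pair: $(R,B,\vartriangleright,\vartriangleleft)$ is a matched pair of bialgebras if $R$ and $B$ are bialgebras in $\mathfrak{M}$, $\vartriangleright:B\otimes R\to R$, $\vartriangleleft:B\otimes R\to B$, and (1) $(R,\Delta_R,\varepsilon_R,\vartriangleright)$ is a left $B$-module coalgebra (i.e. $\vartriangleright$ is a left action of the algebra $B$ and a coalgebra morphism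 $B\otimes R\to R$); (2) $(B,\Delta_B,\varepsilon_B,\vartriangleleft)$ is a right $R$-module coalgebra (i.e. $\vartriangleleft$ is a right action of the algebra $R$ and a coalgebra morphism $B\otimes R\to B$); (3) $\vartriangleleft(u_B\otimes R)=u_B\varepsilon_R l_R$; (4) $\vartriangleright(B\otimes u_R)=u_R\varepsilon_B r_B$; (5) $m_B(\vartriangleleft\otimes B)(B\otimes\vartriangleright\otimes\vartriangleleft)(B\otimes\Delta_{B\otimes R})=\vartriangleleft(m_B\otimes R)$; (6) $m_R(R\otimes\vartriangleright)(\vartriangleright\otimes\vartriangleleft\otimes R)(\Delta_{B\otimes R}\otimes R)=\vartriangleright(B\otimes m_R)$; (7) $(\vartriangleleft\otimes\vartriangleright)\Delta_{B\otimes R}=c_{R,B}(\vartriangleright\otimes\vartriangleleft)\Delta_{B\otimes R}$. Double cross product: for a matched pair, $R\Join B$ is the bialgebra on $R\otimes B$ with $m_{R\Join B}=(m_R\otimes m_B)(R\otimes\vartriangleright\otimes\vartriangleleft\otimes B)(R\otimes B\otimes c_{B,R}\otimes R\otimes B)(R\otimes\Delta_B\otimes\Delta_R\otimes B)$, $u_{R\Join B}=(u_R\otimes u_B)\Delta_{\mathbf 1}$, $\Delta_{R\Join B}=(R\otimes c_{R,B}\otimes B)(\Delta_R\otimes\Delta_B)$, $\varepsilon_{R\Join B}=m_{\mathbf 1}(\varepsilon_R\otimes\varepsilon_B)$. *)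

theory Defs
  imports "HOL-Algebra.Group"
begin

text \<open>
  Composition \<open>g \<cdot> f\<close> is written in the usual order (first \<open>f\<close>), and \<open>\<langle>X\<rangle>\<close> is the identity of the
  object \<open>X\<close>.  Monoidal categories are not assumed to be strict: all associativity constraints,
  which the source suppresses, are inserted explicitly.
\<close>

no_notation mult (infixl \<open>\<otimes>\<index>\<close> 70)

section \<open>Categories\<close>

record ('o, 'a) cat =
  Obj :: "'o set"
  Arr :: "'a set"
  Dom :: "'a \<Rightarrow> 'o"
  Cod :: "'a \<Rightarrow> 'o"
  Ident :: "'o \<Rightarrow> 'a"  (\<open>\<langle>_\<rangle>\<index>\<close>)
  Comp :: "'a \<Rightarrow> 'a \<Rightarrow> 'a"  (infixr \<open>\<cdot>\<index>\<close> 55)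

definition Hom :: "('o, 'a, 'm) cat_scheme \<Rightarrow> 'o \<Rightarrow> 'o \<Rightarrow> 'a set" where
  "Hom M X Y = {f \<in> Arr M. Dom M f = X \<and> Cod M f = Y}"

locale category =
  fixes M :: "('o, 'a, 'm) cat_scheme" (structure)
  assumes dom_cod: "f \<in> Arr M \<Longrightarrow> Dom M f \<in> Obj M \<and> Cod M f \<in> Obj M"
    and ident_in_Hom: "X \<in> Obj M \<Longrightarrow> \<langle>X\<rangle> \<in> Hom M X X"
    and comp_in_Hom: "f \<in> Hom M X Y \<Longrightarrow> g \<in> Hom M Y Z \<Longrightarrow> g \<cdot> f \<in> Hom M X Z"
    and comp_ident: "f \<in> Hom M X Y \<Longrightarrow> \<langle>Y\<rangle> \<cdot> f = f \<and> f \<cdot> \<langle>X\<rangle> = f"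
    and comp_assoc: "f \<in> Hom M W X \<Longrightarrow> g \<in> Hom M X Y \<Longrightarrow> h \<in> Hom M Y Z
      \<Longrightarrow> (h \<cdot> g) \<cdot> f = h \<cdot> (g \<cdot> f)"

context
  fixes M :: "('o, 'a, 'm) cat_scheme" (structure)
begin

definition inverse_arrows :: "'a \<Rightarrow> 'a \<Rightarrow> bool" where
  "inverse_arrows f g \<longleftrightarrow> f \<in> Arr M \<and> g \<in> Hom M (Cod M f) (Dom M f)
     \<and> g \<cdot> f = \<langle>Dom M f\<rangle> \<and> f \<cdot> g = \<langle>Cod M f\<rangle>"

definition isomorphism :: "'a \<Rightarrow> bool" where
  "isomorphism f \<longleftrightarrow> (\<exists>g. inverse_arrows f g)"

definition inverse_arrow :: "'a \<Rightarrow> 'a" where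
  "inverse_arrow f = (THE g. inverse_arrows f g)"

definition monomorphism :: "'a \<Rightarrow> bool" where
  "monomorphism f \<longleftrightarrow> f \<in> Arr M \<and>
     (\<forall>X. \<forall>g \<in> Hom M X (Dom M f). \<forall>h \<in> Hom M X (Dom M f). f \<cdot> g = f \<cdot> h \<longrightarrow> g = h)"

definition epimorphism :: "'a \<Rightarrow> bool" where
  "epimorphism f \<longleftrightarrow> f \<in> Arr M \<and>
     (\<forall>X. \<forall>g \<in> Hom M (Cod M f) X. \<forall>h \<in> Hom M (Cod M f) X. g \<cdot> f = h \<cdot> f \<longrightarrow> g = h)"

definition is_equalizer :: "'a \<Rightarrow> 'a \<Rightarrow> 'a \<Rightarrow> bool" where
  "is_equalizer e f g \<longleftrightarrow> e \<in> Arr M \<and> f \<in> Hom M (Cod M e) (Cod M f) \<and> g \<in> Hom M (Cod M e) (Cod M f)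
     \<and> f \<cdot> e = g \<cdot> e
     \<and> (\<forall>X. \<forall>h \<in> Hom M X (Cod M e). f \<cdot> h = g \<cdot> h \<longrightarrow>
          (\<exists>!k. k \<in> Hom M X (Dom M e) \<and> e \<cdot> k = h))"

definition zero_object :: "'o \<Rightarrow> bool" where
  "zero_object Z \<longleftrightarrow> Z \<in> Obj M \<and>
     (\<forall>X \<in> Obj M. (\<exists>!f. f \<in> Hom M Z X) \<and> (\<exists>!f. f \<in> Hom M X Z))"

end


section \<open>Abelian categories\<close>

record ('o, 'a) preadditive_cat = "('o, 'a) cat" +
  Add :: "'a \<Rightarrow> 'a \<Rightarrow> 'a"  (infixl \<open>\<oplus>\<index>\<close> 65)
  Zero :: "'o \<Rightarrow> 'o \<Rightarrow> 'a"

locale preadditive_category = category M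
  for M :: "('o, 'a, 'm) preadditive_cat_scheme" (structure) +
  assumes hom_group: "X \<in> Obj M \<Longrightarrow> Y \<in> Obj M \<Longrightarrow>
      comm_group \<lparr>carrier = Hom M X Y, mult = Add M, one = Zero M X Y\<rparr>"
    and comp_add_left: "f \<in> Hom M X Y \<Longrightarrow> g \<in> Hom M Y Z \<Longrightarrow> h \<in> Hom M Y Z
      \<Longrightarrow> (g \<oplus> h) \<cdot> f = (g \<cdot> f) \<oplus> (h \<cdot> f)"
    and comp_add_right: "f \<in> Hom M X Y \<Longrightarrow> g \<in> Hom M X Y \<Longrightarrow> h \<in> Hom M Y Z
      \<Longrightarrow> h \<cdot> (f \<oplus> g) = (h \<cdot> f) \<oplus> (h \<cdot> g)"

context
  fixes M :: "('o, 'a, 'm) preadditive_cat_scheme" (structure)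
begin

definition is_kernel :: "'a \<Rightarrow> 'a \<Rightarrow> bool" where
  "is_kernel k f \<longleftrightarrow> f \<in> Arr M \<and> is_equalizer M k f (Zero M (Dom M f) (Cod M f))"

definition is_cokernel :: "'a \<Rightarrow> 'a \<Rightarrow> bool" where
  "is_cokernel q f \<longleftrightarrow> f \<in> Arr M \<and> q \<in> Hom M (Cod M f) (Cod M q)
     \<and> q \<cdot> f = Zero M (Dom M f) (Cod M q)
     \<and> (\<forall>X. \<forall>h \<in> Hom M (Cod M f) X. h \<cdot> f = Zero M (Dom M f) X \<longrightarrow>
          (\<exists>!k. k \<in> Hom M (Cod M q) X \<and> k \<cdot> q = h))"

definition has_biproduct :: "'o \<Rightarrow> 'o \<Rightarrow> bool" where
  "has_biproduct X Y \<longleftrightarrow> (\<exists>P \<in> Obj M. \<exists>i1 \<in> Hom M X P. \<exists>i2 \<in> Hom M Y P.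
     \<exists>p1 \<in> Hom M P X. \<exists>p2 \<in> Hom M P Y.
       p1 \<cdot> i1 = \<langle>X\<rangle> \<and> p2 \<cdot> i2 = \<langle>Y\<rangle> \<and> p1 \<cdot> i2 = Zero M Y X \<and> p2 \<cdot> i1 = Zero M X Y
       \<and> (i1 \<cdot> p1) \<oplus> (i2 \<cdot> p2) = \<langle>P\<rangle>)"

text \<open>
  The next three notions are for the arrow map \<open>F\<close> of an endofunctor.  Exactness of
  \<open>0 \<rightarrow> X \<rightarrow> Y \<rightarrow> Z\<close> means that the first arrow is a kernel of the second one, and dually for
  \<open>X \<rightarrow> Y \<rightarrow> Z \<rightarrow> 0\<close>.
\<close>

definition additive_functor :: "('a \<Rightarrow> 'a) \<Rightarrow> bool" where
  "additive_functor F \<longleftrightarrow>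
     (\<forall>X Y. \<forall>f \<in> Hom M X Y. \<forall>g \<in> Hom M X Y. F (f \<oplus> g) = F f \<oplus> F g)"

definition left_exact_functor :: "('a \<Rightarrow> 'a) \<Rightarrow> bool" where
  "left_exact_functor F \<longleftrightarrow> (\<forall>k f. is_kernel k f \<longrightarrow> is_kernel (F k) (F f))"

definition right_exact_functor :: "('a \<Rightarrow> 'a) \<Rightarrow> bool" where
  "right_exact_functor F \<longleftrightarrow> (\<forall>q f. is_cokernel q f \<longrightarrow> is_cokernel (F q) (F f))"

end

locale abelian_category = preadditive_category M
  for M :: "('o, 'a, 'm) preadditive_cat_scheme" (structure) +
  assumes ex_zero_object: "\<exists>Z. zero_object M Z"
    and ex_biproduct: "X \<in> Obj M \<Longrightarrow> Y \<in> Obj M \<Longrightarrow> has_biproduct M X Y"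
    and ex_kernel: "f \<in> Arr M \<Longrightarrow> \<exists>k. is_kernel M k f"
    and ex_cokernel: "f \<in> Arr M \<Longrightarrow> \<exists>q. is_cokernel M q f"
    and mono_is_kernel: "monomorphism M k \<Longrightarrow> \<exists>f. is_kernel M k f"
    and epi_is_cokernel: "epimorphism M q \<Longrightarrow> \<exists>f. is_cokernel M q f"


section \<open>Braided monoidal categories\<close>

text \<open>
  \<open>\<boxtimes>\<close> is the tensor product of objects, \<open>\<otimes>\<close> that of arrows.  The constraints are directed as
  \<open>Assoc X Y Z : (X \<boxtimes> Y) \<boxtimes> Z \<rightarrow> X \<boxtimes> (Y \<boxtimes> Z)\<close>, \<open>Lunit X : \<I> \<boxtimes> X \<rightarrow> X\<close>, \<open>Runit X : X \<boxtimes> \<I> \<rightarrow> X\<close>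
  and \<open>Braid X Y : X \<boxtimes> Y \<rightarrow> Y \<boxtimes> X\<close>.
\<close>

record ('o, 'a) braided_cat = "('o, 'a) preadditive_cat" +
  TensorObj :: "'o \<Rightarrow> 'o \<Rightarrow> 'o"  (infixl \<open>\<boxtimes>\<index>\<close> 70)
  TensorArr :: "'a \<Rightarrow> 'a \<Rightarrow> 'a"  (infixl \<open>\<otimes>\<index>\<close> 70)
  UnitObj :: 'o  (\<open>\<I>\<index>\<close>)
  Assoc :: "'o \<Rightarrow> 'o \<Rightarrow> 'o \<Rightarrow> 'a"
  Lunit :: "'o \<Rightarrow> 'a"
  Runit :: "'o \<Rightarrow> 'a"
  Braid :: "'o \<Rightarrow> 'o \<Rightarrow> 'a"

definition AssocInv :: "('o, 'a, 'm) braided_cat_scheme \<Rightarrow> 'o \<Rightarrow> 'o \<Rightarrow> 'o \<Rightarrow> 'a" where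
  "AssocInv M X Y Z = inverse_arrow M (Assoc M X Y Z)"

locale monoidal_category = category M
  for M :: "('o, 'a, 'm) braided_cat_scheme" (structure) +
  assumes tensor_obj: "X \<in> Obj M \<Longrightarrow> Y \<in> Obj M \<Longrightarrow> X \<boxtimes> Y \<in> Obj M"
    and unit_obj: "\<I> \<in> Obj M"
    and tensor_arr: "f \<in> Hom M X X' \<Longrightarrow> g \<in> Hom M Y Y' \<Longrightarrow> f \<otimes> g \<in> Hom M (X \<boxtimes> Y) (X' \<boxtimes> Y')"
    and tensor_ident: "X \<in> Obj M \<Longrightarrow> Y \<in> Obj M \<Longrightarrow> \<langle>X\<rangle> \<otimes> \<langle>Y\<rangle> = \<langle>X \<boxtimes> Y\<rangle>"
    and tensor_comp: "f \<in> Hom M X X' \<Longrightarrow> f' \<in> Hom M X' X'' \<Longrightarrow> g \<in> Hom M Y Y' \<Longrightarrow> g' \<in> Hom M Y' Y''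
      \<Longrightarrow> (f' \<cdot> f) \<otimes> (g' \<cdot> g) = (f' \<otimes> g') \<cdot> (f \<otimes> g)"
    and assoc_in_Hom: "X \<in> Obj M \<Longrightarrow> Y \<in> Obj M \<Longrightarrow> Z \<in> Obj M
      \<Longrightarrow> Assoc M X Y Z \<in> Hom M ((X \<boxtimes> Y) \<boxtimes> Z) (X \<boxtimes> (Y \<boxtimes> Z))"
    and assoc_iso: "X \<in> Obj M \<Longrightarrow> Y \<in> Obj M \<Longrightarrow> Z \<in> Obj M \<Longrightarrow> isomorphism M (Assoc M X Y Z)"
    and assoc_natural: "f \<in> Hom M X X' \<Longrightarrow> g \<in> Hom M Y Y' \<Longrightarrow> h \<in> Hom M Z Z'
      \<Longrightarrow> Assoc M X' Y' Z' \<cdot> ((f \<otimes> g) \<otimes> h) = (f \<otimes> (g \<otimes> h)) \<cdot> Assoc M X Y Z"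
    and lunit_in_Hom: "X \<in> Obj M \<Longrightarrow> Lunit M X \<in> Hom M (\<I> \<boxtimes> X) X"
    and lunit_iso: "X \<in> Obj M \<Longrightarrow> isomorphism M (Lunit M X)"
    and lunit_natural: "f \<in> Hom M X Y \<Longrightarrow> Lunit M Y \<cdot> (\<langle>\<I>\<rangle> \<otimes> f) = f \<cdot> Lunit M X"
    and runit_in_Hom: "X \<in> Obj M \<Longrightarrow> Runit M X \<in> Hom M (X \<boxtimes> \<I>) X"
    and runit_iso: "X \<in> Obj M \<Longrightarrow> isomorphism M (Runit M X)"
    and runit_natural: "f \<in> Hom M X Y \<Longrightarrow> Runit M Y \<cdot> (f \<otimes> \<langle>\<I>\<rangle>) = f \<cdot> Runit M X"
    and pentagon: "W \<in> Obj M \<Longrightarrow> X \<in> Obj M \<Longrightarrow> Y \<in> Obj M \<Longrightarrow> Z \<in> Obj M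
      \<Longrightarrow> Assoc M W X (Y \<boxtimes> Z) \<cdot> Assoc M (W \<boxtimes> X) Y Z
        = (\<langle>W\<rangle> \<otimes> Assoc M X Y Z) \<cdot> Assoc M W (X \<boxtimes> Y) Z \<cdot> (Assoc M W X Y \<otimes> \<langle>Z\<rangle>)"
    and triangle: "X \<in> Obj M \<Longrightarrow> Y \<in> Obj M
      \<Longrightarrow> (\<langle>X\<rangle> \<otimes> Lunit M Y) \<cdot> Assoc M X \<I> Y = Runit M X \<otimes> \<langle>Y\<rangle>"

locale braided_monoidal_category = monoidal_category M
  for M :: "('o, 'a, 'm) braided_cat_scheme" (structure) +
  assumes braid_in_Hom: "X \<in> Obj M \<Longrightarrow> Y \<in> Obj M \<Longrightarrow> Braid M X Y \<in> Hom M (X \<boxtimes> Y) (Y \<boxtimes> X)"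
    and braid_iso: "X \<in> Obj M \<Longrightarrow> Y \<in> Obj M \<Longrightarrow> isomorphism M (Braid M X Y)"
    and braid_natural: "f \<in> Hom M X X' \<Longrightarrow> g \<in> Hom M Y Y'
      \<Longrightarrow> Braid M X' Y' \<cdot> (f \<otimes> g) = (g \<otimes> f) \<cdot> Braid M X Y"
    and hexagon1: "X \<in> Obj M \<Longrightarrow> Y \<in> Obj M \<Longrightarrow> Z \<in> Obj M
      \<Longrightarrow> Braid M (X \<boxtimes> Y) Z = Assoc M Z X Y \<cdot> (Braid M X Z \<otimes> \<langle>Y\<rangle>) \<cdot> AssocInv M X Z Y
            \<cdot> (\<langle>X\<rangle> \<otimes> Braid M Y Z) \<cdot> Assoc M X Y Z"
    and hexagon2: "X \<in> Obj M \<Longrightarrow> Y \<in> Obj M \<Longrightarrow> Z \<in> Obj M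
      \<Longrightarrow> Braid M X (Y \<boxtimes> Z) = AssocInv M Y Z X \<cdot> (\<langle>Y\<rangle> \<otimes> Braid M X Z) \<cdot> Assoc M Y X Z
            \<cdot> (Braid M X Y \<otimes> \<langle>Z\<rangle>) \<cdot> AssocInv M X Y Z"

locale abelian_coabelian_braided_monoidal_category =
  abelian_category M + braided_monoidal_category M
  for M :: "('o, 'a, 'm) braided_cat_scheme" (structure) +
  assumes tensor_left_additive: "X \<in> Obj M \<Longrightarrow> additive_functor M (\<lambda>f. \<langle>X\<rangle> \<otimes> f)"
    and tensor_right_additive: "X \<in> Obj M \<Longrightarrow> additive_functor M (\<lambda>f. f \<otimes> \<langle>X\<rangle>)"
    and tensor_left_right_exact: "X \<in> Obj M \<Longrightarrow> right_exact_functor M (\<lambda>f. \<langle>X\<rangle> \<otimes> f)"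
    and tensor_right_right_exact: "X \<in> Obj M \<Longrightarrow> right_exact_functor M (\<lambda>f. f \<otimes> \<langle>X\<rangle>)"
    and tensor_left_left_exact: "X \<in> Obj M \<Longrightarrow> left_exact_functor M (\<lambda>f. \<langle>X\<rangle> \<otimes> f)"
    and tensor_right_left_exact: "X \<in> Obj M \<Longrightarrow> left_exact_functor M (\<lambda>f. f \<otimes> \<langle>X\<rangle>)"


section \<open>Bialgebras\<close>

record ('o, 'a) coalg =
  Car :: 'o
  Comul :: 'a
  Counit :: 'a

record ('o, 'a) bialg = "('o, 'a) coalg" +
  Mul :: 'a
  Unit :: 'a

context
  fixes M :: "('o, 'a, 'm) braided_cat_scheme" (structure)
begin

definition unit_mul :: "'a" where
  "unit_mul = Lunit M \<I>"

definition unit_comul :: "'a" where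
  "unit_comul = inverse_arrow M unit_mul"

text \<open>\<open>regroup X Y Z W : (X \<boxtimes> Y) \<boxtimes> (Z \<boxtimes> W) \<rightarrow> X \<boxtimes> ((Y \<boxtimes> Z) \<boxtimes> W)\<close>, with inverse \<open>ungroup X Y Z W\<close>.\<close>

definition regroup :: "'o \<Rightarrow> 'o \<Rightarrow> 'o \<Rightarrow> 'o \<Rightarrow> 'a" where
  "regroup X Y Z W = (\<langle>X\<rangle> \<otimes> AssocInv M Y Z W) \<cdot> Assoc M X Y (Z \<boxtimes> W)"

definition ungroup :: "'o \<Rightarrow> 'o \<Rightarrow> 'o \<Rightarrow> 'o \<Rightarrow> 'a" where
  "ungroup X Y Z W = AssocInv M X Y (Z \<boxtimes> W) \<cdot> (\<langle>X\<rangle> \<otimes> Assoc M Y Z W)"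

text \<open>\<open>X \<otimes> c\<^bsub>Y,Z\<^esub> \<otimes> W\<close> as an arrow \<open>(X \<boxtimes> Y) \<boxtimes> (Z \<boxtimes> W) \<rightarrow> (X \<boxtimes> Z) \<boxtimes> (Y \<boxtimes> W)\<close>.\<close>

definition mid_braid :: "'o \<Rightarrow> 'o \<Rightarrow> 'o \<Rightarrow> 'o \<Rightarrow> 'a" where
  "mid_braid X Y Z W = ungroup X Z Y W \<cdot> (\<langle>X\<rangle> \<otimes> (Braid M Y Z \<otimes> \<langle>W\<rangle>)) \<cdot> regroup X Y Z W"

definition algebra :: "('o, 'a, 'b) bialg_scheme \<Rightarrow> bool" where
  "algebra H \<longleftrightarrow> Car H \<in> Obj M
     \<and> Mul H \<in> Hom M (Car H \<boxtimes> Car H) (Car H) \<and> Unit H \<in> Hom M \<I> (Car H)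
     \<and> Mul H \<cdot> (Mul H \<otimes> \<langle>Car H\<rangle>) = Mul H \<cdot> (\<langle>Car H\<rangle> \<otimes> Mul H) \<cdot> Assoc M (Car H) (Car H) (Car H)
     \<and> Mul H \<cdot> (Unit H \<otimes> \<langle>Car H\<rangle>) = Lunit M (Car H)
     \<and> Mul H \<cdot> (\<langle>Car H\<rangle> \<otimes> Unit H) = Runit M (Car H)"

definition coalgebra :: "('o, 'a, 'b) coalg_scheme \<Rightarrow> bool" where
  "coalgebra C \<longleftrightarrow> Car C \<in> Obj M
     \<and> Comul C \<in> Hom M (Car C) (Car C \<boxtimes> Car C) \<and> Counit C \<in> Hom M (Car C) \<I>
     \<and> Assoc M (Car C) (Car C) (Car C) \<cdot> (Comul C \<otimes> \<langle>Car C\<rangle>) \<cdot> Comul C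
         = (\<langle>Car C\<rangle> \<otimes> Comul C) \<cdot> Comul C
     \<and> Lunit M (Car C) \<cdot> (Counit C \<otimes> \<langle>Car C\<rangle>) \<cdot> Comul C = \<langle>Car C\<rangle>
     \<and> Runit M (Car C) \<cdot> (\<langle>Car C\<rangle> \<otimes> Counit C) \<cdot> Comul C = \<langle>Car C\<rangle>"

definition algebra_hom :: "('o, 'a, 'b) bialg_scheme \<Rightarrow> ('o, 'a, 'c) bialg_scheme \<Rightarrow> 'a \<Rightarrow> bool" where
  "algebra_hom H K f \<longleftrightarrow> f \<in> Hom M (Car H) (Car K)
     \<and> f \<cdot> Mul H = Mul K \<cdot> (f \<otimes> f) \<and> f \<cdot> Unit H = Unit K"

definition coalgebra_hom :: "('o, 'a, 'b) coalg_scheme \<Rightarrow> ('o, 'a, 'c) coalg_scheme \<Rightarrow> 'a \<Rightarrow> bool" where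
  "coalgebra_hom C D f \<longleftrightarrow> f \<in> Hom M (Car C) (Car D)
     \<and> Comul D \<cdot> f = (f \<otimes> f) \<cdot> Comul C \<and> Counit D \<cdot> f = Counit C"

definition tensor_coalg ::
    "('o, 'a, 'b) coalg_scheme \<Rightarrow> ('o, 'a, 'c) coalg_scheme \<Rightarrow> ('o, 'a) coalg" where
  "tensor_coalg C D = \<lparr>Car = Car C \<boxtimes> Car D,
     Comul = mid_braid (Car C) (Car C) (Car D) (Car D) \<cdot> (Comul C \<otimes> Comul D),
     Counit = unit_mul \<cdot> (Counit C \<otimes> Counit D)\<rparr>"

definition bialgebra :: "('o, 'a, 'b) bialg_scheme \<Rightarrow> bool" where
  "bialgebra H \<longleftrightarrow> algebra H \<and> coalgebra H
     \<and> Comul H \<cdot> Mul H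
         = (Mul H \<otimes> Mul H) \<cdot> mid_braid (Car H) (Car H) (Car H) (Car H) \<cdot> (Comul H \<otimes> Comul H)
     \<and> Counit H \<cdot> Mul H = unit_mul \<cdot> (Counit H \<otimes> Counit H)
     \<and> Comul H \<cdot> Unit H = (Unit H \<otimes> Unit H) \<cdot> unit_comul
     \<and> Counit H \<cdot> Unit H = \<langle>\<I>\<rangle>"

definition bialgebra_hom :: "('o, 'a, 'b) bialg_scheme \<Rightarrow> ('o, 'a, 'c) bialg_scheme \<Rightarrow> 'a \<Rightarrow> bool" where
  "bialgebra_hom H K f \<longleftrightarrow> algebra_hom H K f \<and> coalgebra_hom H K f"

definition isomorphic_bialgebras ::
    "('o, 'a, 'b) bialg_scheme \<Rightarrow> ('o, 'a, 'c) bialg_scheme \<Rightarrow> bool" where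
  "isomorphic_bialgebras H K \<longleftrightarrow> bialgebra H \<and> bialgebra K
     \<and> (\<exists>f. bialgebra_hom H K f \<and> isomorphism M f)"

definition antipode :: "('o, 'a, 'b) bialg_scheme \<Rightarrow> 'a \<Rightarrow> bool" where
  "antipode H S \<longleftrightarrow> S \<in> Hom M (Car H) (Car H)
     \<and> Mul H \<cdot> (S \<otimes> \<langle>Car H\<rangle>) \<cdot> Comul H = Unit H \<cdot> Counit H
     \<and> Mul H \<cdot> (\<langle>Car H\<rangle> \<otimes> S) \<cdot> Comul H = Unit H \<cdot> Counit H"

definition cocommutative :: "('o, 'a, 'b) coalg_scheme \<Rightarrow> bool" where
  "cocommutative C \<longleftrightarrow> Braid M (Car C) (Car C) \<cdot> Comul C = Comul C"

definition right_weak_projection ::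
    "('o, 'a, 'b) bialg_scheme \<Rightarrow> ('o, 'a, 'c) bialg_scheme \<Rightarrow> 'a \<Rightarrow> 'a \<Rightarrow> bool" where
  "right_weak_projection A B \<sigma> \<pi> \<longleftrightarrow> coalgebra_hom A B \<pi>
     \<and> \<pi> \<cdot> Mul A \<cdot> (\<langle>Car A\<rangle> \<otimes> \<sigma>) = Mul B \<cdot> (\<pi> \<otimes> \<langle>Car B\<rangle>)
     \<and> \<pi> \<cdot> \<sigma> = \<langle>Car B\<rangle>"


section \<open>Matched pairs and double cross products\<close>

definition left_module_coalgebra ::
    "('o, 'a, 'b) bialg_scheme \<Rightarrow> ('o, 'a, 'c) coalg_scheme \<Rightarrow> 'a \<Rightarrow> bool" where
  "left_module_coalgebra H C act \<longleftrightarrow> coalgebra C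
     \<and> act \<in> Hom M (Car H \<boxtimes> Car C) (Car C)
     \<and> act \<cdot> (Mul H \<otimes> \<langle>Car C\<rangle>) = act \<cdot> (\<langle>Car H\<rangle> \<otimes> act) \<cdot> Assoc M (Car H) (Car H) (Car C)
     \<and> act \<cdot> (Unit H \<otimes> \<langle>Car C\<rangle>) = Lunit M (Car C)
     \<and> coalgebra_hom (tensor_coalg H C) C act"

definition right_module_coalgebra ::
    "('o, 'a, 'b) bialg_scheme \<Rightarrow> ('o, 'a, 'c) coalg_scheme \<Rightarrow> 'a \<Rightarrow> bool" where
  "right_module_coalgebra H C act \<longleftrightarrow> coalgebra C
     \<and> act \<in> Hom M (Car C \<boxtimes> Car H) (Car C)
     \<and> act \<cdot> (act \<otimes> \<langle>Car H\<rangle>) = act \<cdot> (\<langle>Car C\<rangle> \<otimes> Mul H) \<cdot> Assoc M (Car C) (Car H) (Car H)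
     \<and> act \<cdot> (\<langle>Car C\<rangle> \<otimes> Unit H) = Runit M (Car C)
     \<and> coalgebra_hom (tensor_coalg C H) C act"

text \<open>\<open>la\<close> and \<open>ra\<close> are the arrows \<open>\<vartriangleright> : B \<otimes> R \<rightarrow> R\<close> and \<open>\<vartriangleleft> : B \<otimes> R \<rightarrow> B\<close>.\<close>

definition matched_pair ::
    "('o, 'a, 'b) bialg_scheme \<Rightarrow> ('o, 'a, 'c) bialg_scheme \<Rightarrow> 'a \<Rightarrow> 'a \<Rightarrow> bool" where
  "matched_pair R B la ra \<longleftrightarrow> bialgebra R \<and> bialgebra B
     \<and> left_module_coalgebra B R la
     \<and> right_module_coalgebra R B ra
     \<and> ra \<cdot> (Unit B \<otimes> \<langle>Car R\<rangle>) = Unit B \<cdot> Counit R \<cdot> Lunit M (Car R)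
     \<and> la \<cdot> (\<langle>Car B\<rangle> \<otimes> Unit R) = Unit R \<cdot> Counit B \<cdot> Runit M (Car B)
     \<and> Mul B \<cdot> (ra \<otimes> \<langle>Car B\<rangle>) \<cdot> AssocInv M (Car B) (Car R) (Car B)
           \<cdot> (\<langle>Car B\<rangle> \<otimes> (la \<otimes> ra)) \<cdot> (\<langle>Car B\<rangle> \<otimes> Comul (tensor_coalg B R))
           \<cdot> Assoc M (Car B) (Car B) (Car R)
         = ra \<cdot> (Mul B \<otimes> \<langle>Car R\<rangle>)
     \<and> Mul R \<cdot> (\<langle>Car R\<rangle> \<otimes> la) \<cdot> Assoc M (Car R) (Car B) (Car R)
           \<cdot> ((la \<otimes> ra) \<otimes> \<langle>Car R\<rangle>) \<cdot> (Comul (tensor_coalg B R) \<otimes> \<langle>Car R\<rangle>)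
         = la \<cdot> (\<langle>Car B\<rangle> \<otimes> Mul R) \<cdot> Assoc M (Car B) (Car R) (Car R)
     \<and> (ra \<otimes> la) \<cdot> Comul (tensor_coalg B R)
         = Braid M (Car R) (Car B) \<cdot> (la \<otimes> ra) \<cdot> Comul (tensor_coalg B R)"

text \<open>
  In the multiplication the factors \<open>R \<otimes> B \<otimes> c \<otimes> R \<otimes> B\<close> and \<open>R \<otimes> \<Delta> \<otimes> \<Delta> \<otimes> B\<close> are combined into
  \<open>R \<otimes> \<Delta>\<^bsub>B \<otimes> R\<^esub> \<otimes> B\<close>.
\<close>

definition double_cross_product ::
    "('o, 'a, 'b) bialg_scheme \<Rightarrow> ('o, 'a, 'c) bialg_scheme \<Rightarrow> 'a \<Rightarrow> 'a \<Rightarrow> ('o, 'a) bialg" where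
  "double_cross_product R B la ra = \<lparr>Car = Car R \<boxtimes> Car B,
     Comul = mid_braid (Car R) (Car R) (Car B) (Car B) \<cdot> (Comul R \<otimes> Comul B),
     Counit = unit_mul \<cdot> (Counit R \<otimes> Counit B),
     Mul = (Mul R \<otimes> Mul B) \<cdot> ungroup (Car R) (Car R) (Car B) (Car B)
       \<cdot> (\<langle>Car R\<rangle> \<otimes> ((la \<otimes> ra) \<otimes> \<langle>Car B\<rangle>))
       \<cdot> (\<langle>Car R\<rangle> \<otimes> (Comul (tensor_coalg B R) \<otimes> \<langle>Car B\<rangle>))
       \<cdot> regroup (Car R) (Car B) (Car R) (Car B),
     Unit = (Unit R \<otimes> Unit B) \<cdot> unit_comul\<rparr>"

end

end

theory Submission
  imports Defs
begin

text \<open>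
  Everything rests on the arrow \<open>\<omega> = m\<^sub>A (i \<otimes> \<sigma>) : R \<otimes> B \<rightarrow> A\<close>.  It is an isomorphism of coalgebras with
  inverse \<open>(p \<otimes> \<pi>) \<Delta>\<^sub>A\<close>, and \<open>R \<Join> B\<close> is the bialgebra obtained by transporting the structure of \<open>A\<close>
  along it.  So no axiom of the double cross product has to be verified on \<open>R \<otimes> B\<close>: it is enough that
  \<open>\<omega>\<close> respects all four structure arrows and has a left inverse (\<open>bialgebra_transport\<close>).

  Cocommutativity first enters through \<open>i\<close>.  An element of \<open>R\<close> is coinvariant on the right, and hence, as \<open>A\<close> is
  cocommutative, on the left as well; therefore \<open>\<Delta>\<^sub>A i\<close> takes its values in \<open>R \<otimes> R\<close> and \<open>i\<close> is a coalgebra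
  morphism (\<open>coalgebra_hom_i\<close>).  Triviality of \<open>\<xi>\<close> says that the product of two elements of \<open>R\<close> is
  again coinvariant, so that \<open>i\<close> is multiplicative as well (\<open>algebra_hom_i\<close>), and \<open>R\<close> inherits the bialgebra
  axioms from \<open>A\<close> through the split monomorphism \<open>i\<close>.

  The matched pair axioms come from rewriting a product \<open>b r\<close> with \<open>b\<close> in \<open>B\<close> and \<open>r\<close> in \<open>R\<close>.  The arrow
  \<open>x = m\<^sub>A (\<sigma> \<otimes> i)\<close> is a coalgebra morphism, and \<open>x = \<omega> \<omega>\<inverse> x\<close> becomes
  \<open>b r = (b\<^sub>1 \<vartriangleright> r\<^sub>1) (b\<^sub>2 \<vartriangleleft> r\<^sub>2)\<close> (\<open>\<omega>_swap\<close>).  This is the formula for the multiplication of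
  \<open>R \<Join> B\<close>.  Each mixed axiom is the associativity of \<open>A\<close> read through it and projected to
  \<open>R\<close> or \<open>B\<close>, using \<open>p (a \<sigma>(b)) = p(a) \<epsilon>(b)\<close>, \<open>p (a \<cdot> i p(a')) = p (a a')\<close>,
  \<open>\<pi> (i(r) a) = \<epsilon>(r) \<pi>(a)\<close> and \<open>\<pi> (\<sigma>\<pi>(a) i(r)) = \<pi> (a i(r))\<close>.
  The axiom involving \<open>c\<^sub>R\<^sub>,\<^sub>B\<close> is \<open>c \<Delta>\<^sub>A = \<Delta>\<^sub>A\<close> composed with \<open>x\<close> and projected to \<open>B \<otimes> R\<close>.

  The braiding is only ever moved by naturality, except for the values of \<open>X \<otimes> c \<otimes> W\<close> on unit objects, which
  give the two coherence lemmas \<open>mid_braid_unit_second\<close> and \<open>mid_braid_unit_unit\<close>.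
\<close>

section \<open>Composition and inverse arrows\<close>

context category
begin

text \<open>
  Typing is handled through \<open>Dom\<close> and \<open>Cod\<close> instead of membership in hom-sets: side conditions of rewrite
  rules then contain no objects that are absent from the left-hand side, so the simplifier can discharge
  them.
\<close>

lemma Hom_iff: "f \<in> Hom M X Y \<longleftrightarrow> f \<in> Arr M \<and> Dom M f = X \<and> Cod M f = Y"
  by (auto simp: Hom_def)

lemma obj_dom [simp]: "f \<in> Arr M \<Longrightarrow> Dom M f \<in> Obj M"
  and obj_cod [simp]: "f \<in> Arr M \<Longrightarrow> Cod M f \<in> Obj M"
  by (simp_all add: dom_cod)

lemma arr_ident [simp]:
  assumes "X \<in> Obj M"
  shows "\<langle>X\<rangle> \<in> Arr M" "Dom M \<langle>X\<rangle> = X" "Cod M \<langle>X\<rangle> = X"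
  using ident_in_Hom[OF assms] by (simp_all add: Hom_iff)

lemma arr_comp [simp]:
  assumes "f \<in> Arr M" "g \<in> Arr M" "Cod M f = Dom M g"
  shows "g \<cdot> f \<in> Arr M" "Dom M (g \<cdot> f) = Dom M f" "Cod M (g \<cdot> f) = Cod M g"
  using comp_in_Hom[of f "Dom M f" "Dom M g" g "Cod M g"] assms by (simp_all add: Hom_iff)

lemma comp_ident_left [simp]: "f \<in> Arr M \<Longrightarrow> Cod M f = X \<Longrightarrow> \<langle>X\<rangle> \<cdot> f = f"
  and comp_ident_right [simp]: "f \<in> Arr M \<Longrightarrow> Dom M f = X \<Longrightarrow> f \<cdot> \<langle>X\<rangle> = f"
  using comp_ident[of f "Dom M f" "Cod M f"] by (auto simp: Hom_iff)

lemma assoc_comp [simp]: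
  assumes "f \<in> Arr M" "g \<in> Arr M" "h \<in> Arr M" "Cod M f = Dom M g" "Cod M g = Dom M h"
  shows "(h \<cdot> g) \<cdot> f = h \<cdot> (g \<cdot> f)"
  using comp_assoc[of f "Dom M f" "Dom M g" g "Dom M h" h "Cod M h"] assms by (simp add: Hom_iff)

text \<open>
  Composites are normalised to the right.  This turns an equation between two-fold composites into the rule that
  applies it in front of a further arrow; the lemmas with suffix \<open>_extend\<close> are obtained in this way.
\<close>

lemma comp_extend:
  assumes "g \<cdot> f = g' \<cdot> f'" "f \<in> Arr M" "g \<in> Arr M" "f' \<in> Arr M" "g' \<in> Arr M"
    "Cod M f = Dom M g" "Cod M f' = Dom M g'" "k \<in> Arr M" "Cod M k = Dom M f"
  shows "g \<cdot> (f \<cdot> k) = g' \<cdot> (f' \<cdot> k)"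
proof -
  have "Dom M f' = Dom M f"
    using arr_comp(2)[of f g] arr_comp(2)[of f' g'] assms by simp
  then show ?thesis
    using assoc_comp[of k f g] assoc_comp[of k f' g'] assms by simp
qed

lemma inverse_arrows_unique:
  assumes "inverse_arrows M f g" "inverse_arrows M f h"
  shows "g = h"
proof -
  have "g = g \<cdot> (f \<cdot> h)" "(g \<cdot> f) \<cdot> h = h"
    using assms by (auto simp: inverse_arrows_def Hom_iff)
  moreover have "(g \<cdot> f) \<cdot> h = g \<cdot> (f \<cdot> h)"
    using assms by (intro assoc_comp) (auto simp: inverse_arrows_def Hom_iff)
  ultimately show ?thesis by simp
qed

lemma inverse_arrowsI:
  assumes "f \<in> Arr M" "g \<in> Arr M" "Dom M g = Cod M f" "Cod M g = Dom M f"
    "g \<cdot> f = \<langle>Dom M f\<rangle>" "f \<cdot> g = \<langle>Cod M f\<rangle>"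
  shows "inverse_arrows M f g"
  using assms by (simp add: inverse_arrows_def Hom_iff)

lemma inverse_arrow_inverse:
  assumes "isomorphism M f"
  shows "inverse_arrows M f (inverse_arrow M f)"
proof -
  obtain g where "inverse_arrows M f g"
    using assms unfolding isomorphism_def by blast
  then show ?thesis
    unfolding inverse_arrow_def by (rule theI2) (auto intro: inverse_arrows_unique \<open>inverse_arrows M f g\<close>)
qed

lemma inverse_arrow [simp]:
  assumes "isomorphism M f"
  shows "f \<in> Arr M" "inverse_arrow M f \<in> Arr M"
    "Dom M (inverse_arrow M f) = Cod M f" "Cod M (inverse_arrow M f) = Dom M f"
    "inverse_arrow M f \<cdot> f = \<langle>Dom M f\<rangle>" "f \<cdot> inverse_arrow M f = \<langle>Cod M f\<rangle>"
  using inverse_arrow_inverse[OF assms] by (simp_all add: inverse_arrows_def Hom_iff)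

lemma inverse_arrow_cancel [simp]:
  assumes "isomorphism M f" "k \<in> Arr M"
  shows "Cod M k = Dom M f \<Longrightarrow> inverse_arrow M f \<cdot> (f \<cdot> k) = k"
    and "Cod M k = Cod M f \<Longrightarrow> f \<cdot> (inverse_arrow M f \<cdot> k) = k"
  using assms by (simp_all flip: assoc_comp)

lemma iso_cancel_left:
  assumes "isomorphism M f" "f \<cdot> g = f \<cdot> h" "g \<in> Arr M" "h \<in> Arr M" "Cod M g = Dom M f" "Cod M h = Dom M f"
  shows "g = h"
  using inverse_arrow_cancel(1)[OF assms(1,3,5)] inverse_arrow_cancel(1)[OF assms(1,4,6)] assms(2) by metis

lemma iso_cancel_right:
  assumes "isomorphism M f" "g \<cdot> f = h \<cdot> f" "g \<in> Arr M" "h \<in> Arr M" "Dom M g = Cod M f" "Dom M h = Cod M f"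
  shows "g = h"
proof -
  have "g = (g \<cdot> f) \<cdot> inverse_arrow M f" "h = (h \<cdot> f) \<cdot> inverse_arrow M f"
    using assms(1,3-6) by simp_all
  then show ?thesis using assms(2) by metis
qed

end

section \<open>Coherence for the unit constraints\<close>

context monoidal_category
begin

lemma obj_tensor [simp]: "X \<in> Obj M \<Longrightarrow> Y \<in> Obj M \<Longrightarrow> X \<boxtimes> Y \<in> Obj M"
  and obj_unit [simp]: "\<I> \<in> Obj M"
  by (rule tensor_obj unit_obj; assumption)+

lemma arr_tensor [simp]:
  assumes "f \<in> Arr M" "g \<in> Arr M"
  shows "f \<otimes> g \<in> Arr M" "Dom M (f \<otimes> g) = Dom M f \<boxtimes> Dom M g" "Cod M (f \<otimes> g) = Cod M f \<boxtimes> Cod M g"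
  using tensor_arr[of f "Dom M f" "Cod M f" g "Dom M g" "Cod M g"] assms by (simp_all add: Hom_iff)

lemma ident_tensor_ident [simp]: "X \<in> Obj M \<Longrightarrow> Y \<in> Obj M \<Longrightarrow> \<langle>X\<rangle> \<otimes> \<langle>Y\<rangle> = \<langle>X \<boxtimes> Y\<rangle>"
  by (rule tensor_ident)

text \<open>
  With this orientation the simplifier fuses consecutive tensor products, so that both sides of an equation become
  chains in which tensor products alternate with constraints.
\<close>

lemma interchange [simp]:
  assumes "f \<in> Arr M" "f' \<in> Arr M" "g \<in> Arr M" "g' \<in> Arr M"
    "Cod M f = Dom M f'" "Cod M g = Dom M g'"
  shows "(f' \<otimes> g') \<cdot> (f \<otimes> g) = (f' \<cdot> f) \<otimes> (g' \<cdot> g)"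
  using tensor_comp[of f "Dom M f" "Cod M f" f' "Cod M f'" g "Dom M g" "Cod M g" g' "Cod M g'"] assms
  by (simp add: Hom_iff)

lemma interchange_extend [simp]:
  assumes "f \<in> Arr M" "f' \<in> Arr M" "g \<in> Arr M" "g' \<in> Arr M"
    "Cod M f = Dom M f'" "Cod M g = Dom M g'" "k \<in> Arr M" "Cod M k = Dom M f \<boxtimes> Dom M g"
  shows "(f' \<otimes> g') \<cdot> ((f \<otimes> g) \<cdot> k) = ((f' \<cdot> f) \<otimes> (g' \<cdot> g)) \<cdot> k"
  using assoc_comp[of k "f \<otimes> g" "f' \<otimes> g'"] assms by simp

lemma iso_constraints [simp]:
  "X \<in> Obj M \<Longrightarrow> Y \<in> Obj M \<Longrightarrow> Z \<in> Obj M \<Longrightarrow> isomorphism M (Assoc M X Y Z)"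
  "X \<in> Obj M \<Longrightarrow> isomorphism M (Lunit M X)"
  "X \<in> Obj M \<Longrightarrow> isomorphism M (Runit M X)"
  by (rule assoc_iso lunit_iso runit_iso; assumption)+

lemma arr_constraints [simp]:
  assumes "X \<in> Obj M" 
  shows "Y \<in> Obj M \<Longrightarrow> Z \<in> Obj M \<Longrightarrow> Assoc M X Y Z \<in> Arr M"
    "Y \<in> Obj M \<Longrightarrow> Z \<in> Obj M \<Longrightarrow> Dom M (Assoc M X Y Z) = (X \<boxtimes> Y) \<boxtimes> Z"
    "Y \<in> Obj M \<Longrightarrow> Z \<in> Obj M \<Longrightarrow> Cod M (Assoc M X Y Z) = X \<boxtimes> (Y \<boxtimes> Z)"
    "Lunit M X \<in> Arr M" "Dom M (Lunit M X) = \<I> \<boxtimes> X" "Cod M (Lunit M X) = X"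
    "Runit M X \<in> Arr M" "Dom M (Runit M X) = X \<boxtimes> \<I>" "Cod M (Runit M X) = X"
  using assoc_in_Hom[OF assms, of Y Z] lunit_in_Hom[OF assms] runit_in_Hom[OF assms]
  by (simp_all add: Hom_iff)

lemma assoc_inv [simp]:
  assumes "X \<in> Obj M" "Y \<in> Obj M" "Z \<in> Obj M"
  shows "AssocInv M X Y Z \<in> Arr M" "Dom M (AssocInv M X Y Z) = X \<boxtimes> (Y \<boxtimes> Z)"
    "Cod M (AssocInv M X Y Z) = (X \<boxtimes> Y) \<boxtimes> Z"
    "AssocInv M X Y Z \<cdot> Assoc M X Y Z = \<langle>(X \<boxtimes> Y) \<boxtimes> Z\<rangle>"
    "Assoc M X Y Z \<cdot> AssocInv M X Y Z = \<langle>X \<boxtimes> (Y \<boxtimes> Z)\<rangle>"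
  using assms by (simp_all add: AssocInv_def)

lemma assoc_inv_cancel [simp]:
  assumes "X \<in> Obj M" "Y \<in> Obj M" "Z \<in> Obj M" "k \<in> Arr M"
  shows "Cod M k = (X \<boxtimes> Y) \<boxtimes> Z \<Longrightarrow> AssocInv M X Y Z \<cdot> (Assoc M X Y Z \<cdot> k) = k"
    "Cod M k = X \<boxtimes> (Y \<boxtimes> Z) \<Longrightarrow> Assoc M X Y Z \<cdot> (AssocInv M X Y Z \<cdot> k) = k"
  using assms by (simp_all add: AssocInv_def)

lemma assoc_nat:
  assumes "f \<in> Arr M" "g \<in> Arr M" "h \<in> Arr M" "Cod M f = X" "Cod M g = Y" "Cod M h = Z"
  shows "Assoc M X Y Z \<cdot> ((f \<otimes> g) \<otimes> h) = (f \<otimes> (g \<otimes> h)) \<cdot> Assoc M (Dom M f) (Dom M g) (Dom M h)"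
  using assoc_natural[of f "Dom M f" X g "Dom M g" Y h "Dom M h" Z] assms by (simp add: Hom_iff)

lemma assoc_nat_extend:
  assumes "f \<in> Arr M" "g \<in> Arr M" "h \<in> Arr M" "Cod M f = X" "Cod M g = Y" "Cod M h = Z"
    "k \<in> Arr M" "Cod M k = (Dom M f \<boxtimes> Dom M g) \<boxtimes> Dom M h"
  shows "Assoc M X Y Z \<cdot> (((f \<otimes> g) \<otimes> h) \<cdot> k)
    = (f \<otimes> (g \<otimes> h)) \<cdot> (Assoc M (Dom M f) (Dom M g) (Dom M h) \<cdot> k)"
  by (rule comp_extend[OF assoc_nat]) (use assms in auto)

lemma assoc_inv_nat:
  assumes "f \<in> Arr M" "g \<in> Arr M" "h \<in> Arr M" "Cod M f = X" "Cod M g = Y" "Cod M h = Z"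
  shows "AssocInv M X Y Z \<cdot> (f \<otimes> (g \<otimes> h)) = ((f \<otimes> g) \<otimes> h) \<cdot> AssocInv M (Dom M f) (Dom M g) (Dom M h)"
proof (rule iso_cancel_left[of "Assoc M X Y Z"])
  have o: "X \<in> Obj M" "Y \<in> Obj M" "Z \<in> Obj M" using assms by auto
  show "Assoc M X Y Z \<cdot> AssocInv M X Y Z \<cdot> (f \<otimes> (g \<otimes> h))
      = Assoc M X Y Z \<cdot> ((f \<otimes> g) \<otimes> h) \<cdot> AssocInv M (Dom M f) (Dom M g) (Dom M h)"
    using assms o by (simp add: assoc_nat_extend)
qed (use assms in auto)

lemma assoc_inv_nat_extend:
  assumes "f \<in> Arr M" "g \<in> Arr M" "h \<in> Arr M" "Cod M f = X" "Cod M g = Y" "Cod M h = Z"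
    "k \<in> Arr M" "Cod M k = Dom M f \<boxtimes> (Dom M g \<boxtimes> Dom M h)"
  shows "AssocInv M X Y Z \<cdot> ((f \<otimes> (g \<otimes> h)) \<cdot> k)
    = ((f \<otimes> g) \<otimes> h) \<cdot> (AssocInv M (Dom M f) (Dom M g) (Dom M h) \<cdot> k)"
  by (rule comp_extend[OF assoc_inv_nat]) (use assms in auto)

lemma lunit_nat: "f \<in> Arr M \<Longrightarrow> Lunit M (Cod M f) \<cdot> (\<langle>\<I>\<rangle> \<otimes> f) = f \<cdot> Lunit M (Dom M f)"
  and runit_nat: "f \<in> Arr M \<Longrightarrow> Runit M (Cod M f) \<cdot> (f \<otimes> \<langle>\<I>\<rangle>) = f \<cdot> Runit M (Dom M f)"
  using lunit_natural[of f "Dom M f" "Cod M f"] runit_natural[of f "Dom M f" "Cod M f"]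
  by (simp_all add: Hom_iff)

text \<open>\<open>\<I> \<otimes> -\<close> and \<open>- \<otimes> \<I>\<close> are isomorphic to the identity functor, hence faithful.\<close>

lemma unit_tensor_faithful:
  assumes "\<langle>\<I>\<rangle> \<otimes> f = \<langle>\<I>\<rangle> \<otimes> g" "f \<in> Arr M" "g \<in> Arr M" "Dom M f = Dom M g" "Cod M f = Cod M g"
  shows "f = g"
  by (rule iso_cancel_right[of "Lunit M (Dom M f)"])
    (use assms lunit_nat[of f] lunit_nat[of g] in simp_all)

lemma tensor_unit_faithful:
  assumes "f \<otimes> \<langle>\<I>\<rangle> = g \<otimes> \<langle>\<I>\<rangle>" "f \<in> Arr M" "g \<in> Arr M" "Dom M f = Dom M g" "Cod M f = Cod M g"
  shows "f = g"
  by (rule iso_cancel_right[of "Runit M (Dom M f)"])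
    (use assms runit_nat[of f] runit_nat[of g] in simp_all)

lemma iso_comp:
  assumes "isomorphism M f" "isomorphism M g" "Cod M f = Dom M g"
  shows "isomorphism M (g \<cdot> f)"
  unfolding isomorphism_def
  by (rule exI[of _ "inverse_arrow M f \<cdot> inverse_arrow M g"], rule inverse_arrowsI) (use assms in simp_all)

lemma iso_tensor_ident:
  assumes "isomorphism M f" "X \<in> Obj M"
  shows "isomorphism M (f \<otimes> \<langle>X\<rangle>)"
  unfolding isomorphism_def
  by (rule exI[of _ "inverse_arrow M f \<otimes> \<langle>X\<rangle>"], rule inverse_arrowsI) (use assms in simp_all)

text \<open>
  Kelly's coherence lemma.  As \<open>\<I> \<otimes> -\<close> is faithful, the equation may be checked after tensoring with \<open>\<I>\<close> and
  composing with associativity isomorphisms, where it follows from the pentagon for \<open>\<I>, \<I>, X, Y\<close> and two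
  triangles.
\<close>

lemma lunit_tensor:
  assumes "X \<in> Obj M" "Y \<in> Obj M"
  shows "Lunit M (X \<boxtimes> Y) \<cdot> Assoc M \<I> X Y = Lunit M X \<otimes> \<langle>Y\<rangle>"
proof (rule unit_tensor_faithful)
  let ?c = "Assoc M \<I> (\<I> \<boxtimes> X) Y \<cdot> (Assoc M \<I> \<I> X \<otimes> \<langle>Y\<rangle>)"
  show "\<langle>\<I>\<rangle> \<otimes> (Lunit M (X \<boxtimes> Y) \<cdot> Assoc M \<I> X Y) = \<langle>\<I>\<rangle> \<otimes> (Lunit M X \<otimes> \<langle>Y\<rangle>)"
  proof (rule iso_cancel_right[of ?c])
    show "isomorphism M ?c"
      using assms by (intro iso_comp iso_tensor_ident) simp_all
    have "(\<langle>\<I>\<rangle> \<otimes> (Lunit M (X \<boxtimes> Y) \<cdot> Assoc M \<I> X Y)) \<cdot> ?c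
        = (\<langle>\<I>\<rangle> \<otimes> Lunit M (X \<boxtimes> Y)) \<cdot> ((\<langle>\<I>\<rangle> \<otimes> Assoc M \<I> X Y) \<cdot> ?c)"
      using assms by simp
    also have "\<dots> = (\<langle>\<I>\<rangle> \<otimes> Lunit M (X \<boxtimes> Y)) \<cdot> (Assoc M \<I> \<I> (X \<boxtimes> Y) \<cdot> Assoc M (\<I> \<boxtimes> \<I>) X Y)"
      using assms pentagon[of \<I> \<I> X Y] by simp
    also have "\<dots> = ((\<langle>\<I>\<rangle> \<otimes> Lunit M (X \<boxtimes> Y)) \<cdot> Assoc M \<I> \<I> (X \<boxtimes> Y)) \<cdot> Assoc M (\<I> \<boxtimes> \<I>) X Y"
      using assms by simp
    also have "\<dots> = (Runit M \<I> \<otimes> (\<langle>X\<rangle> \<otimes> \<langle>Y\<rangle>)) \<cdot> Assoc M (\<I> \<boxtimes> \<I>) X Y"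
      using assms by (simp only: triangle obj_tensor obj_unit ident_tensor_ident)
    also have "\<dots> = Assoc M \<I> X Y \<cdot> ((Runit M \<I> \<otimes> \<langle>X\<rangle>) \<otimes> \<langle>Y\<rangle>)"
      using assms by (subst assoc_nat) simp_all
    also have "\<dots> = Assoc M \<I> X Y \<cdot> (((\<langle>\<I>\<rangle> \<otimes> Lunit M X) \<cdot> Assoc M \<I> \<I> X) \<otimes> \<langle>Y\<rangle>)"
      using assms by (simp only: triangle obj_tensor obj_unit)
    also have "\<dots> = Assoc M \<I> X Y \<cdot> (((\<langle>\<I>\<rangle> \<otimes> Lunit M X) \<otimes> \<langle>Y\<rangle>) \<cdot> (Assoc M \<I> \<I> X \<otimes> \<langle>Y\<rangle>))"
      using assms by simp
    also have "\<dots> = (\<langle>\<I>\<rangle> \<otimes> (Lunit M X \<otimes> \<langle>Y\<rangle>)) \<cdot> ?c"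
      using assms by (subst assoc_nat_extend) simp_all
    finally show "(\<langle>\<I>\<rangle> \<otimes> (Lunit M (X \<boxtimes> Y) \<cdot> Assoc M \<I> X Y)) \<cdot> ?c = (\<langle>\<I>\<rangle> \<otimes> (Lunit M X \<otimes> \<langle>Y\<rangle>)) \<cdot> ?c" .
  qed (use assms in simp_all)
qed (use assms in simp_all)

text \<open>
  The mirror image of the previous lemma, from the pentagon for \<open>X, Y, \<I>, \<I>\<close>.
\<close>

lemma runit_tensor:
  assumes "X \<in> Obj M" "Y \<in> Obj M"
  shows "(\<langle>X\<rangle> \<otimes> Runit M Y) \<cdot> Assoc M X Y \<I> = Runit M (X \<boxtimes> Y)"
proof (rule tensor_unit_faithful)
  show "((\<langle>X\<rangle> \<otimes> Runit M Y) \<cdot> Assoc M X Y \<I>) \<otimes> \<langle>\<I>\<rangle> = Runit M (X \<boxtimes> Y) \<otimes> \<langle>\<I>\<rangle>"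
  proof (rule iso_cancel_left[of "Assoc M X Y \<I>"])
    have "Assoc M X Y \<I> \<cdot> (((\<langle>X\<rangle> \<otimes> Runit M Y) \<cdot> Assoc M X Y \<I>) \<otimes> \<langle>\<I>\<rangle>)
        = Assoc M X Y \<I> \<cdot> (((\<langle>X\<rangle> \<otimes> Runit M Y) \<otimes> \<langle>\<I>\<rangle>) \<cdot> (Assoc M X Y \<I> \<otimes> \<langle>\<I>\<rangle>))"
      using assms by simp
    also have "\<dots> = (\<langle>X\<rangle> \<otimes> (Runit M Y \<otimes> \<langle>\<I>\<rangle>)) \<cdot> (Assoc M X (Y \<boxtimes> \<I>) \<I> \<cdot> (Assoc M X Y \<I> \<otimes> \<langle>\<I>\<rangle>))"
      using assms by (subst assoc_nat_extend) simp_all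
    also have "\<dots> = (\<langle>X\<rangle> \<otimes> ((\<langle>Y\<rangle> \<otimes> Lunit M \<I>) \<cdot> Assoc M Y \<I> \<I>))
        \<cdot> (Assoc M X (Y \<boxtimes> \<I>) \<I> \<cdot> (Assoc M X Y \<I> \<otimes> \<langle>\<I>\<rangle>))"
      using assms by (simp only: triangle obj_unit)
    also have "\<dots> = (\<langle>X\<rangle> \<otimes> (\<langle>Y\<rangle> \<otimes> Lunit M \<I>)) \<cdot> ((\<langle>X\<rangle> \<otimes> Assoc M Y \<I> \<I>)
        \<cdot> (Assoc M X (Y \<boxtimes> \<I>) \<I> \<cdot> (Assoc M X Y \<I> \<otimes> \<langle>\<I>\<rangle>)))"
      using assms by simp
    also have "\<dots> = (\<langle>X\<rangle> \<otimes> (\<langle>Y\<rangle> \<otimes> Lunit M \<I>)) \<cdot> (Assoc M X Y (\<I> \<boxtimes> \<I>) \<cdot> Assoc M (X \<boxtimes> Y) \<I> \<I>)"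
      using assms by (simp only: pentagon obj_unit)
    also have "\<dots> = Assoc M X Y \<I> \<cdot> ((\<langle>X \<boxtimes> Y\<rangle> \<otimes> Lunit M \<I>) \<cdot> Assoc M (X \<boxtimes> Y) \<I> \<I>)"
      using assms assoc_nat_extend[of "\<langle>X\<rangle>" "\<langle>Y\<rangle>" "Lunit M \<I>" X Y \<I> "Assoc M (X \<boxtimes> Y) \<I> \<I>"] by simp
    also have "\<dots> = Assoc M X Y \<I> \<cdot> (Runit M (X \<boxtimes> Y) \<otimes> \<langle>\<I>\<rangle>)"
      using assms by (simp only: triangle obj_unit obj_tensor)
    finally show "Assoc M X Y \<I> \<cdot> (((\<langle>X\<rangle> \<otimes> Runit M Y) \<cdot> Assoc M X Y \<I>) \<otimes> \<langle>\<I>\<rangle>)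
      = Assoc M X Y \<I> \<cdot> (Runit M (X \<boxtimes> Y) \<otimes> \<langle>\<I>\<rangle>)" .
  qed (use assms in simp_all)
qed (use assms in simp_all)

text \<open>
  Naturality of \<open>l\<close> along \<open>l\<^sub>\<I>\<close> gives \<open>l\<^bsub>\<I> \<otimes> \<I>\<^esub> = \<I> \<otimes> l\<^sub>\<I>\<close>; then Kelly's lemma and the triangle
  both compute the same arrow \<open>(\<I> \<otimes> \<I>) \<otimes> \<I> \<rightarrow> \<I> \<otimes> \<I>\<close>.
\<close>

lemma lunit_unit_eq_runit_unit: "Lunit M \<I> = Runit M \<I>"
proof (rule tensor_unit_faithful)
  have "Lunit M (\<I> \<boxtimes> \<I>) = \<langle>\<I>\<rangle> \<otimes> Lunit M \<I>"
    by (rule iso_cancel_left[of "Lunit M \<I>"]) (use lunit_nat[of "Lunit M \<I>"] in simp_all)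
  then show "Lunit M \<I> \<otimes> \<langle>\<I>\<rangle> = Runit M \<I> \<otimes> \<langle>\<I>\<rangle>"
    using lunit_tensor[of \<I> \<I>] triangle[of \<I> \<I>] by simp
qed simp_all

end

section \<open>The braiding and the unit object\<close>

context braided_monoidal_category
begin

lemma iso_braid [simp]: "X \<in> Obj M \<Longrightarrow> Y \<in> Obj M \<Longrightarrow> isomorphism M (Braid M X Y)"
  by (rule braid_iso)

lemma arr_braid [simp]:
  assumes "X \<in> Obj M" "Y \<in> Obj M"
  shows "Braid M X Y \<in> Arr M" "Dom M (Braid M X Y) = X \<boxtimes> Y" "Cod M (Braid M X Y) = Y \<boxtimes> X"
  using braid_in_Hom[OF assms] by (simp_all add: Hom_iff)

lemma braid_nat:
  assumes "f \<in> Arr M" "g \<in> Arr M" "Cod M f = X" "Cod M g = Y"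
  shows "Braid M X Y \<cdot> (f \<otimes> g) = (g \<otimes> f) \<cdot> Braid M (Dom M f) (Dom M g)"
  using braid_natural[of f "Dom M f" X g "Dom M g" Y] assms by (simp add: Hom_iff)

lemma braid_nat_extend:
  assumes "f \<in> Arr M" "g \<in> Arr M" "Cod M f = X" "Cod M g = Y"
    "k \<in> Arr M" "Cod M k = Dom M f \<boxtimes> Dom M g"
  shows "Braid M X Y \<cdot> ((f \<otimes> g) \<cdot> k) = (g \<otimes> f) \<cdot> (Braid M (Dom M f) (Dom M g) \<cdot> k)"
  by (rule comp_extend[OF braid_nat]) (use assms in auto)

text \<open>
  The first hexagon with two unit objects: naturality of the braiding along \<open>r\<^sub>\<I>\<close> expresses
  \<open>c\<^bsub>\<I> \<otimes> \<I>,Z\<^esub>\<close> through \<open>c\<^bsub>\<I>,Z\<^esub>\<close>, and one factor \<open>c\<^bsub>\<I>,Z\<^esub>\<close> cancels.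
\<close>

lemma runit_braid:
  assumes Z: "Z \<in> Obj M"
  shows "Runit M Z \<cdot> Braid M \<I> Z = Lunit M Z"
proof (rule unit_tensor_faithful)
  let ?c = "Braid M \<I> Z"
  have "?c \<cdot> ((\<langle>\<I>\<rangle> \<otimes> Lunit M Z) \<cdot> Assoc M \<I> \<I> Z) = ?c \<cdot> (Runit M \<I> \<otimes> \<langle>Z\<rangle>)"
    using Z by (simp only: triangle obj_unit)
  also have "\<dots> = (\<langle>Z\<rangle> \<otimes> Runit M \<I>) \<cdot> Braid M (\<I> \<boxtimes> \<I>) Z"
    using Z by (subst braid_nat) simp_all
  also have "\<dots> = ((\<langle>Z\<rangle> \<otimes> Runit M \<I>) \<cdot> Assoc M Z \<I> \<I>) \<cdot> ((?c \<otimes> \<langle>\<I>\<rangle>) \<cdot> AssocInv M \<I> Z \<I>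
      \<cdot> (\<langle>\<I>\<rangle> \<otimes> ?c) \<cdot> Assoc M \<I> \<I> Z)"
    using Z by (simp add: hexagon1)
  also have "\<dots> = (Runit M (Z \<boxtimes> \<I>) \<cdot> (?c \<otimes> \<langle>\<I>\<rangle>)) \<cdot> AssocInv M \<I> Z \<I>
      \<cdot> (\<langle>\<I>\<rangle> \<otimes> ?c) \<cdot> Assoc M \<I> \<I> Z"
    using Z by (simp add: runit_tensor)
  also have "\<dots> = (?c \<cdot> (\<langle>\<I>\<rangle> \<otimes> Runit M Z) \<cdot> Assoc M \<I> Z \<I>) \<cdot> AssocInv M \<I> Z \<I>
      \<cdot> (\<langle>\<I>\<rangle> \<otimes> ?c) \<cdot> Assoc M \<I> \<I> Z"
    using Z runit_nat[of ?c] by (simp only: runit_tensor arr_braid obj_unit)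
  also have "\<dots> = ?c \<cdot> ((\<langle>\<I>\<rangle> \<otimes> (Runit M Z \<cdot> ?c)) \<cdot> Assoc M \<I> \<I> Z)"
    using Z by simp
  finally have "?c \<cdot> ((\<langle>\<I>\<rangle> \<otimes> Lunit M Z) \<cdot> Assoc M \<I> \<I> Z)
      = ?c \<cdot> ((\<langle>\<I>\<rangle> \<otimes> (Runit M Z \<cdot> ?c)) \<cdot> Assoc M \<I> \<I> Z)" .
  from iso_cancel_left[OF _ this]
  have "(\<langle>\<I>\<rangle> \<otimes> Lunit M Z) \<cdot> Assoc M \<I> \<I> Z = (\<langle>\<I>\<rangle> \<otimes> (Runit M Z \<cdot> ?c)) \<cdot> Assoc M \<I> \<I> Z"
    using Z by simp
  from iso_cancel_right[OF _ this]
  show "\<langle>\<I>\<rangle> \<otimes> (Runit M Z \<cdot> ?c) = \<langle>\<I>\<rangle> \<otimes> Lunit M Z"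
    using Z by simp
qed (use Z in simp_all)

text \<open>
  The same argument for the second hexagon, with naturality along \<open>l\<^sub>\<I>\<close>.
\<close>

lemma lunit_braid:
  assumes X: "X \<in> Obj M"
  shows "Lunit M X \<cdot> Braid M X \<I> = Runit M X"
proof (rule tensor_unit_faithful)
  let ?c = "Braid M X \<I>"
  have "?c \<cdot> (Runit M X \<otimes> \<langle>\<I>\<rangle>) = (?c \<cdot> (\<langle>X\<rangle> \<otimes> Lunit M \<I>)) \<cdot> Assoc M X \<I> \<I>"
    using X triangle[of X \<I>] by simp
  also have "\<dots> = (Lunit M \<I> \<otimes> \<langle>X\<rangle>) \<cdot> Braid M X (\<I> \<boxtimes> \<I>) \<cdot> Assoc M X \<I> \<I>"
    using X by (subst braid_nat) simp_all
  also have "\<dots> = (Lunit M (\<I> \<boxtimes> X) \<cdot> Assoc M \<I> \<I> X) \<cdot> AssocInv M \<I> \<I> X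
      \<cdot> (\<langle>\<I>\<rangle> \<otimes> ?c) \<cdot> Assoc M \<I> X \<I> \<cdot> (?c \<otimes> \<langle>\<I>\<rangle>)"
    using X by (simp add: hexagon2 lunit_tensor)
  also have "\<dots> = (Lunit M (\<I> \<boxtimes> X) \<cdot> (\<langle>\<I>\<rangle> \<otimes> ?c)) \<cdot> Assoc M \<I> X \<I> \<cdot> (?c \<otimes> \<langle>\<I>\<rangle>)"
    using X by simp
  also have "\<dots> = (?c \<cdot> Lunit M (X \<boxtimes> \<I>)) \<cdot> Assoc M \<I> X \<I> \<cdot> (?c \<otimes> \<langle>\<I>\<rangle>)"
    using X lunit_nat[of ?c] by (simp only: arr_braid obj_unit)
  also have "\<dots> = ?c \<cdot> (Lunit M (X \<boxtimes> \<I>) \<cdot> Assoc M \<I> X \<I>) \<cdot> (?c \<otimes> \<langle>\<I>\<rangle>)"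
    using X by simp
  also have "\<dots> = ?c \<cdot> ((Lunit M X \<cdot> ?c) \<otimes> \<langle>\<I>\<rangle>)"
    using X by (simp add: lunit_tensor)
  finally have "?c \<cdot> (Runit M X \<otimes> \<langle>\<I>\<rangle>) = ?c \<cdot> ((Lunit M X \<cdot> ?c) \<otimes> \<langle>\<I>\<rangle>)" .
  from iso_cancel_left[OF _ this] show "(Lunit M X \<cdot> ?c) \<otimes> \<langle>\<I>\<rangle> = Runit M X \<otimes> \<langle>\<I>\<rangle>"
    using X by simp
qed (use X in simp_all)

lemma arr_group [simp]:
  assumes "X \<in> Obj M" "Y \<in> Obj M" "Z \<in> Obj M" "W \<in> Obj M"
  shows "regroup M X Y Z W \<in> Arr M" "Dom M (regroup M X Y Z W) = (X \<boxtimes> Y) \<boxtimes> (Z \<boxtimes> W)"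
    "Cod M (regroup M X Y Z W) = X \<boxtimes> ((Y \<boxtimes> Z) \<boxtimes> W)"
    "ungroup M X Y Z W \<in> Arr M" "Cod M (ungroup M X Y Z W) = (X \<boxtimes> Y) \<boxtimes> (Z \<boxtimes> W)"
    "Dom M (ungroup M X Y Z W) = X \<boxtimes> ((Y \<boxtimes> Z) \<boxtimes> W)"
  using assms by (simp_all add: regroup_def ungroup_def)

lemma arr_mid_braid [simp]:
  assumes "X \<in> Obj M" "Y \<in> Obj M" "Z \<in> Obj M" "W \<in> Obj M"
  shows "mid_braid M X Y Z W \<in> Arr M" "Dom M (mid_braid M X Y Z W) = (X \<boxtimes> Y) \<boxtimes> (Z \<boxtimes> W)"
    "Cod M (mid_braid M X Y Z W) = (X \<boxtimes> Z) \<boxtimes> (Y \<boxtimes> W)"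
  using assms by (simp_all add: mid_braid_def)

lemma regroup_nat:
  assumes "f \<in> Arr M" "g \<in> Arr M" "h \<in> Arr M" "k \<in> Arr M"
    "Cod M f = X" "Cod M g = Y" "Cod M h = Z" "Cod M k = W"
  shows "regroup M X Y Z W \<cdot> ((f \<otimes> g) \<otimes> (h \<otimes> k))
    = (f \<otimes> ((g \<otimes> h) \<otimes> k)) \<cdot> regroup M (Dom M f) (Dom M g) (Dom M h) (Dom M k)"
proof -
  have "X \<in> Obj M" "Y \<in> Obj M" "Z \<in> Obj M" "W \<in> Obj M"
    using assms by auto
  then show ?thesis
    using assms by (simp add: regroup_def assoc_nat assoc_inv_nat)
qed

lemma ungroup_nat:
  assumes "f \<in> Arr M" "g \<in> Arr M" "h \<in> Arr M" "k \<in> Arr M"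
    "Cod M f = X" "Cod M g = Y" "Cod M h = Z" "Cod M k = W"
  shows "ungroup M X Y Z W \<cdot> (f \<otimes> ((g \<otimes> h) \<otimes> k))
    = ((f \<otimes> g) \<otimes> (h \<otimes> k)) \<cdot> ungroup M (Dom M f) (Dom M g) (Dom M h) (Dom M k)"
proof -
  have "X \<in> Obj M" "Y \<in> Obj M" "Z \<in> Obj M" "W \<in> Obj M"
    using assms by auto
  note o = this
  have "ungroup M X Y Z W \<cdot> (f \<otimes> ((g \<otimes> h) \<otimes> k)) = AssocInv M X Y (Z \<boxtimes> W) \<cdot> (f \<otimes> (g \<otimes> (h \<otimes> k)))
      \<cdot> (\<langle>Dom M f\<rangle> \<otimes> Assoc M (Dom M g) (Dom M h) (Dom M k))"
    using assms o by (simp add: ungroup_def assoc_nat)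
  also have "\<dots> = ((f \<otimes> g) \<otimes> (h \<otimes> k)) \<cdot> ungroup M (Dom M f) (Dom M g) (Dom M h) (Dom M k)"
    using assms o by (subst assoc_inv_nat_extend) (simp_all add: ungroup_def)
  finally show ?thesis .
qed

lemma mid_braid_nat:
  assumes "f \<in> Arr M" "g \<in> Arr M" "h \<in> Arr M" "k \<in> Arr M"
    "Cod M f = X" "Cod M g = Y" "Cod M h = Z" "Cod M k = W"
  shows "mid_braid M X Y Z W \<cdot> ((f \<otimes> g) \<otimes> (h \<otimes> k))
    = ((f \<otimes> h) \<otimes> (g \<otimes> k)) \<cdot> mid_braid M (Dom M f) (Dom M g) (Dom M h) (Dom M k)"
proof -
  have o [simp]: "X \<in> Obj M" "Y \<in> Obj M" "Z \<in> Obj M" "W \<in> Obj M"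
    using assms by auto
  let ?r = "regroup M (Dom M f) (Dom M g) (Dom M h) (Dom M k)"
  have "mid_braid M X Y Z W \<cdot> ((f \<otimes> g) \<otimes> (h \<otimes> k))
      = ungroup M X Z Y W \<cdot> (\<langle>X\<rangle> \<otimes> (Braid M Y Z \<otimes> \<langle>W\<rangle>)) \<cdot> (f \<otimes> ((g \<otimes> h) \<otimes> k)) \<cdot> ?r"
    using assms by (simp add: mid_braid_def regroup_nat del: interchange_extend)
  also have "\<dots> = ungroup M X Z Y W \<cdot> (f \<otimes> ((h \<otimes> g) \<otimes> k)) \<cdot>
      (\<langle>Dom M f\<rangle> \<otimes> (Braid M (Dom M g) (Dom M h) \<otimes> \<langle>Dom M k\<rangle>)) \<cdot> ?r"
    using assms by (simp add: braid_nat)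
  also have "\<dots> = (ungroup M X Z Y W \<cdot> (f \<otimes> ((h \<otimes> g) \<otimes> k))) \<cdot>
      (\<langle>Dom M f\<rangle> \<otimes> (Braid M (Dom M g) (Dom M h) \<otimes> \<langle>Dom M k\<rangle>)) \<cdot> ?r"
    using assms by simp
  also have "\<dots> = ((f \<otimes> h) \<otimes> (g \<otimes> k)) \<cdot> mid_braid M (Dom M f) (Dom M g) (Dom M h) (Dom M k)"
    using assms by (subst ungroup_nat) (simp_all add: mid_braid_def)
  finally show ?thesis .
qed

lemma mid_braid_nat_extend:
  assumes "f \<in> Arr M" "g \<in> Arr M" "h \<in> Arr M" "k \<in> Arr M"
    "Cod M f = X" "Cod M g = Y" "Cod M h = Z" "Cod M k = W"
    "l \<in> Arr M" "Cod M l = (Dom M f \<boxtimes> Dom M g) \<boxtimes> (Dom M h \<boxtimes> Dom M k)"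
  shows "mid_braid M X Y Z W \<cdot> (((f \<otimes> g) \<otimes> (h \<otimes> k)) \<cdot> l)
    = ((f \<otimes> h) \<otimes> (g \<otimes> k)) \<cdot> (mid_braid M (Dom M f) (Dom M g) (Dom M h) (Dom M k) \<cdot> l)"
  by (rule comp_extend[OF mid_braid_nat]) (use assms in auto)

text \<open>
  Up to associativity and unit constraints, \<open>X \<otimes> c\<^bsub>\<I>,Y\<^esub> \<otimes> Z\<close> is an identity.  It makes \<open>\<omega>\<close> right \<open>B\<close>-colinear below.
\<close>

lemma mid_braid_unit_second:
  assumes [simp]: "X \<in> Obj M" "Y \<in> Obj M" "Z \<in> Obj M"
  shows "(\<langle>X \<boxtimes> Y\<rangle> \<otimes> Lunit M Z) \<cdot> mid_braid M X \<I> Y Z = AssocInv M X Y Z \<cdot> (Runit M X \<otimes> \<langle>Y \<boxtimes> Z\<rangle>)"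
proof -
  have "(\<langle>X \<boxtimes> Y\<rangle> \<otimes> Lunit M Z) \<cdot> mid_braid M X \<I> Y Z
      = ((\<langle>X \<boxtimes> Y\<rangle> \<otimes> Lunit M Z) \<cdot> AssocInv M X Y (\<I> \<boxtimes> Z)) \<cdot> (\<langle>X\<rangle> \<otimes> Assoc M Y \<I> Z)
        \<cdot> (\<langle>X\<rangle> \<otimes> (Braid M \<I> Y \<otimes> \<langle>Z\<rangle>)) \<cdot> (\<langle>X\<rangle> \<otimes> AssocInv M \<I> Y Z) \<cdot> Assoc M X \<I> (Y \<boxtimes> Z)"
    by (simp add: mid_braid_def ungroup_def regroup_def del: interchange interchange_extend)
  also have "\<dots> = (AssocInv M X Y Z \<cdot> (\<langle>X\<rangle> \<otimes> (\<langle>Y\<rangle> \<otimes> Lunit M Z))) \<cdot> (\<langle>X\<rangle> \<otimes> Assoc M Y \<I> Z)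
        \<cdot> (\<langle>X\<rangle> \<otimes> (Braid M \<I> Y \<otimes> \<langle>Z\<rangle>)) \<cdot> (\<langle>X\<rangle> \<otimes> AssocInv M \<I> Y Z) \<cdot> Assoc M X \<I> (Y \<boxtimes> Z)"
    using assoc_inv_nat[of "\<langle>X\<rangle>" "\<langle>Y\<rangle>" "Lunit M Z" X Y Z] by simp
  also have "\<dots> = AssocInv M X Y Z \<cdot> (\<langle>X\<rangle> \<otimes> ((\<langle>Y\<rangle> \<otimes> Lunit M Z) \<cdot> Assoc M Y \<I> Z))
        \<cdot> (\<langle>X\<rangle> \<otimes> (Braid M \<I> Y \<otimes> \<langle>Z\<rangle>)) \<cdot> (\<langle>X\<rangle> \<otimes> AssocInv M \<I> Y Z) \<cdot> Assoc M X \<I> (Y \<boxtimes> Z)"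
    by simp
  also have "\<dots> = AssocInv M X Y Z \<cdot> (\<langle>X\<rangle> \<otimes> ((Runit M Y \<cdot> Braid M \<I> Y) \<otimes> \<langle>Z\<rangle>))
        \<cdot> (\<langle>X\<rangle> \<otimes> AssocInv M \<I> Y Z) \<cdot> Assoc M X \<I> (Y \<boxtimes> Z)"
    by (simp add: triangle)
  also have "\<dots> = AssocInv M X Y Z \<cdot> (\<langle>X\<rangle> \<otimes> Lunit M (Y \<boxtimes> Z)) \<cdot> Assoc M X \<I> (Y \<boxtimes> Z)"
    by (simp add: runit_braid flip: lunit_tensor)
  also have "\<dots> = AssocInv M X Y Z \<cdot> (Runit M X \<otimes> \<langle>Y \<boxtimes> Z\<rangle>)"
    by (simp add: triangle)
  finally show ?thesis .
qed

text \<open>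
  Up to constraints, \<open>X \<otimes> c\<^bsub>Y,\<I>\<^esub> \<otimes> \<I>\<close> is an identity.  It makes \<open>X \<otimes> \<epsilon>\<close> a coalgebra morphism, which is how
  \<open>p\<close> is seen to be one.
\<close>

lemma mid_braid_unit_unit:
  assumes [simp]: "X \<in> Obj M" "Y \<in> Obj M"
  shows "(Runit M X \<otimes> Runit M Y) \<cdot> mid_braid M X Y \<I> \<I> = Runit M (X \<boxtimes> Y) \<cdot> (\<langle>X \<boxtimes> Y\<rangle> \<otimes> Lunit M \<I>)"
proof -
  let ?G = "regroup M X Y \<I> \<I>"
  have "(Runit M X \<otimes> Runit M Y) \<cdot> mid_braid M X Y \<I> \<I>
     = (\<langle>X\<rangle> \<otimes> Runit M Y) \<cdot> ((Runit M X \<otimes> \<langle>Y \<boxtimes> \<I>\<rangle>) \<cdot> AssocInv M X \<I> (Y \<boxtimes> \<I>))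
        \<cdot> (\<langle>X\<rangle> \<otimes> Assoc M \<I> Y \<I>) \<cdot> (\<langle>X\<rangle> \<otimes> (Braid M Y \<I> \<otimes> \<langle>\<I>\<rangle>)) \<cdot> ?G"
    by (simp add: mid_braid_def ungroup_def)
  also have "(Runit M X \<otimes> \<langle>Y \<boxtimes> \<I>\<rangle>) \<cdot> AssocInv M X \<I> (Y \<boxtimes> \<I>) = \<langle>X\<rangle> \<otimes> Lunit M (Y \<boxtimes> \<I>)"
    by (simp flip: triangle)
  also have "(\<langle>X\<rangle> \<otimes> Runit M Y) \<cdot> (\<langle>X\<rangle> \<otimes> Lunit M (Y \<boxtimes> \<I>)) \<cdot> (\<langle>X\<rangle> \<otimes> Assoc M \<I> Y \<I>)
        \<cdot> (\<langle>X\<rangle> \<otimes> (Braid M Y \<I> \<otimes> \<langle>\<I>\<rangle>)) \<cdot> ?G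
     = (\<langle>X\<rangle> \<otimes> (Runit M Y \<cdot> (Lunit M (Y \<boxtimes> \<I>) \<cdot> Assoc M \<I> Y \<I>) \<cdot> (Braid M Y \<I> \<otimes> \<langle>\<I>\<rangle>))) \<cdot> ?G"
    by simp
  also have "\<dots> = (\<langle>X\<rangle> \<otimes> (Runit M Y \<cdot> ((Lunit M Y \<cdot> Braid M Y \<I>) \<otimes> \<langle>\<I>\<rangle>))) \<cdot> ?G"
    by (simp add: lunit_tensor)
  also have "\<dots> = (\<langle>X\<rangle> \<otimes> (Runit M Y \<cdot> ((Runit M Y \<otimes> \<langle>\<I>\<rangle>) \<cdot> AssocInv M Y \<I> \<I>))) \<cdot> Assoc M X Y (\<I> \<boxtimes> \<I>)"
    by (simp add: lunit_braid regroup_def)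
  also have "(Runit M Y \<otimes> \<langle>\<I>\<rangle>) \<cdot> AssocInv M Y \<I> \<I> = \<langle>Y\<rangle> \<otimes> Lunit M \<I>"
    by (simp flip: triangle)
  also have "(\<langle>X\<rangle> \<otimes> (Runit M Y \<cdot> (\<langle>Y\<rangle> \<otimes> Lunit M \<I>))) \<cdot> Assoc M X Y (\<I> \<boxtimes> \<I>)
      = (\<langle>X\<rangle> \<otimes> Runit M Y) \<cdot> ((\<langle>X\<rangle> \<otimes> (\<langle>Y\<rangle> \<otimes> Lunit M \<I>)) \<cdot> Assoc M X Y (\<I> \<boxtimes> \<I>))"
    by simp
  also have "\<dots> = ((\<langle>X\<rangle> \<otimes> Runit M Y) \<cdot> Assoc M X Y \<I>) \<cdot> (\<langle>X \<boxtimes> Y\<rangle> \<otimes> Lunit M \<I>)"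
    using assoc_nat[of "\<langle>X\<rangle>" "\<langle>Y\<rangle>" "Lunit M \<I>" X Y \<I>] by simp
  finally show ?thesis by (simp add: runit_tensor)
qed

end

context monoidal_category
begin

text \<open>
  Naturality of the unit constraints in the direction that moves them to the front of a composite.
\<close>

lemma lunit_slide:
  assumes "f \<in> Arr M" "Dom M f = X" "Cod M f = Y"
  shows "f \<cdot> Lunit M X = Lunit M Y \<cdot> (\<langle>\<I>\<rangle> \<otimes> f)"
    and "k \<in> Arr M \<Longrightarrow> Cod M k = \<I> \<boxtimes> X \<Longrightarrow> f \<cdot> (Lunit M X \<cdot> k) = Lunit M Y \<cdot> ((\<langle>\<I>\<rangle> \<otimes> f) \<cdot> k)"
proof -
  have "X \<in> Obj M" "Y \<in> Obj M" using assms by auto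
  note [simp] = this assms
  show e: "f \<cdot> Lunit M X = Lunit M Y \<cdot> (\<langle>\<I>\<rangle> \<otimes> f)"
    using lunit_nat[of f] by simp
  show "f \<cdot> (Lunit M X \<cdot> k) = Lunit M Y \<cdot> ((\<langle>\<I>\<rangle> \<otimes> f) \<cdot> k)"
    if "k \<in> Arr M" "Cod M k = \<I> \<boxtimes> X"
    by (rule comp_extend[OF e]) (simp_all add: that)
qed

lemma runit_slide:
  assumes "f \<in> Arr M" "Dom M f = X" "Cod M f = Y"
  shows "f \<cdot> Runit M X = Runit M Y \<cdot> (f \<otimes> \<langle>\<I>\<rangle>)"
    and "k \<in> Arr M \<Longrightarrow> Cod M k = X \<boxtimes> \<I> \<Longrightarrow> f \<cdot> (Runit M X \<cdot> k) = Runit M Y \<cdot> ((f \<otimes> \<langle>\<I>\<rangle>) \<cdot> k)"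
proof -
  have "X \<in> Obj M" "Y \<in> Obj M" using assms by auto
  note [simp] = this assms
  show e: "f \<cdot> Runit M X = Runit M Y \<cdot> (f \<otimes> \<langle>\<I>\<rangle>)"
    using runit_nat[of f] by simp
  show "f \<cdot> (Runit M X \<cdot> k) = Runit M Y \<cdot> ((f \<otimes> \<langle>\<I>\<rangle>) \<cdot> k)"
    if "k \<in> Arr M" "Cod M k = X \<boxtimes> \<I>"
    by (rule comp_extend[OF e]) (simp_all add: that)
qed

end

section \<open>Bialgebras and their morphisms\<close>

context braided_monoidal_category
begin

lemma unit_mul_eq: "unit_mul M = Lunit M \<I>"
  by (simp add: unit_mul_def)

lemma arr_unit_comul [simp]:
  "unit_mul M \<in> Arr M" "Dom M (unit_mul M) = \<I> \<boxtimes> \<I>" "Cod M (unit_mul M) = \<I>"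
  "unit_comul M \<in> Arr M" "Dom M (unit_comul M) = \<I>" "Cod M (unit_comul M) = \<I> \<boxtimes> \<I>"
  "unit_mul M \<cdot> unit_comul M = \<langle>\<I>\<rangle>"
  by (simp_all add: unit_mul_def unit_comul_def)

text \<open>
  Objects with structure arrows of the right types but no axioms: the axioms for \<open>R\<close> and for \<open>R \<Join> B\<close>
  are conclusions.
\<close>

definition coalgebra_type :: "('o, 'a, 'b) coalg_scheme \<Rightarrow> bool" where
  "coalgebra_type C \<longleftrightarrow> Car C \<in> Obj M
     \<and> Comul C \<in> Hom M (Car C) (Car C \<boxtimes> Car C) \<and> Counit C \<in> Hom M (Car C) \<I>"

definition algebra_type :: "('o, 'a, 'b) bialg_scheme \<Rightarrow> bool" where
  "algebra_type H \<longleftrightarrow> Car H \<in> Obj M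
     \<and> Mul H \<in> Hom M (Car H \<boxtimes> Car H) (Car H) \<and> Unit H \<in> Hom M \<I> (Car H)"

lemma coalgebra_type_arr:
  assumes "coalgebra_type C"
  shows "Car C \<in> Obj M" "Comul C \<in> Arr M" "Dom M (Comul C) = Car C" "Cod M (Comul C) = Car C \<boxtimes> Car C"
    "Counit C \<in> Arr M" "Dom M (Counit C) = Car C" "Cod M (Counit C) = \<I>"
  using assms by (auto simp: coalgebra_type_def Hom_iff)

lemma algebra_type_arr:
  assumes "algebra_type H"
  shows "Car H \<in> Obj M" "Mul H \<in> Arr M" "Dom M (Mul H) = Car H \<boxtimes> Car H" "Cod M (Mul H) = Car H"
    "Unit H \<in> Arr M" "Dom M (Unit H) = \<I>" "Cod M (Unit H) = Car H"
  using assms by (auto simp: algebra_type_def Hom_iff)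

lemma coalgebra_type: "coalgebra M C \<Longrightarrow> coalgebra_type C"
  by (simp add: coalgebra_def coalgebra_type_def)

lemma algebra_type: "algebra M H \<Longrightarrow> algebra_type H"
  by (simp add: algebra_def algebra_type_def)

lemma bialgebra_type:
  assumes "bialgebra M H"
  shows "algebra_type H" "coalgebra_type H"
  using assms by (simp_all add: bialgebra_def algebra_type coalgebra_type)

lemma tensor_coalg_type:
  assumes "coalgebra_type C" "coalgebra_type D"
  shows "coalgebra_type (tensor_coalg M C D)"
  using coalgebra_type_arr[OF assms(1)] coalgebra_type_arr[OF assms(2)]
  by (simp add: coalgebra_type_def tensor_coalg_def Hom_iff)

lemma coalgebra_homD:
  assumes "coalgebra_hom M C D f"
  shows "f \<in> Arr M" "Dom M f = Car C" "Cod M f = Car D"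
    "Comul D \<cdot> f = (f \<otimes> f) \<cdot> Comul C" "Counit D \<cdot> f = Counit C"
  using assms by (simp_all add: coalgebra_hom_def Hom_iff)

lemma algebra_homD:
  assumes "algebra_hom M H K f"
  shows "f \<in> Arr M" "Dom M f = Car H" "Cod M f = Car K"
    "f \<cdot> Mul H = Mul K \<cdot> (f \<otimes> f)" "f \<cdot> Unit H = Unit K"
  using assms by (simp_all add: algebra_hom_def Hom_iff)

lemma coalgebra_hom_comp:
  assumes "coalgebra_type C" "coalgebra_type D" "coalgebra_type E"
    and "coalgebra_hom M C D f" "coalgebra_hom M D E g"
  shows "coalgebra_hom M C E (g \<cdot> f)"
proof -
  note [simp] = coalgebra_type_arr[OF assms(1)] coalgebra_type_arr[OF assms(2)] coalgebra_type_arr[OF assms(3)]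
    coalgebra_homD(1-3)[OF assms(4)] coalgebra_homD(1-3)[OF assms(5)]
  have "Comul E \<cdot> (g \<cdot> f) = (g \<otimes> g) \<cdot> (Comul D \<cdot> f)"
    using comp_extend[OF coalgebra_homD(4)[OF assms(5)], of f] by simp
  also have "\<dots> = ((g \<cdot> f) \<otimes> (g \<cdot> f)) \<cdot> Comul C"
    using coalgebra_homD(4)[OF assms(4)] by simp
  finally have "Comul E \<cdot> (g \<cdot> f) = ((g \<cdot> f) \<otimes> (g \<cdot> f)) \<cdot> Comul C" .
  moreover have "Counit E \<cdot> (g \<cdot> f) = (Counit E \<cdot> g) \<cdot> f"
    by simp
  then have "Counit E \<cdot> (g \<cdot> f) = Counit C"
    by (simp only: coalgebra_homD(5)[OF assms(4)] coalgebra_homD(5)[OF assms(5)])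
  ultimately show ?thesis
    by (simp add: coalgebra_hom_def Hom_iff)
qed

lemma coalgebra_hom_tensor:
  assumes "coalgebra_type C" "coalgebra_type C'" "coalgebra_type D" "coalgebra_type D'"
    and "coalgebra_hom M C C' f" "coalgebra_hom M D D' g"
  shows "coalgebra_hom M (tensor_coalg M C D) (tensor_coalg M C' D') (f \<otimes> g)"
proof -
  note [simp] = coalgebra_type_arr[OF assms(1)] coalgebra_type_arr[OF assms(2)]
    coalgebra_type_arr[OF assms(3)] coalgebra_type_arr[OF assms(4)]
    coalgebra_homD[OF assms(5)] coalgebra_homD[OF assms(6)]
  have "mid_braid M (Car C') (Car C') (Car D') (Car D') \<cdot> (((f \<otimes> f) \<cdot> Comul C) \<otimes> ((g \<otimes> g) \<cdot> Comul D))
    = mid_braid M (Car C') (Car C') (Car D') (Car D') \<cdot> (((f \<otimes> f) \<otimes> (g \<otimes> g)) \<cdot> (Comul C \<otimes> Comul D))"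
    by simp
  also have "\<dots> = ((f \<otimes> g) \<otimes> (f \<otimes> g)) \<cdot> mid_braid M (Car C) (Car C) (Car D) (Car D) \<cdot> (Comul C \<otimes> Comul D)"
    by (subst mid_braid_nat_extend) simp_all
  finally show ?thesis
    by (simp add: coalgebra_hom_def tensor_coalg_def Hom_iff)
qed

lemma bialgebra_mul_coalgebra_hom:
  assumes "bialgebra M H"
  shows "coalgebra_hom M (tensor_coalg M H H) H (Mul H)"
  using assms algebra_type_arr[OF bialgebra_type(1)[OF assms]]
  by (simp add: bialgebra_def coalgebra_hom_def tensor_coalg_def Hom_iff)

lemma left_inverse_cancel:
  assumes "g \<cdot> f = \<langle>Dom M f\<rangle>" "f \<cdot> x = f \<cdot> y" "f \<in> Arr M" "g \<in> Arr M" "Dom M g = Cod M f"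
    "x \<in> Arr M" "y \<in> Arr M" "Cod M x = Dom M f" "Cod M y = Dom M f"
  shows "x = y"
proof -
  have "x = (g \<cdot> f) \<cdot> x"
    using assms(1,3-) by (simp del: assoc_comp)
  also have "\<dots> = g \<cdot> (f \<cdot> y)"
    using assms(3-) by (simp flip: assms(2))
  also have "\<dots> = (g \<cdot> f) \<cdot> y"
    using assms(3-) by simp
  also have "\<dots> = y"
    using assms(1,3-) by (simp del: assoc_comp)
  finally show ?thesis .
qed

text \<open>
  All bialgebra axioms are equations between arrows into \<open>H\<close>, \<open>H \<otimes> H\<close> or \<open>H \<otimes> (H \<otimes> H)\<close>, or into \<open>\<I>\<close>.
  The arrows \<open>f\<close>, \<open>f \<otimes> f\<close> and \<open>f \<otimes> (f \<otimes> f)\<close> have left inverses, hence can be cancelled, and after composing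
  with them an axiom for \<open>H\<close> is the one for \<open>K\<close> precomposed with a tensor power of \<open>f\<close>.  It is
  used for the split monomorphism \<open>i\<close> and for the isomorphism \<open>\<omega>\<close>.
\<close>

lemma bialgebra_transport:
  assumes K: "bialgebra M K" and H: "algebra_type H" "coalgebra_type H"
    and f: "algebra_hom M H K f" "coalgebra_hom M H K f"
    and g: "g \<in> Arr M" "Dom M g = Car K" "Cod M g = Car H" "g \<cdot> f = \<langle>Car H\<rangle>"
  shows "bialgebra M H"
proof -
  let ?H = "Car H" and ?K = "Car K"
  note t [simp] = algebra_type_arr[OF bialgebra_type(1)[OF K]] coalgebra_type_arr[OF bialgebra_type(2)[OF K]]
    algebra_type_arr[OF H(1)] coalgebra_type_arr[OF H(2)] algebra_homD(1-3)[OF f(1)] g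
  note mul = algebra_homD(4)[OF f(1)] and unit = algebra_homD(5)[OF f(1)]
    and comul = coalgebra_homD(4)[OF f(2)] and counit = coalgebra_homD(5)[OF f(2)]
  have mul_extend: "f \<cdot> (Mul H \<cdot> k) = Mul K \<cdot> ((f \<otimes> f) \<cdot> k)"
    if "k \<in> Arr M" "Cod M k = ?H \<boxtimes> ?H" for k
    by (rule comp_extend[OF mul]) (use that in simp_all)
  have comul_extend: "(f \<otimes> f) \<cdot> (Comul H \<cdot> k) = Comul K \<cdot> (f \<cdot> k)"
    if "k \<in> Arr M" "Cod M k = ?H" for k
    by (rule comp_extend[OF comul[symmetric]]) (use that in simp_all)
  have counit_extend: "Counit H \<cdot> k = Counit K \<cdot> (f \<cdot> k)" if "k \<in> Arr M" "Cod M k = ?H" for k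
    using that by (simp flip: counit)
  have cancel: "x = y" if "f \<cdot> x = f \<cdot> y" "x \<in> Arr M" "y \<in> Arr M" "Cod M x = ?H" "Cod M y = ?H" for x y
    by (rule left_inverse_cancel[OF _ that(1), of g]) (use that in simp_all)
  have cancel2: "x = y" if "(f \<otimes> f) \<cdot> x = (f \<otimes> f) \<cdot> y" "x \<in> Arr M" "y \<in> Arr M"
      "Cod M x = ?H \<boxtimes> ?H" "Cod M y = ?H \<boxtimes> ?H" for x y
    by (rule left_inverse_cancel[OF _ that(1), of "g \<otimes> g"]) (use that in simp_all)
  have cancel3: "x = y" if "(f \<otimes> (f \<otimes> f)) \<cdot> x = (f \<otimes> (f \<otimes> f)) \<cdot> y" "x \<in> Arr M" "y \<in> Arr M"
      "Cod M x = ?H \<boxtimes> (?H \<boxtimes> ?H)" "Cod M y = ?H \<boxtimes> (?H \<boxtimes> ?H)" for x y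
    by (rule left_inverse_cancel[OF _ that(1), of "g \<otimes> (g \<otimes> g)"]) (use that in simp_all)
  have K_alg: "Mul K \<cdot> (Mul K \<otimes> \<langle>?K\<rangle>) = Mul K \<cdot> (\<langle>?K\<rangle> \<otimes> Mul K) \<cdot> Assoc M ?K ?K ?K"
      "Mul K \<cdot> (Unit K \<otimes> \<langle>?K\<rangle>) = Lunit M ?K" "Mul K \<cdot> (\<langle>?K\<rangle> \<otimes> Unit K) = Runit M ?K"
    and K_coalg: "Assoc M ?K ?K ?K \<cdot> (Comul K \<otimes> \<langle>?K\<rangle>) \<cdot> Comul K = (\<langle>?K\<rangle> \<otimes> Comul K) \<cdot> Comul K"
      "Lunit M ?K \<cdot> (Counit K \<otimes> \<langle>?K\<rangle>) \<cdot> Comul K = \<langle>?K\<rangle>"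
      "Runit M ?K \<cdot> (\<langle>?K\<rangle> \<otimes> Counit K) \<cdot> Comul K = \<langle>?K\<rangle>"
    and K_bialg: "Comul K \<cdot> Mul K = (Mul K \<otimes> Mul K) \<cdot> mid_braid M ?K ?K ?K ?K \<cdot> (Comul K \<otimes> Comul K)"
      "Counit K \<cdot> Mul K = unit_mul M \<cdot> (Counit K \<otimes> Counit K)"
      "Comul K \<cdot> Unit K = (Unit K \<otimes> Unit K) \<cdot> unit_comul M" "Counit K \<cdot> Unit K = \<langle>\<I>\<rangle>"
    using K by (simp_all add: bialgebra_def algebra_def coalgebra_def)
  have "Mul H \<cdot> (Mul H \<otimes> \<langle>?H\<rangle>) = Mul H \<cdot> (\<langle>?H\<rangle> \<otimes> Mul H) \<cdot> Assoc M ?H ?H ?H"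
  proof (rule cancel)
    have "f \<cdot> Mul H \<cdot> (Mul H \<otimes> \<langle>?H\<rangle>) = (Mul K \<cdot> (Mul K \<otimes> \<langle>?K\<rangle>)) \<cdot> ((f \<otimes> f) \<otimes> f)"
      by (simp add: mul_extend mul)
    also have "\<dots> = Mul K \<cdot> (\<langle>?K\<rangle> \<otimes> Mul K) \<cdot> (f \<otimes> (f \<otimes> f)) \<cdot> Assoc M ?H ?H ?H"
      using assoc_nat[of f f f ?K ?K ?K] by (simp add: K_alg)
    also have "\<dots> = f \<cdot> Mul H \<cdot> (\<langle>?H\<rangle> \<otimes> Mul H) \<cdot> Assoc M ?H ?H ?H"
      by (simp add: mul_extend mul)
    finally show "f \<cdot> Mul H \<cdot> (Mul H \<otimes> \<langle>?H\<rangle>) = f \<cdot> Mul H \<cdot> (\<langle>?H\<rangle> \<otimes> Mul H) \<cdot> Assoc M ?H ?H ?H" .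
  qed simp_all
  moreover have "Mul H \<cdot> (Unit H \<otimes> \<langle>?H\<rangle>) = Lunit M ?H"
  proof (rule cancel)
    have "f \<cdot> Mul H \<cdot> (Unit H \<otimes> \<langle>?H\<rangle>) = (Mul K \<cdot> (Unit K \<otimes> \<langle>?K\<rangle>)) \<cdot> (\<langle>\<I>\<rangle> \<otimes> f)"
      by (simp add: mul_extend unit)
    then show "f \<cdot> Mul H \<cdot> (Unit H \<otimes> \<langle>?H\<rangle>) = f \<cdot> Lunit M ?H"
      using lunit_nat[of f] by (simp only: K_alg t)
  qed simp_all
  moreover have "Mul H \<cdot> (\<langle>?H\<rangle> \<otimes> Unit H) = Runit M ?H"
  proof (rule cancel)
    have "f \<cdot> Mul H \<cdot> (\<langle>?H\<rangle> \<otimes> Unit H) = (Mul K \<cdot> (\<langle>?K\<rangle> \<otimes> Unit K)) \<cdot> (f \<otimes> \<langle>\<I>\<rangle>)"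
      by (simp add: mul_extend unit)
    then show "f \<cdot> Mul H \<cdot> (\<langle>?H\<rangle> \<otimes> Unit H) = f \<cdot> Runit M ?H"
      using runit_nat[of f] by (simp only: K_alg t)
  qed simp_all
  moreover have "Assoc M ?H ?H ?H \<cdot> (Comul H \<otimes> \<langle>?H\<rangle>) \<cdot> Comul H = (\<langle>?H\<rangle> \<otimes> Comul H) \<cdot> Comul H"
  proof (rule cancel3)
    have "(f \<otimes> (f \<otimes> f)) \<cdot> Assoc M ?H ?H ?H \<cdot> (Comul H \<otimes> \<langle>?H\<rangle>) \<cdot> Comul H
        = Assoc M ?K ?K ?K \<cdot> ((f \<otimes> f) \<otimes> f) \<cdot> (Comul H \<otimes> \<langle>?H\<rangle>) \<cdot> Comul H"
      using assoc_nat_extend[of f f f ?K ?K ?K "(Comul H \<otimes> \<langle>?H\<rangle>) \<cdot> Comul H"] by simp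
    also have "\<dots> = Assoc M ?K ?K ?K \<cdot> (Comul K \<otimes> \<langle>?K\<rangle>) \<cdot> ((f \<otimes> f) \<cdot> Comul H)"
      by (simp add: comul)
    also have "\<dots> = (Assoc M ?K ?K ?K \<cdot> (Comul K \<otimes> \<langle>?K\<rangle>) \<cdot> Comul K) \<cdot> f"
      by (simp flip: comul)
    also have "\<dots> = (\<langle>?K\<rangle> \<otimes> Comul K) \<cdot> ((f \<otimes> f) \<cdot> Comul H)"
      by (simp only: K_coalg) (simp flip: comul)
    also have "\<dots> = (f \<otimes> (f \<otimes> f)) \<cdot> (\<langle>?H\<rangle> \<otimes> Comul H) \<cdot> Comul H"
      by (simp add: comul)
    finally show "(f \<otimes> (f \<otimes> f)) \<cdot> Assoc M ?H ?H ?H \<cdot> (Comul H \<otimes> \<langle>?H\<rangle>) \<cdot> Comul H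
        = (f \<otimes> (f \<otimes> f)) \<cdot> (\<langle>?H\<rangle> \<otimes> Comul H) \<cdot> Comul H" .
  qed simp_all
  moreover have "Lunit M ?H \<cdot> (Counit H \<otimes> \<langle>?H\<rangle>) \<cdot> Comul H = \<langle>?H\<rangle>"
  proof (rule cancel)
    have "f \<cdot> Lunit M ?H \<cdot> (Counit H \<otimes> \<langle>?H\<rangle>) \<cdot> Comul H
        = Lunit M ?K \<cdot> (Counit H \<otimes> f) \<cdot> Comul H"
      by (simp add: lunit_slide[of f])
    also have "\<dots> = Lunit M ?K \<cdot> (Counit K \<otimes> \<langle>?K\<rangle>) \<cdot> (f \<otimes> f) \<cdot> Comul H"
      by (simp add: counit)
    also have "\<dots> = (Lunit M ?K \<cdot> (Counit K \<otimes> \<langle>?K\<rangle>) \<cdot> Comul K) \<cdot> f"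
      by (simp flip: comul)
    finally show "f \<cdot> Lunit M ?H \<cdot> (Counit H \<otimes> \<langle>?H\<rangle>) \<cdot> Comul H = f \<cdot> \<langle>?H\<rangle>"
      by (simp only: K_coalg) simp
  qed simp_all
  moreover have "Runit M ?H \<cdot> (\<langle>?H\<rangle> \<otimes> Counit H) \<cdot> Comul H = \<langle>?H\<rangle>"
  proof (rule cancel)
    have "f \<cdot> Runit M ?H \<cdot> (\<langle>?H\<rangle> \<otimes> Counit H) \<cdot> Comul H
        = Runit M ?K \<cdot> (f \<otimes> Counit H) \<cdot> Comul H"
      by (simp add: runit_slide[of f])
    also have "\<dots> = Runit M ?K \<cdot> (\<langle>?K\<rangle> \<otimes> Counit K) \<cdot> (f \<otimes> f) \<cdot> Comul H"
      by (simp add: counit)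
    also have "\<dots> = (Runit M ?K \<cdot> (\<langle>?K\<rangle> \<otimes> Counit K) \<cdot> Comul K) \<cdot> f"
      by (simp flip: comul)
    finally show "f \<cdot> Runit M ?H \<cdot> (\<langle>?H\<rangle> \<otimes> Counit H) \<cdot> Comul H = f \<cdot> \<langle>?H\<rangle>"
      by (simp only: K_coalg) simp
  qed simp_all
  moreover have "Comul H \<cdot> Mul H = (Mul H \<otimes> Mul H) \<cdot> mid_braid M ?H ?H ?H ?H \<cdot> (Comul H \<otimes> Comul H)"
  proof (rule cancel2)
    have "(f \<otimes> f) \<cdot> Comul H \<cdot> Mul H = Comul K \<cdot> Mul K \<cdot> (f \<otimes> f)"
      by (simp add: comul_extend mul)
    also have "\<dots> = (Comul K \<cdot> Mul K) \<cdot> (f \<otimes> f)"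
      by simp
    also have "\<dots> = (Mul K \<otimes> Mul K) \<cdot> mid_braid M ?K ?K ?K ?K \<cdot> ((Comul K \<cdot> f) \<otimes> (Comul K \<cdot> f))"
      by (simp add: K_bialg)
    also have "\<dots> = (Mul K \<otimes> Mul K) \<cdot> mid_braid M ?K ?K ?K ?K \<cdot> ((f \<otimes> f) \<otimes> (f \<otimes> f)) \<cdot> (Comul H \<otimes> Comul H)"
      by (simp add: comul)
    also have "\<dots> = (Mul K \<otimes> Mul K) \<cdot> ((f \<otimes> f) \<otimes> (f \<otimes> f)) \<cdot> mid_braid M ?H ?H ?H ?H \<cdot> (Comul H \<otimes> Comul H)"
      by (subst mid_braid_nat_extend) simp_all
    also have "\<dots> = (f \<otimes> f) \<cdot> (Mul H \<otimes> Mul H) \<cdot> mid_braid M ?H ?H ?H ?H \<cdot> (Comul H \<otimes> Comul H)"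
      by (simp add: mul)
    finally show "(f \<otimes> f) \<cdot> Comul H \<cdot> Mul H
      = (f \<otimes> f) \<cdot> (Mul H \<otimes> Mul H) \<cdot> mid_braid M ?H ?H ?H ?H \<cdot> (Comul H \<otimes> Comul H)" .
  qed simp_all
  moreover have "Counit H \<cdot> Mul H = unit_mul M \<cdot> (Counit H \<otimes> Counit H)"
  proof -
    have "Counit H \<cdot> Mul H = (Counit K \<cdot> Mul K) \<cdot> (f \<otimes> f)"
      by (simp add: counit_extend mul)
    then show ?thesis
      by (simp only: K_bialg) (simp add: counit)
  qed
  moreover have "Comul H \<cdot> Unit H = (Unit H \<otimes> Unit H) \<cdot> unit_comul M"
  proof (rule cancel2)
    have "(f \<otimes> f) \<cdot> Comul H \<cdot> Unit H = Comul K \<cdot> Unit K"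
      by (simp add: comul_extend unit)
    then show "(f \<otimes> f) \<cdot> Comul H \<cdot> Unit H = (f \<otimes> f) \<cdot> (Unit H \<otimes> Unit H) \<cdot> unit_comul M"
      by (simp add: K_bialg unit)
  qed simp_all
  moreover have "Counit H \<cdot> Unit H = \<langle>\<I>\<rangle>"
    by (simp add: counit_extend unit K_bialg)
  ultimately show ?thesis
    by (simp add: bialgebra_def algebra_def coalgebra_def Hom_iff)
qed

lemma inverse_bialgebra_hom:
  assumes "bialgebra M H" "bialgebra M K" "bialgebra_hom M H K f" "isomorphism M f"
  shows "bialgebra_hom M K H (inverse_arrow M f)" "isomorphism M (inverse_arrow M f)"
proof -
  let ?g = "inverse_arrow M f"
  have f: "algebra_hom M H K f" "coalgebra_hom M H K f"
    using assms(3) by (simp_all add: bialgebra_hom_def)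
  note t [simp] = algebra_type_arr[OF bialgebra_type(1)[OF assms(1)]] coalgebra_type_arr[OF bialgebra_type(2)[OF assms(1)]]
    algebra_type_arr[OF bialgebra_type(1)[OF assms(2)]] coalgebra_type_arr[OF bialgebra_type(2)[OF assms(2)]]
    algebra_homD(1-3)[OF f(1)] assms(4)
  have "?g \<cdot> Mul K = ?g \<cdot> (Mul K \<cdot> (f \<otimes> f)) \<cdot> (?g \<otimes> ?g)"
    by simp
  also have "\<dots> = Mul H \<cdot> (?g \<otimes> ?g)"
    by (simp flip: algebra_homD(4)[OF f(1)])
  finally have mul: "?g \<cdot> Mul K = Mul H \<cdot> (?g \<otimes> ?g)" .
  have unit: "?g \<cdot> Unit K = Unit H"
    by (simp flip: algebra_homD(5)[OF f(1)])
  have "Comul H \<cdot> ?g = (?g \<otimes> ?g) \<cdot> ((f \<otimes> f) \<cdot> Comul H) \<cdot> ?g"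
    by simp
  also have "\<dots> = (?g \<otimes> ?g) \<cdot> Comul K"
    by (simp flip: coalgebra_homD(4)[OF f(2)])
  finally have comul: "Comul H \<cdot> ?g = (?g \<otimes> ?g) \<cdot> Comul K" .
  have counit: "Counit H \<cdot> ?g = Counit K"
    by (simp flip: coalgebra_homD(5)[OF f(2)])
  show "bialgebra_hom M K H ?g"
    using mul unit comul counit
    by (simp add: bialgebra_hom_def algebra_hom_def coalgebra_hom_def Hom_iff)
  show "isomorphism M ?g"
    unfolding isomorphism_def by (intro exI[of _ f] inverse_arrowsI) simp_all
qed

end

section \<open>The coinvariants form a bialgebra\<close>

locale cocommutative_weak_projection = braided_monoidal_category M
  for M :: "('o, 'a, 'm) braided_cat_scheme" (structure) +
  fixes A B R :: "('o, 'a) bialg" and S \<sigma> \<pi> i p :: 'a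
  assumes bialgebra_A: "bialgebra M A" and bialgebra_B: "bialgebra M B" and antipode_S: "antipode M B S"
    and hom_\<sigma>: "bialgebra_hom M B A \<sigma>" and weak_projection: "right_weak_projection M A B \<sigma> \<pi>"
    and i_Hom: "i \<in> Hom M (Car R) (Car A)"
    and equalizer_i: "is_equalizer M i ((\<langle>Car A\<rangle> \<otimes> \<pi>) \<cdot> Comul A)
           ((\<langle>Car A\<rangle> \<otimes> Unit B) \<cdot> inverse_arrow M (Runit M (Car A)))"
    and p_Hom: "p \<in> Hom M (Car A) (Car R)"
    and i_p: "i \<cdot> p = Mul A \<cdot> (\<langle>Car A\<rangle> \<otimes> (\<sigma> \<cdot> S \<cdot> \<pi>)) \<cdot> Comul A"
    and p_i: "p \<cdot> i = \<langle>Car R\<rangle>"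
    and Mul_R: "Mul R = p \<cdot> Mul A \<cdot> (i \<otimes> i)" and Unit_R: "Unit R = p \<cdot> Unit A"
    and Comul_R: "Comul R = (p \<otimes> p) \<cdot> Comul A \<cdot> i" and Counit_R: "Counit R = Counit A \<cdot> i"
    and cocommutative_A: "cocommutative M A"
    and trivial_cocycle: "\<pi> \<cdot> Mul A \<cdot> (i \<otimes> i) = Unit B \<cdot> unit_mul M \<cdot> (Counit R \<otimes> Counit R)"
begin

lemma A_arr [simp]: "Car A \<in> Obj M" 
    "Mul A \<in> Arr M" "Dom M (Mul A) = Car A \<boxtimes> Car A" "Cod M (Mul A) = Car A"
    "Unit A \<in> Arr M" "Dom M (Unit A) = \<I>" "Cod M (Unit A) = Car A"
    "Comul A \<in> Arr M" "Dom M (Comul A) = Car A" "Cod M (Comul A) = Car A \<boxtimes> Car A"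
    "Counit A \<in> Arr M" "Dom M (Counit A) = Car A" "Cod M (Counit A) = \<I>"
  using algebra_type_arr[OF bialgebra_type(1)[OF bialgebra_A]]
    coalgebra_type_arr[OF bialgebra_type(2)[OF bialgebra_A]] by simp_all

lemma B_arr [simp]: "Car B \<in> Obj M" 
    "Mul B \<in> Arr M" "Dom M (Mul B) = Car B \<boxtimes> Car B" "Cod M (Mul B) = Car B"
    "Unit B \<in> Arr M" "Dom M (Unit B) = \<I>" "Cod M (Unit B) = Car B"
    "Comul B \<in> Arr M" "Dom M (Comul B) = Car B" "Cod M (Comul B) = Car B \<boxtimes> Car B"
    "Counit B \<in> Arr M" "Dom M (Counit B) = Car B" "Cod M (Counit B) = \<I>"
    "S \<in> Arr M" "Dom M S = Car B" "Cod M S = Car B"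
  using algebra_type_arr[OF bialgebra_type(1)[OF bialgebra_B]] antipode_S
    coalgebra_type_arr[OF bialgebra_type(2)[OF bialgebra_B]] by (simp_all add: antipode_def Hom_iff)

lemma hom_arr [simp]:
  "\<sigma> \<in> Arr M" "Dom M \<sigma> = Car B" "Cod M \<sigma> = Car A"
  "\<pi> \<in> Arr M" "Dom M \<pi> = Car A" "Cod M \<pi> = Car B"
  "i \<in> Arr M" "Dom M i = Car R" "Cod M i = Car A"
  "p \<in> Arr M" "Dom M p = Car A" "Cod M p = Car R"
  using hom_\<sigma> weak_projection i_Hom p_Hom
  by (simp_all add: bialgebra_hom_def algebra_hom_def right_weak_projection_def coalgebra_hom_def Hom_iff)

lemma R_arr [simp]: "Car R \<in> Obj M" 
    "Mul R \<in> Arr M" "Dom M (Mul R) = Car R \<boxtimes> Car R" "Cod M (Mul R) = Car R"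
    "Unit R \<in> Arr M" "Dom M (Unit R) = \<I>" "Cod M (Unit R) = Car R"
    "Comul R \<in> Arr M" "Dom M (Comul R) = Car R" "Cod M (Comul R) = Car R \<boxtimes> Car R"
    "Counit R \<in> Arr M" "Dom M (Counit R) = Car R" "Cod M (Counit R) = \<I>"
proof -
  show "Car R \<in> Obj M"
    using obj_dom[OF hom_arr(7)] by simp
qed (simp_all add: Mul_R Unit_R Comul_R Counit_R)

lemma types:
  "algebra_type A" "algebra_type B" "algebra_type R" "coalgebra_type A" "coalgebra_type B" "coalgebra_type R"
  by (simp_all add: algebra_type_def coalgebra_type_def Hom_iff)

lemma hom_\<pi>: "coalgebra_hom M A B \<pi>"
  using weak_projection by (simp add: right_weak_projection_def)

lemma comul_A: 
  "Assoc M (Car A) (Car A) (Car A) \<cdot> (Comul A \<otimes> \<langle>Car A\<rangle>) \<cdot> Comul A = (\<langle>Car A\<rangle> \<otimes> Comul A) \<cdot> Comul A"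
  "Lunit M (Car A) \<cdot> (Counit A \<otimes> \<langle>Car A\<rangle>) \<cdot> Comul A = \<langle>Car A\<rangle>"
  "Runit M (Car A) \<cdot> (\<langle>Car A\<rangle> \<otimes> Counit A) \<cdot> Comul A = \<langle>Car A\<rangle>"
  using bialgebra_A by (simp_all add: bialgebra_def coalgebra_def)

lemma comul_B: 
  "Lunit M (Car B) \<cdot> (Counit B \<otimes> \<langle>Car B\<rangle>) \<cdot> Comul B = \<langle>Car B\<rangle>"
  "Runit M (Car B) \<cdot> (\<langle>Car B\<rangle> \<otimes> Counit B) \<cdot> Comul B = \<langle>Car B\<rangle>"
  using bialgebra_B by (simp_all add: bialgebra_def coalgebra_def)

lemma mul_A: 
  "Mul A \<cdot> (Mul A \<otimes> \<langle>Car A\<rangle>) = Mul A \<cdot> (\<langle>Car A\<rangle> \<otimes> Mul A) \<cdot> Assoc M (Car A) (Car A) (Car A)"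
  "Mul A \<cdot> (Unit A \<otimes> \<langle>Car A\<rangle>) = Lunit M (Car A)"
  "Mul A \<cdot> (\<langle>Car A\<rangle> \<otimes> Unit A) = Runit M (Car A)"
  using bialgebra_A by (simp_all add: bialgebra_def algebra_def)

lemma mul_B: 
  "Mul B \<cdot> (Unit B \<otimes> \<langle>Car B\<rangle>) = Lunit M (Car B)"
  "Mul B \<cdot> (\<langle>Car B\<rangle> \<otimes> Unit B) = Runit M (Car B)"
  "Counit B \<cdot> Mul B = Lunit M \<I> \<cdot> (Counit B \<otimes> Counit B)"
  "Comul B \<cdot> Unit B = (Unit B \<otimes> Unit B) \<cdot> unit_comul M" "Counit B \<cdot> Unit B = \<langle>\<I>\<rangle>"
  using bialgebra_B by (simp_all add: bialgebra_def algebra_def unit_mul_eq)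

lemma \<pi>_\<sigma> [simp]: "\<pi> \<cdot> \<sigma> = \<langle>Car B\<rangle>"
  and p_i_simp [simp]: "p \<cdot> i = \<langle>Car R\<rangle>"
  using weak_projection p_i by (simp_all add: right_weak_projection_def)

lemma retraction_cancel [simp]:
  assumes "k \<in> Arr M"
  shows "Cod M k = Car B \<Longrightarrow> \<pi> \<cdot> (\<sigma> \<cdot> k) = k"
    and "Cod M k = Car R \<Longrightarrow> p \<cdot> (i \<cdot> k) = k"
  using assms by (simp_all flip: assoc_comp)

lemma \<sigma>_unit: "\<sigma> \<cdot> Unit B = Unit A"
  and \<sigma>_mul: "\<sigma> \<cdot> Mul B = Mul A \<cdot> (\<sigma> \<otimes> \<sigma>)"
  and coalgebra_hom_\<sigma>: "coalgebra_hom M B A \<sigma>"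
  using hom_\<sigma> by (simp_all add: bialgebra_hom_def algebra_hom_def)

lemma \<pi>_unit: "\<pi> \<cdot> Unit A = Unit B"
  by (simp flip: \<sigma>_unit)


text \<open>
  The product \<open>f \<star> g\<close> of two arrows into \<open>A\<close> lives on the tensor product of their domains.  Equations
  between elements of \<open>A\<close> turn into equations between such products, with associativity constraints left over from
  \<open>star_assoc\<close>.
\<close>

definition star (infixl \<open>\<star>\<close> 70) where
  "f \<star> g = Mul A \<cdot> (f \<otimes> g)"

lemma star_arr [simp]:
  assumes "f \<in> Arr M" "g \<in> Arr M" "Cod M f = Car A" "Cod M g = Car A"
  shows "f \<star> g \<in> Arr M" "Dom M (f \<star> g) = Dom M f \<boxtimes> Dom M g" "Cod M (f \<star> g) = Car A"
  using assms by (simp_all add: star_def)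

lemma star_comp [simp]:
  assumes "f \<in> Arr M" "g \<in> Arr M" "Cod M f = Car A" "Cod M g = Car A"
    "h \<in> Arr M" "k \<in> Arr M" "Cod M h = Dom M f" "Cod M k = Dom M g"
  shows "(f \<star> g) \<cdot> (h \<otimes> k) = (f \<cdot> h) \<star> (g \<cdot> k)"
    and "l \<in> Arr M \<Longrightarrow> Cod M l = Dom M h \<boxtimes> Dom M k \<Longrightarrow> (f \<star> g) \<cdot> ((h \<otimes> k) \<cdot> l) = ((f \<cdot> h) \<star> (g \<cdot> k)) \<cdot> l"
  using assms by (simp_all add: star_def)

lemma star_assoc:
  assumes "f \<in> Arr M" "g \<in> Arr M" "h \<in> Arr M" "Cod M f = Car A" "Cod M g = Car A" "Cod M h = Car A"
    "Dom M f = X" "Dom M g = Y" "Dom M h = Z"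
  shows "(f \<star> g) \<star> h = (f \<star> (g \<star> h)) \<cdot> Assoc M X Y Z"
    and "f \<star> (g \<star> h) = ((f \<star> g) \<star> h) \<cdot> AssocInv M X Y Z"
proof -
  have [simp]: "X \<in> Obj M" "Y \<in> Obj M" "Z \<in> Obj M"
    using assms by auto
  have "(f \<star> g) \<star> h = (Mul A \<cdot> (Mul A \<otimes> \<langle>Car A\<rangle>)) \<cdot> ((f \<otimes> g) \<otimes> h)"
    using assms by (simp add: star_def)
  also have "\<dots> = (f \<star> (g \<star> h)) \<cdot> Assoc M X Y Z"
    using assms assoc_nat[of f g h "Car A" "Car A" "Car A"] by (simp add: star_def mul_A)
  finally show e: "(f \<star> g) \<star> h = (f \<star> (g \<star> h)) \<cdot> Assoc M X Y Z" .
  show "f \<star> (g \<star> h) = ((f \<star> g) \<star> h) \<cdot> AssocInv M X Y Z"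
    using assms by (simp add: e)
qed

lemma star_unit:
  assumes "f \<in> Arr M" "Cod M f = Car A" "Dom M f = X" "e \<in> Arr M" "Cod M e = \<I>" "Dom M e = Y"
  shows "f \<star> (Unit A \<cdot> e) = f \<cdot> Runit M X \<cdot> (\<langle>X\<rangle> \<otimes> e)"
    and "(Unit A \<cdot> e) \<star> f = f \<cdot> Lunit M X \<cdot> (e \<otimes> \<langle>X\<rangle>)"
proof -
  have [simp]: "X \<in> Obj M" "Y \<in> Obj M"
    using assms by auto
  note [simp] = assms
  have "f \<star> (Unit A \<cdot> e) = (Mul A \<cdot> (\<langle>Car A\<rangle> \<otimes> Unit A)) \<cdot> (f \<otimes> e)"
    by (simp add: star_def)
  then show "f \<star> (Unit A \<cdot> e) = f \<cdot> Runit M X \<cdot> (\<langle>X\<rangle> \<otimes> e)"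
    by (simp add: mul_A runit_slide[of f X "Car A"])
  have "(Unit A \<cdot> e) \<star> f = (Mul A \<cdot> (Unit A \<otimes> \<langle>Car A\<rangle>)) \<cdot> (e \<otimes> f)"
    by (simp add: star_def)
  then show "(Unit A \<cdot> e) \<star> f = f \<cdot> Lunit M X \<cdot> (e \<otimes> \<langle>X\<rangle>)"
    by (simp add: mul_A lunit_slide[of f X "Car A"])
qed

lemma star_\<sigma>:
  assumes "f \<in> Arr M" "g \<in> Arr M" "Cod M f = Car B" "Cod M g = Car B"
  shows "(\<sigma> \<cdot> f) \<star> (\<sigma> \<cdot> g) = \<sigma> \<cdot> Mul B \<cdot> (f \<otimes> g)"
proof -
  have "(\<sigma> \<cdot> f) \<star> (\<sigma> \<cdot> g) = (\<sigma> \<cdot> Mul B) \<cdot> (f \<otimes> g)"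
    using assms by (simp add: star_def \<sigma>_mul)
  then show ?thesis
    using assms by simp
qed

lemma \<pi>_star:
  assumes "f \<in> Arr M" "g \<in> Arr M" "Cod M f = Car A" "Cod M g = Car B"
  shows "\<pi> \<cdot> (f \<star> (\<sigma> \<cdot> g)) = Mul B \<cdot> ((\<pi> \<cdot> f) \<otimes> g)"
proof -
  have "\<pi> \<cdot> Mul A \<cdot> (\<langle>Car A\<rangle> \<otimes> \<sigma>) = Mul B \<cdot> (\<pi> \<otimes> \<langle>Car B\<rangle>)"
    using weak_projection by (simp add: right_weak_projection_def)
  then have "(\<pi> \<cdot> Mul A \<cdot> (\<langle>Car A\<rangle> \<otimes> \<sigma>)) \<cdot> (f \<otimes> g) = (Mul B \<cdot> (\<pi> \<otimes> \<langle>Car B\<rangle>)) \<cdot> (f \<otimes> g)"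
    by (simp only:)
  then show ?thesis
    using assms by (simp add: star_def)
qed

lemma star_coalgebra_hom:
  assumes "coalgebra_type C" "coalgebra_type D" "coalgebra_hom M C A f" "coalgebra_hom M D A g"
  shows "coalgebra_hom M (tensor_coalg M C D) A (f \<star> g)"
  unfolding star_def
  by (rule coalgebra_hom_comp[OF _ _ _ coalgebra_hom_tensor bialgebra_mul_coalgebra_hom])
    (simp_all add: assms types tensor_coalg_type bialgebra_A)

lemma i_coinvariant: "(\<langle>Car A\<rangle> \<otimes> \<pi>) \<cdot> Comul A \<cdot> i = (\<langle>Car A\<rangle> \<otimes> Unit B) \<cdot> inverse_arrow M (Runit M (Car A)) \<cdot> i"
  using equalizer_i by (simp add: is_equalizer_def)

text \<open>
  By the universal property \<open>f\<close> factors as \<open>i k\<close>, and \<open>i p i = i\<close>.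
\<close>

lemma coinvariant_fixed:
  assumes "f \<in> Arr M" "Cod M f = Car A"
    and "(\<langle>Car A\<rangle> \<otimes> \<pi>) \<cdot> Comul A \<cdot> f = (\<langle>Car A\<rangle> \<otimes> Unit B) \<cdot> inverse_arrow M (Runit M (Car A)) \<cdot> f"
  shows "i \<cdot> p \<cdot> f = f"
proof -
  have f: "f \<in> Hom M (Dom M f) (Cod M i)"
    using assms by (simp add: Hom_iff)
  have eq: "((\<langle>Car A\<rangle> \<otimes> \<pi>) \<cdot> Comul A) \<cdot> f
      = ((\<langle>Car A\<rangle> \<otimes> Unit B) \<cdot> inverse_arrow M (Runit M (Car A))) \<cdot> f"
    using assms by simp
  obtain k where "k \<in> Hom M (Dom M f) (Dom M i)" "i \<cdot> k = f"
    using equalizer_i f eq unfolding is_equalizer_def by meson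
  then show ?thesis
    by (auto simp: Hom_iff)
qed

text \<open>
  If \<open>f\<close> is a coalgebra morphism, then \<open>(A \<otimes> \<pi>) \<Delta>\<^sub>A f = (f \<otimes> \<pi> f) \<Delta>\<^sub>C\<close>, so coinvariance of \<open>f\<close>
  only requires \<open>\<pi> f\<close> to be trivial.
\<close>

lemma coalgebra_hom_fixed:
  assumes C: "coalgebra_type C" and f: "coalgebra_hom M C A f" and \<pi>f: "\<pi> \<cdot> f = Unit B \<cdot> Counit C"
  shows "i \<cdot> p \<cdot> f = f"
proof (rule coinvariant_fixed)
  note [simp] = coalgebra_type_arr[OF C] coalgebra_homD(1-3)[OF f]
  show "f \<in> Arr M" "Cod M f = Car A" by simp_all
  have "(\<langle>Car A\<rangle> \<otimes> \<pi>) \<cdot> Comul A \<cdot> f = (f \<otimes> (\<pi> \<cdot> f)) \<cdot> Comul C"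
    by (simp add: coalgebra_homD(4)[OF f])
  also have "\<dots> = (f \<otimes> (Unit B \<cdot> Counit A \<cdot> f)) \<cdot> Comul C"
    by (simp add: \<pi>f coalgebra_homD(5)[OF f])
  also have "\<dots> = (\<langle>Car A\<rangle> \<otimes> Unit B) \<cdot> (\<langle>Car A\<rangle> \<otimes> Counit A) \<cdot> (f \<otimes> f) \<cdot> Comul C"
    by simp
  also have "\<dots> = (\<langle>Car A\<rangle> \<otimes> Unit B) \<cdot> (\<langle>Car A\<rangle> \<otimes> Counit A) \<cdot> Comul A \<cdot> f"
    by (simp only: coalgebra_homD(4)[OF f])
  also have "\<dots> = (\<langle>Car A\<rangle> \<otimes> Unit B) \<cdot> inverse_arrow M (Runit M (Car A))
      \<cdot> (Runit M (Car A) \<cdot> (\<langle>Car A\<rangle> \<otimes> Counit A) \<cdot> Comul A) \<cdot> f"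
    by simp
  also have "\<dots> = (\<langle>Car A\<rangle> \<otimes> Unit B) \<cdot> inverse_arrow M (Runit M (Car A)) \<cdot> f"
    by (simp only: comul_A) simp
  finally show "(\<langle>Car A\<rangle> \<otimes> \<pi>) \<cdot> Comul A \<cdot> f
    = (\<langle>Car A\<rangle> \<otimes> Unit B) \<cdot> inverse_arrow M (Runit M (Car A)) \<cdot> f" .
qed

text \<open>
  The antipode axiom composed with the unit, which is grouplike.
\<close>

lemma antipode_unit: "S \<cdot> Unit B = Unit B"
proof -
  have "Unit B = (Unit B \<cdot> Counit B) \<cdot> Unit B"
    by (simp add: mul_B)
  also have "\<dots> = (Mul B \<cdot> (S \<otimes> \<langle>Car B\<rangle>) \<cdot> Comul B) \<cdot> Unit B"
    using antipode_S by (simp only: antipode_def)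
  also have "\<dots> = (Mul B \<cdot> (\<langle>Car B\<rangle> \<otimes> Unit B)) \<cdot> ((S \<cdot> Unit B) \<otimes> \<langle>\<I>\<rangle>) \<cdot> unit_comul M"
    by (simp add: mul_B(4))
  also have "\<dots> = (S \<cdot> Unit B) \<cdot> (unit_mul M \<cdot> unit_comul M)"
    by (simp add: mul_B runit_slide[of _ \<I>] unit_mul_eq lunit_unit_eq_runit_unit del: arr_unit_comul(7))
  finally show ?thesis
    by simp
qed

text \<open>
  By coassociativity \<open>(A \<otimes> m(A \<otimes> \<sigma>S\<pi>)\<Delta>) \<Delta> i\<close> can be computed by applying \<open>\<sigma>S\<pi>\<close> to the second leg of
  \<open>\<Delta> i\<close> first, where coinvariance makes it a unit.
\<close>

lemma ip_comul_right: "(\<langle>Car A\<rangle> \<otimes> (i \<cdot> p)) \<cdot> Comul A \<cdot> i = Comul A \<cdot> i"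
proof -
  let ?a = "Assoc M (Car A) (Car A) (Car A)" and ?f = "\<sigma> \<cdot> S \<cdot> \<pi>"
  have "(\<langle>Car A\<rangle> \<otimes> ?f) \<cdot> Comul A \<cdot> i = (\<langle>Car A\<rangle> \<otimes> (\<sigma> \<cdot> S)) \<cdot> (\<langle>Car A\<rangle> \<otimes> \<pi>) \<cdot> Comul A \<cdot> i"
    by simp
  also have "\<dots> = (\<langle>Car A\<rangle> \<otimes> Unit A) \<cdot> inverse_arrow M (Runit M (Car A)) \<cdot> i"
    by (simp only: i_coinvariant) (simp add: antipode_unit \<sigma>_unit)
  finally have f: "(\<langle>Car A\<rangle> \<otimes> ?f) \<cdot> Comul A \<cdot> i = (\<langle>Car A\<rangle> \<otimes> Unit A) \<cdot> inverse_arrow M (Runit M (Car A)) \<cdot> i" .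
  have "(\<langle>Car A\<rangle> \<otimes> (i \<cdot> p)) \<cdot> Comul A \<cdot> i
      = (\<langle>Car A\<rangle> \<otimes> Mul A) \<cdot> (\<langle>Car A\<rangle> \<otimes> (\<langle>Car A\<rangle> \<otimes> ?f)) \<cdot> ((\<langle>Car A\<rangle> \<otimes> Comul A) \<cdot> Comul A) \<cdot> i"
    by (simp add: i_p)
  also have "\<dots> = (\<langle>Car A\<rangle> \<otimes> Mul A) \<cdot> ((\<langle>Car A\<rangle> \<otimes> (\<langle>Car A\<rangle> \<otimes> ?f)) \<cdot> ?a) \<cdot> (Comul A \<otimes> \<langle>Car A\<rangle>) \<cdot> Comul A \<cdot> i"
    by (simp flip: comul_A(1))
  also have "(\<langle>Car A\<rangle> \<otimes> (\<langle>Car A\<rangle> \<otimes> ?f)) \<cdot> ?a = ?a \<cdot> (\<langle>Car A \<boxtimes> Car A\<rangle> \<otimes> ?f)"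
    using assoc_nat[of "\<langle>Car A\<rangle>" "\<langle>Car A\<rangle>" ?f "Car A" "Car A" "Car A"] by simp
  also have "(\<langle>Car A\<rangle> \<otimes> Mul A) \<cdot> (?a \<cdot> (\<langle>Car A \<boxtimes> Car A\<rangle> \<otimes> ?f)) \<cdot> (Comul A \<otimes> \<langle>Car A\<rangle>) \<cdot> Comul A \<cdot> i
      = (\<langle>Car A\<rangle> \<otimes> Mul A) \<cdot> ?a \<cdot> (Comul A \<otimes> \<langle>Car A\<rangle>) \<cdot> ((\<langle>Car A\<rangle> \<otimes> ?f) \<cdot> Comul A \<cdot> i)"
    by simp
  also have "\<dots> = (\<langle>Car A\<rangle> \<otimes> Mul A) \<cdot> (?a \<cdot> (\<langle>Car A \<boxtimes> Car A\<rangle> \<otimes> Unit A))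
      \<cdot> (Comul A \<otimes> \<langle>\<I>\<rangle>) \<cdot> inverse_arrow M (Runit M (Car A)) \<cdot> i"
    by (simp only: f) simp
  also have "?a \<cdot> (\<langle>Car A \<boxtimes> Car A\<rangle> \<otimes> Unit A) = (\<langle>Car A\<rangle> \<otimes> (\<langle>Car A\<rangle> \<otimes> Unit A)) \<cdot> Assoc M (Car A) (Car A) \<I>"
    using assoc_nat[of "\<langle>Car A\<rangle>" "\<langle>Car A\<rangle>" "Unit A" "Car A" "Car A" "Car A"] by simp
  also have "(\<langle>Car A\<rangle> \<otimes> Mul A) \<cdot> ((\<langle>Car A\<rangle> \<otimes> (\<langle>Car A\<rangle> \<otimes> Unit A)) \<cdot> Assoc M (Car A) (Car A) \<I>)
      \<cdot> (Comul A \<otimes> \<langle>\<I>\<rangle>) \<cdot> inverse_arrow M (Runit M (Car A)) \<cdot> i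
    = ((\<langle>Car A\<rangle> \<otimes> Runit M (Car A)) \<cdot> Assoc M (Car A) (Car A) \<I>)
      \<cdot> (Comul A \<otimes> \<langle>\<I>\<rangle>) \<cdot> inverse_arrow M (Runit M (Car A)) \<cdot> i"
    by (simp add: mul_A)
  also have "\<dots> = Comul A \<cdot> Runit M (Car A) \<cdot> inverse_arrow M (Runit M (Car A)) \<cdot> i"
    by (simp add: runit_tensor runit_slide[of "Comul A" "Car A" "Car A \<boxtimes> Car A"] del: inverse_arrow_cancel)
  finally show ?thesis
    by simp
qed

lemma ip_comul_left: "((i \<cdot> p) \<otimes> \<langle>Car A\<rangle>) \<cdot> Comul A \<cdot> i = Comul A \<cdot> i"
proof -
  let ?c = "Braid M (Car A) (Car A)"
  have c: "?c \<cdot> (Comul A \<cdot> k) = Comul A \<cdot> k" if "k \<in> Arr M" "Cod M k = Car A" for k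
    using that cocommutative_A by (simp add: cocommutative_def flip: assoc_comp)
  have "((i \<cdot> p) \<otimes> \<langle>Car A\<rangle>) \<cdot> Comul A \<cdot> i = ((i \<cdot> p) \<otimes> \<langle>Car A\<rangle>) \<cdot> ?c \<cdot> Comul A \<cdot> i"
    by (simp add: c)
  also have "\<dots> = ?c \<cdot> ((\<langle>Car A\<rangle> \<otimes> (i \<cdot> p)) \<cdot> Comul A \<cdot> i)"
    by (subst braid_nat_extend) simp_all
  also have "\<dots> = Comul A \<cdot> i"
    by (simp only: ip_comul_right) (simp add: c)
  finally show ?thesis .
qed

text \<open>
  With \<open>\<Delta>\<^sub>R = (p \<otimes> p) \<Delta>\<^sub>A i\<close> the claim \<open>(i \<otimes> i) \<Delta>\<^sub>R = \<Delta>\<^sub>A i\<close> says that both legs of \<open>\<Delta>\<^sub>A i\<close> are fixed by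
  \<open>i p\<close>.  The left leg is where cocommutativity is needed.
\<close>

lemma coalgebra_hom_i: "coalgebra_hom M R A i"
proof -
  have "(i \<otimes> i) \<cdot> Comul R = (\<langle>Car A\<rangle> \<otimes> (i \<cdot> p)) \<cdot> ((i \<cdot> p) \<otimes> \<langle>Car A\<rangle>) \<cdot> Comul A \<cdot> i"
    by (simp add: Comul_R)
  also have "\<dots> = Comul A \<cdot> i"
    by (simp only: ip_comul_left ip_comul_right)
  finally show ?thesis
    by (simp add: coalgebra_hom_def Hom_iff Counit_R)
qed

text \<open>
  Both \<open>i \<star> i\<close> and the unit of \<open>A\<close> are coalgebra morphisms whose image under \<open>\<pi>\<close> is trivial; for \<open>i \<star> i\<close>
  this is the hypothesis on \<open>\<xi>\<close>.
\<close>

lemma algebra_hom_i: "algebra_hom M R A i"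
proof -
  have "i \<cdot> p \<cdot> (i \<star> i) = i \<star> i"
  proof (rule coalgebra_hom_fixed)
    show "coalgebra_hom M (tensor_coalg M R R) A (i \<star> i)" "coalgebra_type (tensor_coalg M R R)"
      by (intro star_coalgebra_hom tensor_coalg_type types coalgebra_hom_i)+
    show "\<pi> \<cdot> (i \<star> i) = Unit B \<cdot> Counit (tensor_coalg M R R)"
      by (simp add: star_def trivial_cocycle tensor_coalg_def)
  qed
  moreover have "i \<cdot> p \<cdot> Unit A = Unit A"
  proof (rule coalgebra_hom_fixed)
    \<comment> \<open>The unit object is a coalgebra, and \<open>u\<^sub>A\<close> a coalgebra morphism from it.\<close>
    let ?I = "\<lparr>Car = \<I>, Comul = unit_comul M, Counit = \<langle>\<I>\<rangle>\<rparr>"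
    show "coalgebra_type ?I"
      by (simp add: coalgebra_type_def Hom_iff)
    show "coalgebra_hom M ?I A (Unit A)"
      using bialgebra_A by (simp add: coalgebra_hom_def bialgebra_def Hom_iff)
    show "\<pi> \<cdot> Unit A = Unit B \<cdot> Counit ?I"
      by (simp add: \<pi>_unit)
  qed
  ultimately show ?thesis
    by (simp add: algebra_hom_def Hom_iff Mul_R Unit_R star_def)
qed

lemma bialgebra_R: "bialgebra M R"
  by (rule bialgebra_transport[OF bialgebra_A types(3,6) algebra_hom_i coalgebra_hom_i, of p]) simp_all

lemma comul_R: 
  "Lunit M (Car R) \<cdot> (Counit R \<otimes> \<langle>Car R\<rangle>) \<cdot> Comul R = \<langle>Car R\<rangle>"
  "Runit M (Car R) \<cdot> (\<langle>Car R\<rangle> \<otimes> Counit R) \<cdot> Comul R = \<langle>Car R\<rangle>"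
  using bialgebra_R by (simp_all add: bialgebra_def coalgebra_def)

lemma i_mul: "i \<cdot> Mul R = i \<star> i" and i_unit: "i \<cdot> Unit R = Unit A"
  using algebra_hom_i by (simp_all add: algebra_hom_def star_def)

text \<open>
  Apply \<open>\<epsilon>\<^sub>A\<close> to the first leg of the coinvariance equation.
\<close>

lemma \<pi>_i: "\<pi> \<cdot> i = Unit B \<cdot> Counit R"
proof -
  have "\<pi> \<cdot> i = \<pi> \<cdot> (Lunit M (Car A) \<cdot> (Counit A \<otimes> \<langle>Car A\<rangle>) \<cdot> Comul A) \<cdot> i"
    by (simp only: comul_A) simp
  also have "\<dots> = Lunit M (Car B) \<cdot> (Counit A \<otimes> \<langle>Car B\<rangle>) \<cdot> ((\<langle>Car A\<rangle> \<otimes> \<pi>) \<cdot> Comul A \<cdot> i)"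
    by (simp add: lunit_slide[of \<pi> "Car A" "Car B"])
  also have "\<dots> = (Unit B \<cdot> Lunit M \<I>) \<cdot> (Counit A \<otimes> \<langle>\<I>\<rangle>) \<cdot> inverse_arrow M (Runit M (Car A)) \<cdot> i"
    by (simp only: i_coinvariant) (simp add: lunit_slide[of "Unit B" \<I> "Car B"])
  also have "\<dots> = Unit B \<cdot> Counit A \<cdot> Runit M (Car A) \<cdot> inverse_arrow M (Runit M (Car A)) \<cdot> i"
    by (simp add: lunit_unit_eq_runit_unit runit_slide[of "Counit A" "Car A" \<I>] del: inverse_arrow_cancel)
  finally show ?thesis
    by (simp add: Counit_R)
qed

end

section \<open>The isomorphism of coalgebras between \<open>R \<otimes> B\<close> and \<open>A\<close>\<close>

context cocommutative_weak_projection
begin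

definition \<omega> where "\<omega> = i \<star> \<sigma>"
definition \<omega>' where "\<omega>' = (p \<otimes> \<pi>) \<cdot> Comul A"
definition lact where "lact = p \<cdot> (\<sigma> \<star> i)"
definition ract where "ract = \<pi> \<cdot> (\<sigma> \<star> i)"

lemma \<omega>_arr [simp]:
  "\<omega> \<in> Arr M" "Dom M \<omega> = Car R \<boxtimes> Car B" "Cod M \<omega> = Car A"
  "\<omega>' \<in> Arr M" "Dom M \<omega>' = Car A" "Cod M \<omega>' = Car R \<boxtimes> Car B"
  "lact \<in> Arr M" "Dom M lact = Car B \<boxtimes> Car R" "Cod M lact = Car R"
  "ract \<in> Arr M" "Dom M ract = Car B \<boxtimes> Car R" "Cod M ract = Car B"
  by (simp_all add: \<omega>_def \<omega>'_def lact_def ract_def)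

lemma coalgebra_hom_\<omega>: "coalgebra_hom M (tensor_coalg M R B) A \<omega>"
  unfolding \<omega>_def by (intro star_coalgebra_hom types coalgebra_hom_i coalgebra_hom_\<sigma>)

lemma comul_\<omega>: "Comul A \<cdot> \<omega> = (\<omega> \<otimes> \<omega>) \<cdot> mid_braid M (Car R) (Car R) (Car B) (Car B) \<cdot> (Comul R \<otimes> Comul B)"
  and counit_\<omega>: "Counit A \<cdot> \<omega> = Lunit M \<I> \<cdot> (Counit R \<otimes> Counit B)"
  using coalgebra_homD(4,5)[OF coalgebra_hom_\<omega>] by (simp_all add: tensor_coalg_def unit_mul_eq)

lemma \<pi>_\<omega>: "\<pi> \<cdot> \<omega> = Lunit M (Car B) \<cdot> (Counit R \<otimes> \<langle>Car B\<rangle>)"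
proof -
  have "\<pi> \<cdot> \<omega> = (Mul B \<cdot> (Unit B \<otimes> \<langle>Car B\<rangle>)) \<cdot> (Counit R \<otimes> \<langle>Car B\<rangle>)"
    using \<pi>_star[of i "\<langle>Car B\<rangle>"] by (simp add: \<omega>_def \<pi>_i)
  then show ?thesis
    by (simp only: mul_B)
qed

text \<open>
  \<open>\<omega>\<close> is colinear for the right coactions of \<open>B\<close> by \<open>R \<otimes> \<Delta>\<^sub>B\<close> and by \<open>(A \<otimes> \<pi>) \<Delta>\<^sub>A\<close>.  Since \<open>\<pi> \<omega>\<close> is
  \<open>\<epsilon>\<^sub>R \<otimes> B\<close>, the braiding that exchanges the second leg of \<open>\<Delta>\<^sub>R\<close> with the first leg of \<open>\<Delta>\<^sub>B\<close> meets only a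
  unit object.
\<close>

lemma comodule_\<omega>:
  "(\<langle>Car A\<rangle> \<otimes> \<pi>) \<cdot> Comul A \<cdot> \<omega>
    = (\<omega> \<otimes> \<langle>Car B\<rangle>) \<cdot> AssocInv M (Car R) (Car B) (Car B) \<cdot> (\<langle>Car R\<rangle> \<otimes> Comul B)"
proof -
  have "(\<langle>Car A\<rangle> \<otimes> \<pi>) \<cdot> Comul A \<cdot> \<omega>
      = (\<omega> \<otimes> Lunit M (Car B)) \<cdot> ((\<langle>Car R\<rangle> \<otimes> \<langle>Car B\<rangle>) \<otimes> (Counit R \<otimes> \<langle>Car B\<rangle>))
        \<cdot> mid_braid M (Car R) (Car R) (Car B) (Car B) \<cdot> (Comul R \<otimes> Comul B)"
    by (simp add: comul_\<omega> \<pi>_\<omega>)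
  also have "\<dots> = (\<omega> \<otimes> Lunit M (Car B)) \<cdot> mid_braid M (Car R) \<I> (Car B) (Car B)
        \<cdot> ((\<langle>Car R\<rangle> \<otimes> Counit R) \<otimes> (\<langle>Car B\<rangle> \<otimes> \<langle>Car B\<rangle>)) \<cdot> (Comul R \<otimes> Comul B)"
    by (subst mid_braid_nat_extend) simp_all
  also have "\<dots> = (\<omega> \<otimes> \<langle>Car B\<rangle>) \<cdot> ((\<langle>Car R \<boxtimes> Car B\<rangle> \<otimes> Lunit M (Car B)) \<cdot> mid_braid M (Car R) \<I> (Car B) (Car B))
        \<cdot> (((\<langle>Car R\<rangle> \<otimes> Counit R) \<cdot> Comul R) \<otimes> Comul B)"
    by simp
  also have "\<dots> = (\<omega> \<otimes> \<langle>Car B\<rangle>) \<cdot> AssocInv M (Car R) (Car B) (Car B)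
        \<cdot> ((Runit M (Car R) \<cdot> (\<langle>Car R\<rangle> \<otimes> Counit R) \<cdot> Comul R) \<otimes> Comul B)"
    by (simp add: mid_braid_unit_second)
  finally show ?thesis
    by (simp only: comul_R)
qed

text \<open>
  \<open>i p (r b) = r b\<^sub>1 \<sigma>S(b\<^sub>2) = r \<epsilon>(b)\<close>.  Going through colinearity avoids evaluating the antipode on
  products.
\<close>

lemma p_\<omega>: "p \<cdot> \<omega> = Runit M (Car R) \<cdot> (\<langle>Car R\<rangle> \<otimes> Counit B)"
proof -
  have S: "Mul B \<cdot> (\<langle>Car B\<rangle> \<otimes> S) \<cdot> Comul B = Unit B \<cdot> Counit B"
    using antipode_S by (simp add: antipode_def)
  have "i \<cdot> p \<cdot> \<omega> = (\<langle>Car A\<rangle> \<star> (\<sigma> \<cdot> S)) \<cdot> ((\<langle>Car A\<rangle> \<otimes> \<pi>) \<cdot> Comul A \<cdot> \<omega>)"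
    by (simp add: star_def i_p flip: assoc_comp[of \<omega> p i])
  also have "\<dots> = ((i \<star> \<sigma>) \<star> (\<sigma> \<cdot> S)) \<cdot> AssocInv M (Car R) (Car B) (Car B) \<cdot> (\<langle>Car R\<rangle> \<otimes> Comul B)"
    by (simp only: comodule_\<omega>) (simp add: \<omega>_def)
  also have "\<dots> = (i \<star> ((\<sigma> \<cdot> \<langle>Car B\<rangle>) \<star> (\<sigma> \<cdot> S))) \<cdot> (\<langle>Car R\<rangle> \<otimes> Comul B)"
    by (simp add: star_assoc(1)[of i \<sigma> "\<sigma> \<cdot> S" "Car R" "Car B" "Car B"])
  also have "\<dots> = i \<star> (\<sigma> \<cdot> Mul B \<cdot> (\<langle>Car B\<rangle> \<otimes> S) \<cdot> Comul B)"
    by (subst star_\<sigma>) simp_all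
  also have "\<dots> = i \<star> (Unit A \<cdot> Counit B)"
    by (simp add: S flip: \<sigma>_unit)
  also have "\<dots> = i \<cdot> Runit M (Car R) \<cdot> (\<langle>Car R\<rangle> \<otimes> Counit B)"
    by (subst star_unit) simp_all
  finally have "p \<cdot> (i \<cdot> p \<cdot> \<omega>) = p \<cdot> (i \<cdot> Runit M (Car R) \<cdot> (\<langle>Car R\<rangle> \<otimes> Counit B))"
    by (simp only:)
  then show ?thesis
    by simp
qed

text \<open>
  \<open>a\<^sub>1 \<sigma>S\<pi>(a\<^sub>2) \<sigma>\<pi>(a\<^sub>3) = a\<close>, because \<open>\<sigma>S\<pi>\<close> is a left convolution inverse of \<open>\<sigma>\<pi>\<close>.
\<close>

lemma \<omega>_\<omega>' [simp]: "\<omega> \<cdot> \<omega>' = \<langle>Car A\<rangle>"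
proof -
  let ?f = "\<sigma> \<cdot> S \<cdot> \<pi>" and ?g = "\<sigma> \<cdot> \<pi>" and ?a = "Assoc M (Car A) (Car A) (Car A)"
  have S: "Mul B \<cdot> (S \<otimes> \<langle>Car B\<rangle>) \<cdot> Comul B = Unit B \<cdot> Counit B"
    using antipode_S by (simp add: antipode_def)
  have "(?f \<star> ?g) \<cdot> Comul A = \<sigma> \<cdot> Mul B \<cdot> (S \<otimes> \<langle>Car B\<rangle>) \<cdot> ((\<pi> \<otimes> \<pi>) \<cdot> Comul A)"
    by (subst star_\<sigma>) simp_all
  also have "\<dots> = \<sigma> \<cdot> (Mul B \<cdot> (S \<otimes> \<langle>Car B\<rangle>) \<cdot> Comul B) \<cdot> \<pi>"
    by (simp flip: coalgebra_homD(4)[OF hom_\<pi>])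
  also have "\<dots> = (\<sigma> \<cdot> Unit B) \<cdot> (Counit B \<cdot> \<pi>)"
    by (simp add: S)
  also have "\<dots> = Unit A \<cdot> Counit A"
    by (simp only: \<sigma>_unit coalgebra_homD(5)[OF hom_\<pi>])
  finally have conv: "(?f \<star> ?g) \<cdot> Comul A = Unit A \<cdot> Counit A" .
  have "\<omega> \<cdot> \<omega>' = ((i \<cdot> p) \<star> ?g) \<cdot> Comul A"
    by (simp add: \<omega>_def \<omega>'_def)
  also have "\<dots> = ((\<langle>Car A\<rangle> \<star> ?f) \<star> ?g) \<cdot> (Comul A \<otimes> \<langle>Car A\<rangle>) \<cdot> Comul A"
    by (simp add: i_p star_def)
  also have "\<dots> = (\<langle>Car A\<rangle> \<star> (?f \<star> ?g)) \<cdot> (?a \<cdot> (Comul A \<otimes> \<langle>Car A\<rangle>) \<cdot> Comul A)"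
    by (subst star_assoc(1)[of _ _ _ "Car A" "Car A" "Car A"]) simp_all
  also have "\<dots> = (\<langle>Car A\<rangle> \<star> ((?f \<star> ?g) \<cdot> Comul A)) \<cdot> Comul A"
    by (simp only: comul_A) simp
  also have "\<dots> = (\<langle>Car A\<rangle> \<star> (Unit A \<cdot> Counit A)) \<cdot> Comul A"
    by (simp only: conv)
  also have "\<dots> = Runit M (Car A) \<cdot> (\<langle>Car A\<rangle> \<otimes> Counit A) \<cdot> Comul A"
    by (simp add: star_unit(1)[of _ "Car A" "Counit A" "Car A"])
  finally show ?thesis
    by (simp only: comul_A)
qed

lemma \<omega>'_\<omega> [simp]: "\<omega>' \<cdot> \<omega> = \<langle>Car R \<boxtimes> Car B\<rangle>"
proof -
  have "\<omega>' \<cdot> \<omega> = (p \<otimes> \<langle>Car B\<rangle>) \<cdot> ((\<langle>Car A\<rangle> \<otimes> \<pi>) \<cdot> Comul A \<cdot> \<omega>)"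
    by (simp add: \<omega>'_def)
  also have "\<dots> = (Runit M (Car R) \<otimes> \<langle>Car B\<rangle>) \<cdot> ((\<langle>Car R\<rangle> \<otimes> Counit B) \<otimes> \<langle>Car B\<rangle>)
      \<cdot> AssocInv M (Car R) (Car B) (Car B) \<cdot> (\<langle>Car R\<rangle> \<otimes> Comul B)"
    by (simp only: comodule_\<omega>) (simp add: p_\<omega>)
  also have "\<dots> = (Runit M (Car R) \<otimes> \<langle>Car B\<rangle>) \<cdot> AssocInv M (Car R) \<I> (Car B)
      \<cdot> (\<langle>Car R\<rangle> \<otimes> (Counit B \<otimes> \<langle>Car B\<rangle>)) \<cdot> (\<langle>Car R\<rangle> \<otimes> Comul B)"
    by (subst assoc_inv_nat_extend) simp_all
  also have "\<dots> = ((Runit M (Car R) \<otimes> \<langle>Car B\<rangle>) \<cdot> AssocInv M (Car R) \<I> (Car B))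
      \<cdot> (\<langle>Car R\<rangle> \<otimes> ((Counit B \<otimes> \<langle>Car B\<rangle>) \<cdot> Comul B))"
    by simp
  also have "(Runit M (Car R) \<otimes> \<langle>Car B\<rangle>) \<cdot> AssocInv M (Car R) \<I> (Car B) = \<langle>Car R\<rangle> \<otimes> Lunit M (Car B)"
    by (simp flip: triangle)
  also have "(\<langle>Car R\<rangle> \<otimes> Lunit M (Car B)) \<cdot> (\<langle>Car R\<rangle> \<otimes> ((Counit B \<otimes> \<langle>Car B\<rangle>) \<cdot> Comul B)) = \<langle>Car R \<boxtimes> Car B\<rangle>"
    by (simp add: comul_B)
  finally show ?thesis .
qed

lemma iso_\<omega>: "isomorphism M \<omega>"
  unfolding isomorphism_def by (intro exI[of _ \<omega>'] inverse_arrowsI) simp_all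

lemma \<omega>_expand: "f \<in> Arr M \<Longrightarrow> Cod M f = Car A \<Longrightarrow> \<omega> \<cdot> \<omega>' \<cdot> f = f"
  by (simp flip: assoc_comp)

text \<open>
  Identities for an arbitrary arrow into \<open>A\<close> are proved below by writing it as a product of one from \<open>R\<close> and one
  from \<open>B\<close>.
\<close>

lemma \<omega>_factor:
  assumes "f \<in> Arr M" "Cod M f = Car A"
  obtains h where "h \<in> Arr M" "Dom M h = Dom M f" "Cod M h = Car R \<boxtimes> Car B" "f = \<omega> \<cdot> h"
  using assms \<omega>_expand[OF assms] that[of "\<omega>' \<cdot> f"] by simp

text \<open>
  Under \<open>\<omega>\<close> the arrow \<open>p\<close> becomes \<open>R \<otimes> \<epsilon>\<^sub>B\<close>, a coalgebra morphism.
\<close>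

lemma coalgebra_hom_p: "coalgebra_hom M A R p"
proof -
  have counit: "Lunit M \<I> \<cdot> (Counit B \<otimes> Counit B) \<cdot> Comul B = Counit B"
  proof -
    have "Lunit M \<I> \<cdot> (Counit B \<otimes> Counit B) \<cdot> Comul B
        = Counit B \<cdot> (Lunit M (Car B) \<cdot> (Counit B \<otimes> \<langle>Car B\<rangle>) \<cdot> Comul B)"
      by (simp add: lunit_slide[of "Counit B" "Car B" \<I>] del: assoc_comp) 
    then show ?thesis by (simp only: comul_B) simp
  qed
  have "Comul R \<cdot> p = (p \<otimes> p) \<cdot> Comul A"
  proof (rule iso_cancel_right[OF iso_\<omega>])
    have "((p \<otimes> p) \<cdot> Comul A) \<cdot> \<omega> = (Runit M (Car R) \<otimes> Runit M (Car R))
        \<cdot> ((\<langle>Car R\<rangle> \<otimes> Counit B) \<otimes> (\<langle>Car R\<rangle> \<otimes> Counit B))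
        \<cdot> mid_braid M (Car R) (Car R) (Car B) (Car B) \<cdot> (Comul R \<otimes> Comul B)"
      by (simp add: comul_\<omega> p_\<omega>)
    also have "\<dots> = (Runit M (Car R) \<otimes> Runit M (Car R)) \<cdot> mid_braid M (Car R) (Car R) \<I> \<I>
        \<cdot> ((\<langle>Car R\<rangle> \<otimes> \<langle>Car R\<rangle>) \<otimes> (Counit B \<otimes> Counit B)) \<cdot> (Comul R \<otimes> Comul B)"
      by (subst mid_braid_nat_extend) simp_all
    also have "\<dots> = ((Runit M (Car R) \<otimes> Runit M (Car R)) \<cdot> mid_braid M (Car R) (Car R) \<I> \<I>)
        \<cdot> (Comul R \<otimes> ((Counit B \<otimes> Counit B) \<cdot> Comul B))"
      by simp
    also have "\<dots> = Runit M (Car R \<boxtimes> Car R) \<cdot> (Comul R \<otimes> (Lunit M \<I> \<cdot> (Counit B \<otimes> Counit B) \<cdot> Comul B))"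
      by (simp add: mid_braid_unit_unit)
    also have "\<dots> = (Comul R \<cdot> p) \<cdot> \<omega>"
      by (simp add: counit p_\<omega> runit_slide[of "Comul R" "Car R" "Car R \<boxtimes> Car R"])
    finally show "(Comul R \<cdot> p) \<cdot> \<omega> = ((p \<otimes> p) \<cdot> Comul A) \<cdot> \<omega>" ..
  qed simp_all
  moreover have "Counit R \<cdot> p = Counit A"
  proof (rule iso_cancel_right[OF iso_\<omega>])
    show "(Counit R \<cdot> p) \<cdot> \<omega> = Counit A \<cdot> \<omega>"
      by (simp add: p_\<omega> counit_\<omega> runit_slide[of "Counit R" "Car R" \<I>] lunit_unit_eq_runit_unit)
  qed simp_all
  ultimately show ?thesis
    by (simp add: coalgebra_hom_def Hom_iff)
qed

text \<open>
  Write \<open>a = r b'\<close> in \<open>A\<close>, using \<open>\<omega>\<close>: both \<open>p (a \<sigma>(b))\<close> and \<open>p(a) \<epsilon>(b)\<close> are \<open>r \<epsilon>(b') \<epsilon>(b)\<close>.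
\<close>

lemma p_star_\<sigma>:
  assumes "f \<in> Arr M" "Cod M f = Car A" "Dom M f = X"
  shows "p \<cdot> (f \<star> \<sigma>) = p \<cdot> f \<cdot> Runit M X \<cdot> (\<langle>X\<rangle> \<otimes> Counit B)"
proof -
  obtain h where h [simp]: "h \<in> Arr M" "Dom M h = X" "Cod M h = Car R \<boxtimes> Car B" and f: "f = \<omega> \<cdot> h"
    using \<omega>_factor[OF assms(1,2)] assms(3) by metis
  have [simp]: "X \<in> Obj M" using obj_dom[OF h(1)] by simp
  let ?a = "Assoc M (Car R) (Car B) (Car B)"
  have "f \<star> \<sigma> = ((i \<star> \<sigma>) \<star> \<sigma>) \<cdot> (h \<otimes> \<langle>Car B\<rangle>)"
    by (simp add: f \<omega>_def)
  also have "\<dots> = (i \<star> ((\<sigma> \<cdot> \<langle>Car B\<rangle>) \<star> (\<sigma> \<cdot> \<langle>Car B\<rangle>))) \<cdot> ?a \<cdot> (h \<otimes> \<langle>Car B\<rangle>)"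
    by (subst star_assoc(1)[of _ _ _ "Car R" "Car B" "Car B"]) simp_all
  also have "\<dots> = \<omega> \<cdot> (\<langle>Car R\<rangle> \<otimes> Mul B) \<cdot> ?a \<cdot> (h \<otimes> \<langle>Car B\<rangle>)"
    by (subst star_\<sigma>) (simp_all add: \<omega>_def)
  finally have "p \<cdot> (f \<star> \<sigma>) = (p \<cdot> \<omega>) \<cdot> (\<langle>Car R\<rangle> \<otimes> Mul B) \<cdot> ?a \<cdot> (h \<otimes> \<langle>Car B\<rangle>)"
    by simp
  also have "\<dots> = Runit M (Car R) \<cdot> (\<langle>Car R\<rangle> \<otimes> Lunit M \<I>)
      \<cdot> (\<langle>Car R\<rangle> \<otimes> (Counit B \<otimes> Counit B)) \<cdot> ?a \<cdot> (h \<otimes> \<langle>Car B\<rangle>)"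
    by (simp only: p_\<omega>) (simp add: mul_B)
  also have "\<dots> = Runit M (Car R) \<cdot> ((\<langle>Car R\<rangle> \<otimes> Lunit M \<I>) \<cdot> Assoc M (Car R) \<I> \<I>)
      \<cdot> ((\<langle>Car R\<rangle> \<otimes> Counit B) \<otimes> Counit B) \<cdot> (h \<otimes> \<langle>Car B\<rangle>)"
    using assoc_nat_extend[of "\<langle>Car R\<rangle>" "Counit B" "Counit B" "Car R" \<I> \<I> "h \<otimes> \<langle>Car B\<rangle>"]
    by (simp del: interchange_extend interchange)
  also have "\<dots> = Runit M (Car R) \<cdot> (((Runit M (Car R) \<cdot> (\<langle>Car R\<rangle> \<otimes> Counit B)) \<cdot> h) \<otimes> Counit B)"
    by (simp add: triangle)
  also have "\<dots> = Runit M (Car R) \<cdot> ((p \<cdot> f) \<otimes> Counit B)"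
    by (simp add: f flip: p_\<omega>)
  also have "\<dots> = p \<cdot> f \<cdot> Runit M X \<cdot> (\<langle>X\<rangle> \<otimes> Counit B)"
    using assms by (simp add: runit_slide[of f X "Car A"] runit_slide[of p "Car A" "Car R"])
  finally show ?thesis .
qed

text \<open>
  For \<open>a' = r b\<close> both \<open>p (a \<cdot> i p(a'))\<close> and \<open>p (a a')\<close> are \<open>p (a r) \<epsilon>(b)\<close>, by the previous lemma.
\<close>

lemma p_star_ip:
  assumes "f \<in> Arr M" "Cod M f = Car A" "g \<in> Arr M" "Cod M g = Car A"
  shows "p \<cdot> (f \<star> (i \<cdot> p \<cdot> g)) = p \<cdot> (f \<star> g)"
proof -
  obtain h where h [simp]: "h \<in> Arr M" "Cod M h = Car R \<boxtimes> Car B" and g: "g = \<omega> \<cdot> h"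
    using \<omega>_factor[OF assms(3,4)] by metis
  define X where "X = Dom M f"
  have [simp]: "X \<in> Obj M" "Dom M f = X" "f \<in> Arr M" "Cod M f = Car A"
    using assms by (auto simp: X_def)
  have "f \<star> g = (f \<star> (i \<star> \<sigma>)) \<cdot> (\<langle>X\<rangle> \<otimes> h)"
    by (simp add: g \<omega>_def)
  also have "\<dots> = ((f \<star> i) \<star> \<sigma>) \<cdot> AssocInv M X (Car R) (Car B) \<cdot> (\<langle>X\<rangle> \<otimes> h)"
    by (subst star_assoc(2)[of _ _ _ X "Car R" "Car B"]) simp_all
  finally have "p \<cdot> (f \<star> g) = (p \<cdot> ((f \<star> i) \<star> \<sigma>)) \<cdot> AssocInv M X (Car R) (Car B) \<cdot> (\<langle>X\<rangle> \<otimes> h)"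
    by simp
  also have "\<dots> = p \<cdot> (f \<star> i) \<cdot> Runit M (X \<boxtimes> Car R) \<cdot> ((\<langle>X\<rangle> \<otimes> \<langle>Car R\<rangle>) \<otimes> Counit B)
      \<cdot> AssocInv M X (Car R) (Car B) \<cdot> (\<langle>X\<rangle> \<otimes> h)"
    by (subst p_star_\<sigma>[of _ "X \<boxtimes> Car R"]) simp_all
  also have "\<dots> = p \<cdot> (f \<star> i) \<cdot> (Runit M (X \<boxtimes> Car R) \<cdot> AssocInv M X (Car R) \<I>)
      \<cdot> (\<langle>X\<rangle> \<otimes> (\<langle>Car R\<rangle> \<otimes> Counit B)) \<cdot> (\<langle>X\<rangle> \<otimes> h)"
    using assoc_inv_nat_extend[of "\<langle>X\<rangle>" "\<langle>Car R\<rangle>" "Counit B" X "Car R" \<I> "\<langle>X\<rangle> \<otimes> h"]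
    by (simp del: interchange_extend interchange)
  also have "Runit M (X \<boxtimes> Car R) \<cdot> AssocInv M X (Car R) \<I> = \<langle>X\<rangle> \<otimes> Runit M (Car R)"
    by (simp flip: runit_tensor)
  also have "p \<cdot> (f \<star> i) \<cdot> (\<langle>X\<rangle> \<otimes> Runit M (Car R)) \<cdot> (\<langle>X\<rangle> \<otimes> (\<langle>Car R\<rangle> \<otimes> Counit B)) \<cdot> (\<langle>X\<rangle> \<otimes> h)
      = p \<cdot> (f \<star> (i \<cdot> (Runit M (Car R) \<cdot> (\<langle>Car R\<rangle> \<otimes> Counit B)) \<cdot> h))"
    by simp
  also have "\<dots> = p \<cdot> (f \<star> (i \<cdot> p \<cdot> g))"
    by (simp only: flip: p_\<omega>) (simp add: g)
  finally show ?thesis ..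
qed

text \<open>
  For \<open>a = r' b\<close> right \<open>B\<close>-linearity of \<open>\<pi>\<close> reduces \<open>\<pi> (i(r) a) = \<epsilon>(r) \<pi>(a)\<close> to
  \<open>\<pi> (r r') = \<epsilon>(r) \<epsilon>(r')\<close>, the triviality of \<open>\<xi>\<close>.
\<close>

lemma \<pi>_i_star:
  assumes "f \<in> Arr M" "Cod M f = Car A" "Dom M f = X"
  shows "\<pi> \<cdot> (i \<star> f) = \<pi> \<cdot> f \<cdot> Lunit M X \<cdot> (Counit R \<otimes> \<langle>X\<rangle>)"
proof -
  obtain h where h [simp]: "h \<in> Arr M" "Dom M h = X" "Cod M h = Car R \<boxtimes> Car B" and f: "f = \<omega> \<cdot> h"
    using \<omega>_factor[OF assms(1,2)] assms(3) by metis
  have [simp]: "X \<in> Obj M" using obj_dom[OF h(1)] by simp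
  let ?a = "AssocInv M (Car R) (Car R) (Car B)"
  have "i \<star> f = (i \<star> (i \<star> \<sigma>)) \<cdot> (\<langle>Car R\<rangle> \<otimes> h)"
    by (simp add: f \<omega>_def)
  also have "\<dots> = ((i \<star> i) \<star> (\<sigma> \<cdot> \<langle>Car B\<rangle>)) \<cdot> ?a \<cdot> (\<langle>Car R\<rangle> \<otimes> h)"
    by (subst star_assoc(2)[of _ _ _ "Car R" "Car R" "Car B"]) simp_all
  finally have "\<pi> \<cdot> (i \<star> f) = (\<pi> \<cdot> ((i \<star> i) \<star> (\<sigma> \<cdot> \<langle>Car B\<rangle>))) \<cdot> ?a \<cdot> (\<langle>Car R\<rangle> \<otimes> h)"
    by simp
  also have "\<dots> = (Mul B \<cdot> ((\<pi> \<cdot> (i \<star> i)) \<otimes> \<langle>Car B\<rangle>)) \<cdot> ?a \<cdot> (\<langle>Car R\<rangle> \<otimes> h)"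
    by (subst \<pi>_star) simp_all
  also have "\<dots> = (Mul B \<cdot> (Unit B \<otimes> \<langle>Car B\<rangle>)) \<cdot> (Lunit M \<I> \<otimes> \<langle>Car B\<rangle>)
      \<cdot> ((Counit R \<otimes> Counit R) \<otimes> \<langle>Car B\<rangle>) \<cdot> ?a \<cdot> (\<langle>Car R\<rangle> \<otimes> h)"
    by (simp add: star_def trivial_cocycle unit_mul_eq)
  also have "\<dots> = (Mul B \<cdot> (Unit B \<otimes> \<langle>Car B\<rangle>)) \<cdot> ((Lunit M \<I> \<otimes> \<langle>Car B\<rangle>) \<cdot> AssocInv M \<I> \<I> (Car B))
      \<cdot> (Counit R \<otimes> (Counit R \<otimes> \<langle>Car B\<rangle>)) \<cdot> (\<langle>Car R\<rangle> \<otimes> h)"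
    using assoc_inv_nat_extend[of "Counit R" "Counit R" "\<langle>Car B\<rangle>" \<I> \<I> "Car B" "\<langle>Car R\<rangle> \<otimes> h"]
    by (simp del: interchange_extend interchange)
  also have "(Lunit M \<I> \<otimes> \<langle>Car B\<rangle>) \<cdot> AssocInv M \<I> \<I> (Car B) = Lunit M (\<I> \<boxtimes> Car B)"
    by (simp flip: lunit_tensor)
  also have "(Mul B \<cdot> (Unit B \<otimes> \<langle>Car B\<rangle>)) \<cdot> Lunit M (\<I> \<boxtimes> Car B)
      \<cdot> (Counit R \<otimes> (Counit R \<otimes> \<langle>Car B\<rangle>)) \<cdot> (\<langle>Car R\<rangle> \<otimes> h)
    = Lunit M (Car B) \<cdot> ((\<langle>\<I>\<rangle> \<otimes> ((Lunit M (Car B) \<cdot> (Counit R \<otimes> \<langle>Car B\<rangle>)) \<cdot> h)) \<cdot> (Counit R \<otimes> \<langle>X\<rangle>))"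
    by (simp add: mul_B lunit_slide[of "Lunit M (Car B)"])
  also have "\<dots> = Lunit M (Car B) \<cdot> ((\<langle>\<I>\<rangle> \<otimes> (\<pi> \<cdot> f)) \<cdot> (Counit R \<otimes> \<langle>X\<rangle>))"
    by (simp only: flip: \<pi>_\<omega>) (simp add: f)
  also have "\<dots> = \<pi> \<cdot> f \<cdot> Lunit M X \<cdot> (Counit R \<otimes> \<langle>X\<rangle>)"
    using assms by (simp add: lunit_slide[of f X "Car A"] lunit_slide[of \<pi> "Car A" "Car B"])
  finally show ?thesis .
qed

text \<open>
  For \<open>a = r' b\<close> both \<open>\<pi> (\<sigma>\<pi>(a) i(r))\<close> and \<open>\<pi> (a i(r))\<close> are \<open>\<epsilon>(r') \<pi> (\<sigma>(b) i(r))\<close>, by the previous lemma.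
\<close>

lemma \<pi>_star_i:
  assumes "f \<in> Arr M" "Cod M f = Car A"
  shows "\<pi> \<cdot> ((\<sigma> \<cdot> \<pi> \<cdot> f) \<star> i) = \<pi> \<cdot> (f \<star> i)"
proof -
  obtain h where h [simp]: "h \<in> Arr M" "Cod M h = Car R \<boxtimes> Car B" and f: "f = \<omega> \<cdot> h"
    using \<omega>_factor[OF assms] by metis
  let ?a = "Assoc M (Car R) (Car B) (Car R)"
  have "f \<star> i = ((i \<star> \<sigma>) \<star> i) \<cdot> (h \<otimes> \<langle>Car R\<rangle>)"
    by (simp add: f \<omega>_def)
  also have "\<dots> = (i \<star> (\<sigma> \<star> i)) \<cdot> ?a \<cdot> (h \<otimes> \<langle>Car R\<rangle>)"
    by (subst star_assoc(1)[of _ _ _ "Car R" "Car B" "Car R"]) simp_all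
  finally have "\<pi> \<cdot> (f \<star> i) = (\<pi> \<cdot> (i \<star> (\<sigma> \<star> i))) \<cdot> ?a \<cdot> (h \<otimes> \<langle>Car R\<rangle>)"
    by simp
  also have "\<dots> = ract \<cdot> Lunit M (Car B \<boxtimes> Car R) \<cdot> (Counit R \<otimes> (\<langle>Car B\<rangle> \<otimes> \<langle>Car R\<rangle>)) \<cdot> ?a \<cdot> (h \<otimes> \<langle>Car R\<rangle>)"
    by (subst \<pi>_i_star[of _ "Car B \<boxtimes> Car R"]) (simp_all add: ract_def)
  also have "\<dots> = ract \<cdot> (Lunit M (Car B \<boxtimes> Car R) \<cdot> Assoc M \<I> (Car B) (Car R))
      \<cdot> ((Counit R \<otimes> \<langle>Car B\<rangle>) \<otimes> \<langle>Car R\<rangle>) \<cdot> (h \<otimes> \<langle>Car R\<rangle>)"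
    using assoc_nat_extend[of "Counit R" "\<langle>Car B\<rangle>" "\<langle>Car R\<rangle>" \<I> "Car B" "Car R" "h \<otimes> \<langle>Car R\<rangle>"]
    by (simp del: interchange_extend interchange)
  also have "\<dots> = ract \<cdot> (((Lunit M (Car B) \<cdot> (Counit R \<otimes> \<langle>Car B\<rangle>)) \<cdot> h) \<otimes> \<langle>Car R\<rangle>)"
    by (simp add: lunit_tensor)
  also have "\<dots> = \<pi> \<cdot> ((\<sigma> \<cdot> \<pi> \<cdot> f) \<star> i)"
    by (simp only: flip: \<pi>_\<omega>) (simp add: f ract_def)
  finally show ?thesis ..
qed

end

section \<open>The matched pair and its double cross product\<close>

context cocommutative_weak_projection
begin

lemma cocommutative_extend:
  "k \<in> Arr M \<Longrightarrow> Cod M k = Car A \<Longrightarrow> Braid M (Car A) (Car A) \<cdot> (Comul A \<cdot> k) = Comul A \<cdot> k"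
  using cocommutative_A by (simp add: cocommutative_def flip: assoc_comp)

abbreviation \<Delta>\<^sub>B\<^sub>R where "\<Delta>\<^sub>B\<^sub>R \<equiv> Comul (tensor_coalg M B R)"

text \<open>
  The value on \<open>b \<otimes> r\<close> is \<open>(b\<^sub>1 \<vartriangleright> r\<^sub>1) \<otimes> (b\<^sub>2 \<vartriangleleft> r\<^sub>2)\<close>, the factorization in \<open>R \<otimes> B\<close> of the product
  \<open>b r\<close>.
\<close>

definition swap where "swap = (lact \<otimes> ract) \<cdot> \<Delta>\<^sub>B\<^sub>R"

lemma tensor_coalg_BR_arr [simp]:
  "\<Delta>\<^sub>B\<^sub>R \<in> Arr M" "Dom M \<Delta>\<^sub>B\<^sub>R = Car B \<boxtimes> Car R" "Cod M \<Delta>\<^sub>B\<^sub>R = (Car B \<boxtimes> Car R) \<boxtimes> (Car B \<boxtimes> Car R)"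
  by (simp_all add: tensor_coalg_def)

lemma swap_arr [simp]: "swap \<in> Arr M" "Dom M swap = Car B \<boxtimes> Car R" "Cod M swap = Car R \<boxtimes> Car B"
  by (simp_all add: swap_def)

lemma coalgebra_hom_\<sigma>_star_i: "coalgebra_hom M (tensor_coalg M B R) A (\<sigma> \<star> i)"
  by (intro star_coalgebra_hom types coalgebra_hom_i coalgebra_hom_\<sigma>)

lemma comul_\<sigma>_star_i: "((\<sigma> \<star> i) \<otimes> (\<sigma> \<star> i)) \<cdot> \<Delta>\<^sub>B\<^sub>R = Comul A \<cdot> (\<sigma> \<star> i)"
  using coalgebra_homD(4)[OF coalgebra_hom_\<sigma>_star_i] ..

lemma swap_eq: "swap = (p \<otimes> \<pi>) \<cdot> Comul A \<cdot> (\<sigma> \<star> i)"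
proof -
  have "swap = (p \<otimes> \<pi>) \<cdot> (((\<sigma> \<star> i) \<otimes> (\<sigma> \<star> i)) \<cdot> \<Delta>\<^sub>B\<^sub>R)"
    by (simp add: swap_def lact_def ract_def)
  then show ?thesis
    by (simp only: comul_\<sigma>_star_i)
qed

lemma \<omega>_swap: "\<omega> \<cdot> swap = \<sigma> \<star> i"
proof -
  have "\<omega> \<cdot> swap = \<omega> \<cdot> \<omega>' \<cdot> (\<sigma> \<star> i)"
    by (simp add: swap_eq \<omega>'_def)
  then show ?thesis
    by (simp add: \<omega>_expand)
qed

text \<open>
  Associativity of the action: \<open>b \<vartriangleright> (b' \<vartriangleright> r) = p (b \<cdot> i p(b' r))\<close>, and \<open>i p\<close> may be dropped inside \<open>p\<close>.
\<close>

lemma left_module_coalgebra_lact: "left_module_coalgebra M B R lact"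
proof -
  have "lact \<cdot> (Mul B \<otimes> \<langle>Car R\<rangle>) = p \<cdot> ((\<sigma> \<star> \<sigma>) \<star> i)"
    by (simp add: lact_def \<sigma>_mul star_def)
  also have "\<dots> = (p \<cdot> (\<sigma> \<star> (\<sigma> \<star> i))) \<cdot> Assoc M (Car B) (Car B) (Car R)"
    by (subst star_assoc(1)[of _ _ _ "Car B" "Car B" "Car R"]) simp_all
  also have "p \<cdot> (\<sigma> \<star> (\<sigma> \<star> i)) = p \<cdot> (\<sigma> \<star> (i \<cdot> lact))"
    using p_star_ip[of \<sigma> "\<sigma> \<star> i"] by (simp add: lact_def)
  also have "(p \<cdot> (\<sigma> \<star> (i \<cdot> lact))) \<cdot> Assoc M (Car B) (Car B) (Car R)
      = (p \<cdot> (\<sigma> \<star> i)) \<cdot> (\<langle>Car B\<rangle> \<otimes> lact) \<cdot> Assoc M (Car B) (Car B) (Car R)"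
    by simp
  finally have "lact \<cdot> (Mul B \<otimes> \<langle>Car R\<rangle>) = lact \<cdot> (\<langle>Car B\<rangle> \<otimes> lact) \<cdot> Assoc M (Car B) (Car B) (Car R)"
    by (simp only: lact_def)
  moreover have "lact \<cdot> (Unit B \<otimes> \<langle>Car R\<rangle>) = p \<cdot> ((Unit A \<cdot> \<langle>\<I>\<rangle>) \<star> i)"
    by (simp add: lact_def \<sigma>_unit)
  then have "lact \<cdot> (Unit B \<otimes> \<langle>Car R\<rangle>) = Lunit M (Car R)"
    by (simp add: star_unit(2)[of i "Car R" _ \<I>] del: comp_ident_right) simp
  moreover have "coalgebra_hom M (tensor_coalg M B R) R lact"
    unfolding lact_def
    by (rule coalgebra_hom_comp[OF _ _ _ coalgebra_hom_\<sigma>_star_i coalgebra_hom_p])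
      (intro types tensor_coalg_type)+
  ultimately show ?thesis
    using bialgebra_R by (simp add: left_module_coalgebra_def bialgebra_def Hom_iff)
qed

text \<open>
  Associativity of the action: \<open>(b \<vartriangleleft> r) \<vartriangleleft> r' = \<pi> (\<sigma>\<pi>(b r) r')\<close>, and \<open>\<sigma>\<pi>\<close> may be dropped inside \<open>\<pi>\<close>.
\<close>

lemma right_module_coalgebra_ract: "right_module_coalgebra M R B ract"
proof -
  have "ract \<cdot> (\<langle>Car B\<rangle> \<otimes> Mul R) \<cdot> Assoc M (Car B) (Car R) (Car R)
      = \<pi> \<cdot> (\<sigma> \<star> (i \<star> i)) \<cdot> Assoc M (Car B) (Car R) (Car R)"
    by (simp add: ract_def i_mul)
  also have "\<dots> = \<pi> \<cdot> ((\<sigma> \<star> i) \<star> i)"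
    by (subst star_assoc(1)[of _ _ _ "Car B" "Car R" "Car R"]) simp_all
  also have "\<dots> = \<pi> \<cdot> ((\<sigma> \<cdot> ract) \<star> i)"
    using \<pi>_star_i[of "\<sigma> \<star> i"] by (simp add: ract_def)
  also have "\<dots> = ract \<cdot> (ract \<otimes> \<langle>Car R\<rangle>)"
    by (simp add: ract_def)
  finally have "ract \<cdot> (ract \<otimes> \<langle>Car R\<rangle>)
    = ract \<cdot> (\<langle>Car B\<rangle> \<otimes> Mul R) \<cdot> Assoc M (Car B) (Car R) (Car R)" ..
  moreover have "ract \<cdot> (\<langle>Car B\<rangle> \<otimes> Unit R) = \<pi> \<cdot> (\<sigma> \<star> (Unit A \<cdot> \<langle>\<I>\<rangle>))"
    by (simp add: ract_def i_unit)
  then have "ract \<cdot> (\<langle>Car B\<rangle> \<otimes> Unit R) = Runit M (Car B)"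
    by (simp add: star_unit(1)[of \<sigma> "Car B" _ \<I>] del: comp_ident_right) simp
  moreover have "coalgebra_hom M (tensor_coalg M B R) B ract"
    unfolding ract_def
    by (rule coalgebra_hom_comp[OF _ _ _ coalgebra_hom_\<sigma>_star_i hom_\<pi>])
      (intro types tensor_coalg_type)+
  ultimately show ?thesis
    using bialgebra_B by (simp add: right_module_coalgebra_def bialgebra_def Hom_iff)
qed

lemma ract_unit: "ract \<cdot> (Unit B \<otimes> \<langle>Car R\<rangle>) = Unit B \<cdot> Counit R \<cdot> Lunit M (Car R)"
proof -
  have "ract \<cdot> (Unit B \<otimes> \<langle>Car R\<rangle>) = \<pi> \<cdot> ((Unit A \<cdot> \<langle>\<I>\<rangle>) \<star> i)"
    by (simp add: ract_def \<sigma>_unit)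
  also have "\<dots> = (\<pi> \<cdot> i) \<cdot> Lunit M (Car R)"
    by (simp add: star_unit(2)[of i "Car R" _ \<I>] del: comp_ident_right) simp
  finally show ?thesis
    by (simp add: \<pi>_i)
qed

lemma lact_unit: "lact \<cdot> (\<langle>Car B\<rangle> \<otimes> Unit R) = Unit R \<cdot> Counit B \<cdot> Runit M (Car B)"
proof -
  have "lact \<cdot> (\<langle>Car B\<rangle> \<otimes> Unit R) = p \<cdot> (\<sigma> \<star> (Unit A \<cdot> \<langle>\<I>\<rangle>))"
    by (simp add: lact_def i_unit)
  also have "\<dots> = p \<cdot> \<sigma> \<cdot> Runit M (Car B)"
    by (simp add: star_unit(1)[of \<sigma> "Car B" _ \<I>] del: comp_ident_right) simp
  finally have l: "lact \<cdot> (\<langle>Car B\<rangle> \<otimes> Unit R) = (p \<cdot> \<sigma>) \<cdot> Runit M (Car B)"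
    by simp
  \<comment> \<open>\<open>p \<sigma>\<close> is trivial: take the unit of \<open>A\<close> as the left factor in \<open>p_star_\<sigma>\<close>.\<close>
  have "(p \<cdot> \<sigma>) \<cdot> Lunit M (Car B) = p \<cdot> ((Unit A \<cdot> \<langle>\<I>\<rangle>) \<star> \<sigma>)"
    by (simp add: star_unit(2)[of \<sigma> "Car B" _ \<I>] del: comp_ident_right) simp
  also have "\<dots> = p \<cdot> Unit A \<cdot> Runit M \<I> \<cdot> (\<langle>\<I>\<rangle> \<otimes> Counit B)"
    by (subst p_star_\<sigma>[of _ \<I>]) simp_all
  also have "\<dots> = (Unit R \<cdot> Counit B) \<cdot> Lunit M (Car B)"
    by (simp add: Unit_R lunit_slide[of "Counit B" "Car B" \<I>] lunit_unit_eq_runit_unit)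
  finally have "(p \<cdot> \<sigma>) \<cdot> Lunit M (Car B) = (Unit R \<cdot> Counit B) \<cdot> Lunit M (Car B)" .
  then have "p \<cdot> \<sigma> = Unit R \<cdot> Counit B"
    by (rule iso_cancel_right[rotated]) simp_all
  then show ?thesis
    by (simp only: l) simp
qed

text \<open>
  In \<open>\<pi> (b (b' r))\<close> the inner product is rewritten by \<open>\<omega>_swap\<close>; the rest is right \<open>B\<close>-linearity of \<open>\<pi>\<close>.
\<close>

lemma ract_mul:
  "Mul B \<cdot> (ract \<otimes> \<langle>Car B\<rangle>) \<cdot> AssocInv M (Car B) (Car R) (Car B) \<cdot> (\<langle>Car B\<rangle> \<otimes> (lact \<otimes> ract))
     \<cdot> (\<langle>Car B\<rangle> \<otimes> \<Delta>\<^sub>B\<^sub>R) \<cdot> Assoc M (Car B) (Car B) (Car R)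
   = ract \<cdot> (Mul B \<otimes> \<langle>Car R\<rangle>)"
proof -
  let ?a = "Assoc M (Car B) (Car B) (Car R)" and ?b = "AssocInv M (Car B) (Car R) (Car B)"
  have "ract \<cdot> (Mul B \<otimes> \<langle>Car R\<rangle>) = \<pi> \<cdot> ((\<sigma> \<star> \<sigma>) \<star> i)"
    by (simp add: ract_def \<sigma>_mul star_def)
  also have "\<dots> = \<pi> \<cdot> (\<sigma> \<star> (\<omega> \<cdot> swap)) \<cdot> ?a"
    by (simp add: \<omega>_swap star_assoc(1)[of \<sigma> \<sigma> i "Car B" "Car B" "Car R"])
  also have "\<dots> = (\<pi> \<cdot> (\<sigma> \<star> (i \<star> \<sigma>))) \<cdot> (\<langle>Car B\<rangle> \<otimes> swap) \<cdot> ?a"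
    by (simp add: \<omega>_def)
  also have "\<dots> = (\<pi> \<cdot> ((\<sigma> \<star> i) \<star> (\<sigma> \<cdot> \<langle>Car B\<rangle>))) \<cdot> ?b \<cdot> (\<langle>Car B\<rangle> \<otimes> swap) \<cdot> ?a"
    by (subst star_assoc(2)[of _ _ _ "Car B" "Car R" "Car B"]) simp_all
  also have "\<dots> = (Mul B \<cdot> (ract \<otimes> \<langle>Car B\<rangle>)) \<cdot> ?b \<cdot> (\<langle>Car B\<rangle> \<otimes> swap) \<cdot> ?a"
    by (subst \<pi>_star) (simp_all add: ract_def)
  finally show ?thesis
    by (simp add: swap_def)
qed

text \<open>
  In \<open>p ((b r) r')\<close> the inner product is rewritten by \<open>\<omega>_swap\<close>; then the factor from \<open>B\<close> is grouped
  with \<open>r'\<close>, and \<open>p_star_ip\<close> turns their product into the action.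
\<close>

lemma lact_mul:
  "Mul R \<cdot> (\<langle>Car R\<rangle> \<otimes> lact) \<cdot> Assoc M (Car R) (Car B) (Car R)
     \<cdot> ((lact \<otimes> ract) \<otimes> \<langle>Car R\<rangle>) \<cdot> (\<Delta>\<^sub>B\<^sub>R \<otimes> \<langle>Car R\<rangle>)
   = lact \<cdot> (\<langle>Car B\<rangle> \<otimes> Mul R) \<cdot> Assoc M (Car B) (Car R) (Car R)"
proof -
  let ?a = "Assoc M (Car R) (Car B) (Car R)"
  have "lact \<cdot> (\<langle>Car B\<rangle> \<otimes> Mul R) \<cdot> Assoc M (Car B) (Car R) (Car R)
      = p \<cdot> (\<sigma> \<star> (i \<star> i)) \<cdot> Assoc M (Car B) (Car R) (Car R)"
    by (simp add: lact_def i_mul)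
  also have "\<dots> = p \<cdot> ((\<omega> \<cdot> swap) \<star> i)"
    by (simp add: \<omega>_swap star_assoc(1)[of \<sigma> i i "Car B" "Car R" "Car R"])
  also have "\<dots> = p \<cdot> ((i \<star> \<sigma>) \<star> i) \<cdot> (swap \<otimes> \<langle>Car R\<rangle>)"
    by (simp add: \<omega>_def)
  also have "\<dots> = (p \<cdot> (i \<star> (\<sigma> \<star> i))) \<cdot> ?a \<cdot> (swap \<otimes> \<langle>Car R\<rangle>)"
    by (subst star_assoc(1)[of _ _ _ "Car R" "Car B" "Car R"]) simp_all
  also have "p \<cdot> (i \<star> (\<sigma> \<star> i)) = p \<cdot> (i \<star> (i \<cdot> lact))"
    using p_star_ip[of i "\<sigma> \<star> i"] by (simp add: lact_def)
  also have "\<dots> = Mul R \<cdot> (\<langle>Car R\<rangle> \<otimes> lact)"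
    by (simp add: Mul_R star_def)
  finally show ?thesis
    by (simp add: swap_def)
qed

lemma swap_braid: "(ract \<otimes> lact) \<cdot> \<Delta>\<^sub>B\<^sub>R = Braid M (Car R) (Car B) \<cdot> (lact \<otimes> ract) \<cdot> \<Delta>\<^sub>B\<^sub>R"
proof -
  have "(ract \<otimes> lact) \<cdot> \<Delta>\<^sub>B\<^sub>R = (\<pi> \<otimes> p) \<cdot> (((\<sigma> \<star> i) \<otimes> (\<sigma> \<star> i)) \<cdot> \<Delta>\<^sub>B\<^sub>R)"
    by (simp add: lact_def ract_def)
  also have "\<dots> = (\<pi> \<otimes> p) \<cdot> Braid M (Car A) (Car A) \<cdot> Comul A \<cdot> (\<sigma> \<star> i)"
    by (simp only: comul_\<sigma>_star_i) (simp add: cocommutative_extend)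
  also have "\<dots> = Braid M (Car R) (Car B) \<cdot> swap"
    by (subst swap_eq, subst braid_nat_extend) simp_all
  finally show ?thesis
    by (simp only: swap_def)
qed

lemma matched_pair_RB: "matched_pair M R B lact ract"
  unfolding matched_pair_def
  using bialgebra_R bialgebra_B left_module_coalgebra_lact right_module_coalgebra_ract
    ract_unit lact_unit ract_mul lact_mul swap_braid
  by (intro conjI)

text \<open>
  The two bracketings of a product of four arrows that occur in the multiplication of the double cross product.
\<close>

lemma star_ungroup:
  assumes "f \<in> Arr M" "Cod M f = Car A" "Dom M f = X" "g \<in> Arr M" "Cod M g = Car A" "Dom M g = Y"
    "h \<in> Arr M" "Cod M h = Car A" "Dom M h = Z" "k \<in> Arr M" "Cod M k = Car A" "Dom M k = W"
  shows "((f \<star> g) \<star> (h \<star> k)) \<cdot> ungroup M X Y Z W = f \<star> ((g \<star> h) \<star> k)"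
    and "(f \<star> ((g \<star> h) \<star> k)) \<cdot> regroup M X Y Z W = (f \<star> g) \<star> (h \<star> k)"
proof -
  have [simp]: "X \<in> Obj M" "Y \<in> Obj M" "Z \<in> Obj M" "W \<in> Obj M"
    using assms by auto
  note [simp] = assms
  have "((f \<star> g) \<star> (h \<star> k)) \<cdot> ungroup M X Y Z W
      = (((f \<star> g) \<star> (h \<star> k)) \<cdot> AssocInv M X Y (Z \<boxtimes> W)) \<cdot> (\<langle>X\<rangle> \<otimes> Assoc M Y Z W)"
    by (simp add: ungroup_def)
  also have "\<dots> = (f \<star> (g \<star> (h \<star> k))) \<cdot> (\<langle>X\<rangle> \<otimes> Assoc M Y Z W)"
    by (subst star_assoc(2)[of _ _ _ X Y "Z \<boxtimes> W"]) simp_all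
  also have "\<dots> = f \<star> ((g \<star> h) \<star> k)"
    by (simp add: star_assoc(1)[of g h k Y Z W])
  finally show u: "((f \<star> g) \<star> (h \<star> k)) \<cdot> ungroup M X Y Z W = f \<star> ((g \<star> h) \<star> k)" .
  have "(f \<star> ((g \<star> h) \<star> k)) \<cdot> regroup M X Y Z W
      = ((f \<star> g) \<star> (h \<star> k)) \<cdot> ungroup M X Y Z W \<cdot> regroup M X Y Z W"
    by (simp flip: u)
  also have "ungroup M X Y Z W \<cdot> regroup M X Y Z W = \<langle>(X \<boxtimes> Y) \<boxtimes> (Z \<boxtimes> W)\<rangle>"
    by (simp add: ungroup_def regroup_def)
  finally show "(f \<star> ((g \<star> h) \<star> k)) \<cdot> regroup M X Y Z W = (f \<star> g) \<star> (h \<star> k)"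
    by simp
qed

text \<open>
  \<open>\<omega>\<close> is multiplicative since \<open>r (b r') b' = r (b\<^sub>1 \<vartriangleright> r'\<^sub>1) (b\<^sub>2 \<vartriangleleft> r'\<^sub>2) b'\<close>.
\<close>

lemma isomorphic_double_cross_product:
  "isomorphic_bialgebras M A (double_cross_product M R B lact ract)"
proof -
  let ?D = "double_cross_product M R B lact ract"
  have Car_D: "Car ?D = Car R \<boxtimes> Car B"
    by (simp add: double_cross_product_def)
  have "Mul ?D = (Mul R \<otimes> Mul B) \<cdot> ungroup M (Car R) (Car R) (Car B) (Car B)
      \<cdot> (\<langle>Car R\<rangle> \<otimes> (swap \<otimes> \<langle>Car B\<rangle>)) \<cdot> regroup M (Car R) (Car B) (Car R) (Car B)"
    by (simp add: double_cross_product_def swap_def)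
  then have "\<omega> \<cdot> Mul ?D = (((i \<star> i) \<star> (\<sigma> \<star> \<sigma>)) \<cdot> ungroup M (Car R) (Car R) (Car B) (Car B))
      \<cdot> (\<langle>Car R\<rangle> \<otimes> (swap \<otimes> \<langle>Car B\<rangle>)) \<cdot> regroup M (Car R) (Car B) (Car R) (Car B)"
    by (simp add: \<omega>_def i_mul) (simp add: \<sigma>_mul flip: star_def)
  also have "\<dots> = (i \<star> ((\<omega> \<cdot> swap) \<star> \<sigma>)) \<cdot> regroup M (Car R) (Car B) (Car R) (Car B)"
    by (subst star_ungroup(1)) (simp_all add: \<omega>_def)
  also have "\<dots> = \<omega> \<star> \<omega>"
    unfolding \<omega>_swap by (subst star_ungroup(2)) (simp_all add: \<omega>_def)
  finally have mul: "\<omega> \<cdot> Mul ?D = Mul A \<cdot> (\<omega> \<otimes> \<omega>)"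
    by (simp add: star_def)
  have "\<omega> \<cdot> Unit ?D = (Unit A \<star> (Unit A \<cdot> \<langle>\<I>\<rangle>)) \<cdot> unit_comul M"
    by (simp add: double_cross_product_def \<omega>_def i_unit \<sigma>_unit)
  also have "\<dots> = Unit A \<cdot> (unit_mul M \<cdot> unit_comul M)"
    by (simp add: star_unit(1)[of "Unit A" \<I> _ \<I>] unit_mul_eq lunit_unit_eq_runit_unit
        del: comp_ident_right arr_unit_comul(7))
  finally have unit: "\<omega> \<cdot> Unit ?D = Unit A"
    by simp
  have alg: "algebra_type ?D"
    by (simp add: algebra_type_def double_cross_product_def Hom_iff)
  have coalg: "coalgebra_type ?D"
    by (simp add: coalgebra_type_def double_cross_product_def Hom_iff)
  have hom: "algebra_hom M ?D A \<omega>"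
    unfolding algebra_hom_def Car_D mul unit by (simp add: Hom_iff)
  have cohom: "coalgebra_hom M ?D A \<omega>"
    using coalgebra_hom_\<omega> by (simp add: coalgebra_hom_def double_cross_product_def tensor_coalg_def)
  have D: "bialgebra M ?D"
    by (rule bialgebra_transport[OF bialgebra_A alg coalg hom cohom, of \<omega>']) (simp_all add: Car_D)
  have "bialgebra_hom M ?D A \<omega>"
    using hom cohom by (simp add: bialgebra_hom_def)
  from inverse_bialgebra_hom[OF D bialgebra_A this iso_\<omega>] show ?thesis
    using D bialgebra_A unfolding isomorphic_bialgebras_def by blast
qed

end

theorem theorem2p16:
  fixes M :: "('o, 'a, 'm) braided_cat_scheme" (structure)
    and A B R :: "('o, 'a) bialg"
    and S\<^sub>B \<sigma> \<pi> i p \<Phi> \<Pi>\<^sub>2 \<xi> la ra :: 'a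
  assumes "abelian_coabelian_braided_monoidal_category M"
    and "bialgebra M A"
    and "bialgebra M B" and "antipode M B S\<^sub>B"
    and "bialgebra_hom M B A \<sigma>" and "monomorphism M \<sigma>"
    and "right_weak_projection M A B \<sigma> \<pi>"
    and "\<Phi> = \<sigma> \<cdot> S\<^sub>B \<cdot> \<pi>"
    and "\<Pi>\<^sub>2 = Mul A \<cdot> (\<langle>Car A\<rangle> \<otimes> \<Phi>) \<cdot> Comul A"
    and "i \<in> Hom M (Car R) (Car A)"
    and "is_equalizer M i ((\<langle>Car A\<rangle> \<otimes> \<pi>) \<cdot> Comul A)
           ((\<langle>Car A\<rangle> \<otimes> Unit B) \<cdot> inverse_arrow M (Runit M (Car A)))"
    and "p \<in> Hom M (Car A) (Car R)" and "i \<cdot> p = \<Pi>\<^sub>2" and "p \<cdot> i = \<langle>Car R\<rangle>"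
    and "Mul R = p \<cdot> Mul A \<cdot> (i \<otimes> i)"
    and "Unit R = p \<cdot> Unit A"
    and "Comul R = (p \<otimes> p) \<cdot> Comul A \<cdot> i"
    and "Counit R = Counit A \<cdot> i"
    and "\<xi> = \<pi> \<cdot> Mul A \<cdot> (i \<otimes> i)"
    and "cocommutative M A"
    and "\<xi> = Unit B \<cdot> unit_mul M \<cdot> (Counit R \<otimes> Counit R)"
    and "la = p \<cdot> Mul A \<cdot> (\<sigma> \<otimes> i)"
    and "ra = \<pi> \<cdot> Mul A \<cdot> (\<sigma> \<otimes> i)"
  shows "matched_pair M R B la ra \<and> isomorphic_bialgebras M A (double_cross_product M R B la ra)"
proof -
  interpret abelian_coabelian_braided_monoidal_category M by fact
  interpret cocommutative_weak_projection M A B R S\<^sub>B \<sigma> \<pi> i p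
    by unfold_locales (use assms in simp_all)
  have "la = lact" "ra = ract"
    using assms(22,23) by (simp_all add: lact_def ract_def star_def)
  then show ?thesis
    using matched_pair_RB isomorphic_double_cross_product by simp
qed

end
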